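(* Let $Q$ be an affine monoid and $\mathbb{K}$ a field. Let $U \subseteq M \subseteq \mathbb{K}[\mathbb{Z}Q]$ be finitely generated $\mathbb{Z}Q$-graded $\mathbb{K}[Q]$-modules and let $N := M/U$. For each $\mathfrak{p} \in \operatorname{Ass} N$, let $r_{\mathfrak{p}}$ denote its multiplicity on $N$ and let $F_{\mathfrak{p}}$ denote the corresponding face of $Q$. Then there are elements $q_{\mathfrak{p},i} \in \mathbb{Z}Q$ (for $\mathfrak{p} \in \operatorname{Ass} N$, $1 \le i \le r_{\mathfrak{p}}$) such that $$\operatorname{Supp} N = \bigcup_{\mathfrak{p} \in \operatorname{Ass} N}\ \bigcup_{i=1}^{r_{\mathfrak{p}}} \bigl(\mathbb{Z}F_{\mathfrak{p}} + q_{\mathfrak{p},i}\bigr) \cap \operatorname{Supp} M .$$ This union is irredundant (none of the sets $\mathbb{Z}F_{\mathfrak{p}} + q_{\mathfrak{p},i}$ can be omitted), and it is unique as a union of sets: if $\operatorname{Supp} N = \bigcup_{j=1}^{l} (\mathbb{Z}G_j + p_j) \cap \operatorname{Supp} M$ is any irredundant finite union with faces $G_j$ of $Q$ and $p_j \in \mathbb{Z}Q$, then the sets $\mathbb{Z}G_j + p_j$ are exactly the sets $\mathbb{Z}F_{\mathfrak{p}} + q_{\mathfrak{p},i}$.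
   Context: An affine monoid $Q$ is a finitely generated submonoid of the additive monoid $\mathbb{Z}^N$ for some $N\in\mathbb{N}$; $\mathbb{Z}Q$ is the group it generates and $\mathbb{K}[Q]$ its monoid algebra, with monomials $\mathbf{x}^q$, $q\in Q$, and its natural $\mathbb{Z}Q$-grading. A face of $Q$ is a subset $F \subseteq Q$ such that for all $a,b\in Q$: $a+b\in F \Leftrightarrow a,b\in F$ (nonempty; $Q$ itself is a face); $\mathbb{Z}F$ is the group generated by $F$. For a face $F$, $\mathfrak{p}_F\subseteq \mathbb{K}[Q]$ is the prime ideal spanned as a vector space by the monomials $\mathbf{x}^q$ with $q \in Q\setminus F$; the graded prime ideals of $\mathbb{K}[Q]$ are exactly the $\mathfrak{p}_F$, and the face corresponding to $\mathfrak{p}=\mathfrak{p}_F$ is $F_{\mathfrak{p}}=F$. Modules $U\subseteq M$ are graded $\mathbb{K}[Q]$-submodules of $\mathbb{K}[\mathbb{Z}Q]$. For a $\mathbb{Z}Q$-graded module $N$, $\operatorname{Supp} N\subseteq\mathbb{Z}Q$ is the set of degrees $q$ with $N_q\neq 0$. The multiplicity $r_{\mathfrak{p}}$ of $\mathfrak{p}$ on $N$ is the graded length of $H^0_{\mathfrak{p}}(N_{(\mathfrak{p})})$ over the homogeneous localization $\mathbb{K}[Q]_{(\mathfrak{p})}$ (equivalently the length of $H^0_{\mathfrak{p}}(N_{\mathfrak{p}})$ over the local ring $\mathbb{K}[Q]_{\mathfrak{p}}$). *)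

theory Defs
  imports
    "HOL-Algebra.Module"
    "HOL-Algebra.Ideal_Product"
    "HOL-Algebra.Generated_Groups"
    "HOL-Library.Poly_Mapping"
    "HOL-Library.Extended_Nat"
    "HOL-Computational_Algebra.Group_Closure"
    "HOL-Analysis.Finite_Cartesian_Product"
begin

section \<open>Modules over a commutative ring\<close>

definition finitely_generated_module ::
    "('r, 'c) ring_scheme \<Rightarrow> ('r, 'm, 'd) module_scheme \<Rightarrow> bool"
  where "finitely_generated_module R M \<longleftrightarrow>
    (\<exists>A. finite A \<and> A \<subseteq> carrier M \<and> carrier M = (\<lambda>H. submodule H R M) hull A)"

definition self_module :: "('r, 'c) ring_scheme \<Rightarrow> ('r, 'r) module"
  where "self_module R = \<lparr>carrier = carrier R, mult = mult R, one = one R,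
    zero = zero R, add = add R, smult = mult R\<rparr>"

text \<open>
  Records of type \<open>module\<close> extend ring records; the fields \<open>mult\<close> and \<open>one\<close> play no
  role in the locale \<open>module\<close> of HOL-Algebra and are left undefined.
\<close>

definition quotient_module ::
    "('r, 'm, 'd) module_scheme \<Rightarrow> 'm set \<Rightarrow> ('r, 'm set) module"
  where "quotient_module M U = \<lparr>carrier = a_rcosets\<^bsub>M\<^esub> U, mult = undefined, one = undefined,
    zero = U, add = set_add M, smult = (\<lambda>r X. \<Union>x\<in>X. U +>\<^bsub>M\<^esub> (r \<odot>\<^bsub>M\<^esub> x))\<rparr>"

definition associated_primes ::
    "('r, 'c) ring_scheme \<Rightarrow> ('r, 'm, 'd) module_scheme \<Rightarrow> 'r set set"
  where "associated_primes R N =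
    {p. primeideal p R \<and> (\<exists>x\<in>carrier N. p = {r \<in> carrier R. r \<odot>\<^bsub>N\<^esub> x = \<zero>\<^bsub>N\<^esub>})}"

text \<open>The submodule \<open>H\<^sup>0\<^sub>I(N)\<close> of elements killed by a power of the ideal \<open>I\<close>.\<close>

definition local_cohomology0 ::
    "('r, 'c) ring_scheme \<Rightarrow> 'r set \<Rightarrow> ('r, 'm, 'd) module_scheme \<Rightarrow> 'm set"
  where "local_cohomology0 R I N =
    {x \<in> carrier N. \<exists>n::nat. \<forall>r \<in> I [^]\<^bsub>ideals_set R\<^esub> n. r \<odot>\<^bsub>N\<^esub> x = \<zero>\<^bsub>N\<^esub>}"


section \<open>Localization\<close>

definition fraction_rel ::
    "('r, 'c) ring_scheme \<Rightarrow> 'r set \<Rightarrow> ('r, 'm, 'd) module_scheme \<Rightarrow> (('m \<times> 'r) \<times> ('m \<times> 'r)) set"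
  where "fraction_rel R S N = {((x, s), (y, t)).
    x \<in> carrier N \<and> s \<in> S \<and> y \<in> carrier N \<and> t \<in> S \<and>
    (\<exists>u\<in>S. u \<odot>\<^bsub>N\<^esub> (t \<odot>\<^bsub>N\<^esub> x) = u \<odot>\<^bsub>N\<^esub> (s \<odot>\<^bsub>N\<^esub> y))}"

definition fraction ::
    "('r, 'c) ring_scheme \<Rightarrow> 'r set \<Rightarrow> ('r, 'm, 'd) module_scheme \<Rightarrow> 'm \<Rightarrow> 'r \<Rightarrow> ('m \<times> 'r) set"
  where "fraction R S N x s = fraction_rel R S N `` {(x, s)}"

text \<open>
  \<open>S\<^sup>-\<^sup>1N\<close>, for a multiplicative subset \<open>S\<close> of \<open>R\<close>. A fraction is an equivalence class,
  and the unions below range over the representatives of such classes.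
\<close>

definition localized_module ::
    "('r, 'c) ring_scheme \<Rightarrow> 'r set \<Rightarrow> ('r, 'm, 'd) module_scheme \<Rightarrow>
     (('r \<times> 'r) set, ('m \<times> 'r) set) module"
  where "localized_module R S N = \<lparr>
    carrier = {fraction R S N x s | x s. x \<in> carrier N \<and> s \<in> S},
    mult = undefined, one = undefined,
    zero = fraction R S N \<zero>\<^bsub>N\<^esub> \<one>\<^bsub>R\<^esub>,
    add = (\<lambda>X Y. \<Union>(x, s)\<in>X. \<Union>(y, t)\<in>Y.
      fraction R S N (t \<odot>\<^bsub>N\<^esub> x \<oplus>\<^bsub>N\<^esub> s \<odot>\<^bsub>N\<^esub> y) (s \<otimes>\<^bsub>R\<^esub> t)),
    smult = (\<lambda>X Y. \<Union>(a, s)\<in>X. \<Union>(y, t)\<in>Y.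
      fraction R S N (a \<odot>\<^bsub>N\<^esub> y) (s \<otimes>\<^bsub>R\<^esub> t))\<rparr>"

definition localized_ring :: "('r, 'c) ring_scheme \<Rightarrow> 'r set \<Rightarrow> ('r \<times> 'r) set ring"
  where "localized_ring R S = (let L = localized_module R S (self_module R) in
    \<lparr>carrier = carrier L, mult = smult L, one = fraction R S (self_module R) \<one>\<^bsub>R\<^esub> \<one>\<^bsub>R\<^esub>,
     zero = zero L, add = add L\<rparr>)"

definition extended_ideal ::
    "('r, 'c) ring_scheme \<Rightarrow> 'r set \<Rightarrow> 'r set \<Rightarrow> ('r \<times> 'r) set set"
  where "extended_ideal R S I = {fraction R S (self_module R) a s | a s. a \<in> I \<and> s \<in> S}"


section \<open>Graded modules\<close>

text \<open>
  A grading of a module is given by the family of its homogeneous components, indexed by a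
  group \<open>'g\<close>; each component contains zero.
\<close>

definition graded_submodule ::
    "('r, 'c) ring_scheme \<Rightarrow> ('r, 'm, 'd) module_scheme \<Rightarrow> ('g \<Rightarrow> 'm set) \<Rightarrow> 'm set \<Rightarrow> bool"
  where "graded_submodule R M MC H \<longleftrightarrow>
    submodule H R M \<and> H \<subseteq> generate (add_monoid M) (\<Union>g. H \<inter> MC g)"

definition quotient_grading ::
    "('r, 'm, 'd) module_scheme \<Rightarrow> ('g \<Rightarrow> 'm set) \<Rightarrow> 'm set \<Rightarrow> 'g \<Rightarrow> 'm set set"
  where "quotient_grading M MC U g = (\<lambda>m. U +>\<^bsub>M\<^esub> m) ` MC g"

definition localized_grading ::
    "('r, 'c) ring_scheme \<Rightarrow> ('g \<Rightarrow> 'r set) \<Rightarrow> 'r set \<Rightarrow>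
     ('r, 'm, 'd) module_scheme \<Rightarrow> ('g::ab_group_add \<Rightarrow> 'm set) \<Rightarrow> 'g \<Rightarrow> ('m \<times> 'r) set set"
  where "localized_grading R RC S N NC g =
    {fraction R S N x s | x s h d. x \<in> NC h \<and> s \<in> S \<inter> RC d \<and> g = h - d}"

definition Supp :: "('r, 'm, 'd) module_scheme \<Rightarrow> ('g \<Rightarrow> 'm set) \<Rightarrow> 'g set"
  where "Supp N NC = {g. NC g \<noteq> {\<zero>\<^bsub>N\<^esub>}}"

definition graded_length ::
    "('r, 'c) ring_scheme \<Rightarrow> ('r, 'm, 'd) module_scheme \<Rightarrow> ('g \<Rightarrow> 'm set) \<Rightarrow> enat"
  where "graded_length R N NC = Sup {enat n | n.
    \<exists>L :: nat \<Rightarrow> 'm set. (\<forall>i\<le>n. graded_submodule R N NC (L i)) \<and> (\<forall>i<n. L i \<subset> L (Suc i))}"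

text \<open>
  The graded length of \<open>H\<^sup>0\<^sub>p(N\<^sub>(\<^sub>p\<^sub>))\<close> over \<open>R\<^sub>(\<^sub>p\<^sub>)\<close>, where the subscript \<open>(p)\<close> denotes the
  homogeneous localization, inverting the homogeneous elements outside \<open>p\<close>.
\<close>

definition multiplicity_on ::
    "('r, 'c) ring_scheme \<Rightarrow> ('g \<Rightarrow> 'r set) \<Rightarrow>
     ('r, 'm, 'd) module_scheme \<Rightarrow> ('g::ab_group_add \<Rightarrow> 'm set) \<Rightarrow> 'r set \<Rightarrow> enat"
  where "multiplicity_on R RC N NC p =
    (let S = (\<Union>g. RC g) - p;
         A = localized_ring R S;
         X = localized_module R S N;
         H = local_cohomology0 A (extended_ideal R S p) X
     in graded_length A (X\<lparr>carrier := H\<rparr>) (\<lambda>g. H \<inter> localized_grading R RC S N NC g))"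


section \<open>Affine monoids and their algebras\<close>

definition affine_monoid :: "(int ^ 'n) set \<Rightarrow> bool"
  where "affine_monoid Q \<longleftrightarrow>
    (\<exists>A. finite A \<and> Q = (\<lambda>H. 0 \<in> H \<and> (\<forall>a\<in>H. \<forall>b\<in>H. a + b \<in> H)) hull A)"

definition is_face :: "'g::ab_group_add set \<Rightarrow> 'g set \<Rightarrow> bool"
  where "is_face Q F \<longleftrightarrow> F \<noteq> {} \<and> F \<subseteq> Q \<and>
    (\<forall>a\<in>Q. \<forall>b\<in>Q. a + b \<in> F \<longleftrightarrow> a \<in> F \<and> b \<in> F)"

text \<open>
  For a submonoid \<open>B\<close> of \<open>'g\<close>, the monoid algebra \<open>K[B]\<close> is the subring of the group algebra
  \<open>'g \<Rightarrow>\<^sub>0 'k\<close> of elements with exponents in \<open>B\<close>, and its component of degree \<open>g\<close> is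
  spanned by the monomial with exponent \<open>g\<close> if \<open>g \<in> B\<close>, and zero otherwise.
\<close>

definition monoid_algebra :: "'g::ab_group_add set \<Rightarrow> ('g \<Rightarrow>\<^sub>0 'k::field) ring"
  where "monoid_algebra B = \<lparr>carrier = {f. Poly_Mapping.keys f \<subseteq> B},
    mult = (*), one = 1, zero = 0, add = (+)\<rparr>"

definition monoid_algebra_grading :: "'g::ab_group_add set \<Rightarrow> 'g \<Rightarrow> ('g \<Rightarrow>\<^sub>0 'k::field) set"
  where "monoid_algebra_grading B g = {f. Poly_Mapping.keys f \<subseteq> B \<inter> {g}}"

definition face_prime :: "'g::ab_group_add set \<Rightarrow> 'g set \<Rightarrow> ('g \<Rightarrow>\<^sub>0 'k::field) set"
  where "face_prime Q F = {f. Poly_Mapping.keys f \<subseteq> Q - F}"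

definition face_of_prime :: "'g::ab_group_add set \<Rightarrow> ('g \<Rightarrow>\<^sub>0 'k::field) set \<Rightarrow> 'g set"
  where "face_of_prime Q p = (THE F. is_face Q F \<and> p = face_prime Q F)"

text \<open>\<open>\<int>F + q\<close>\<close>

definition face_coset :: "'g::ab_group_add set \<Rightarrow> 'g \<Rightarrow> 'g set"
  where "face_coset F q = (\<lambda>z. z + q) ` group_closure F"


section \<open>Irredundant unions\<close>

definition irredundant_union :: "'i set \<Rightarrow> ('i \<Rightarrow> 'a set) \<Rightarrow> bool"
  where "irredundant_union I B \<longleftrightarrow> (\<forall>i\<in>I. (\<Union>j\<in>I - {i}. B j) \<noteq> (\<Union>j\<in>I. B j))"

end

theory Submission
  imports Defs "HOL-Library.Multiset"
begin

text \<open>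
  Every homogeneous component of \<open>K[\<int>Q]\<close> is at most one-dimensional, so a graded submodule is the
  span \<open>K[A]\<close> of the monomials with exponents in a set \<open>A\<close> closed under adding elements of \<open>Q\<close>.
  Writing \<open>M = K[A]\<close> and \<open>U = K[B]\<close>, the quotient \<open>N\<close> has the monomials with exponents in
  \<open>D = A - B\<close> as a basis, and multiplication in \<open>N\<close> is multiplication of polynomials followed by
  discarding the monomials outside \<open>D\<close>. The theorem becomes a statement about sets of exponents.

  Inverting the monomials of a face \<open>F\<close> replaces \<open>A\<close>, \<open>B\<close> and \<open>Q\<close> by \<open>A - F\<close>, \<open>B - F\<close> and \<open>Q - F\<close>
  (the sets \<open>localize F A\<close> and so on), and \<open>H\<^sup>0\<close> of the localized module is spanned by the monomials
  whose degree lies in the set \<open>T\<^sub>F\<close> (\<open>torsion_degrees\<close>) of those degrees of the localized module that leave its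
  support after adding sufficiently many elements of \<open>(Q - F) - \<int>F\<close>. This set is a union of cosets of
  \<open>\<int>F\<close>. A set of such cosets is the support of a graded submodule iff it is closed upwards for the
  order that \<open>Q\<close> induces on cosets, and finite posets have maximal chains of up-sets with as many steps
  as elements; so the multiplicity of the prime of \<open>F\<close> is the number of cosets in \<open>T\<^sub>F\<close>.
  The elements \<open>q\<close> of the theorem are representatives of these cosets.

  Four combinatorial facts then give the result. There are only finitely many cosets in \<open>T\<^sub>F\<close>
  (\<open>finite_torsion_cosets\<close>, by Dickson's lemma). If \<open>T\<^sub>F\<close> is not empty, then some monomial of \<open>N\<close> has
  the prime of \<open>F\<close> as annihilator (\<open>torsion_witness\<close>), so no coset is lost by looking at associated
  primes only. Each degree in \<open>D\<close> lies in \<open>T\<^sub>F\<close> for some \<open>F\<close> (\<open>exists_torsion_face\<close>), and no coset in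
  \<open>T\<^sub>F\<close> meets \<open>B\<close>; hence these cosets, intersected with \<open>A\<close>, have union \<open>D\<close>. Finally every finite
  family of cosets of groups of faces with this property contains each coset in each \<open>T\<^sub>F\<close>
  (\<open>torsion_coset_in_cover\<close>). Applied to subfamilies of the constructed family this is irredundancy, applied to
  another irredundant family it is uniqueness.

  The remaining algebraic input is that associated primes of \<open>N\<close> are primes of faces
  (\<open>associated_prime_face\<close>), which uses a total order on \<open>\<int>\<^sup>n\<close> compatible with addition.
\<close>

section \<open>Polynomials supported on a set of exponents\<close>

abbreviation "keys \<equiv> Poly_Mapping.keys"
abbreviation "lookup \<equiv> Poly_Mapping.lookup"
abbreviation "single \<equiv> Poly_Mapping.single"

definition span_on :: "'g set \<Rightarrow> ('g \<Rightarrow>\<^sub>0 'k::zero) set"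
  where "span_on W = {f. keys f \<subseteq> W}"

definition trunc :: "'g set \<Rightarrow> ('g \<Rightarrow>\<^sub>0 'k::zero) \<Rightarrow> 'g \<Rightarrow>\<^sub>0 'k"
  where "trunc W f = Poly_Mapping.mapp (\<lambda>k v. if k \<in> W then v else 0) f"

lemma lookup_trunc: "lookup (trunc W f) k = (if k \<in> W then lookup f k else 0)"
  by (auto simp: trunc_def lookup_mapp when_def in_keys_iff)

lemma keys_trunc: "keys (trunc W f) = keys f \<inter> W"
  by (auto simp: in_keys_iff lookup_trunc split: if_splits)

lemma trunc_in_span_on [simp]: "trunc W f \<in> span_on W"
  by (auto simp: span_on_def keys_trunc)

lemma trunc_id: "f \<in> span_on W \<Longrightarrow> trunc W f = f"
  by (rule poly_mapping_eqI) (auto simp: lookup_trunc span_on_def when_def in_keys_iff)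

lemma trunc_0 [simp]: "trunc W 0 = 0"
  by (rule poly_mapping_eqI) (auto simp: lookup_trunc)

lemma trunc_add: "trunc W (f + g) = trunc W f + trunc W (g :: 'g \<Rightarrow>\<^sub>0 'k::monoid_add)"
  by (rule poly_mapping_eqI) (auto simp: lookup_trunc lookup_add when_def)

lemma trunc_diff: "trunc W (f - g) = trunc W f - trunc W (g :: 'g \<Rightarrow>\<^sub>0 'k::ab_group_add)"
  by (rule poly_mapping_eqI) (auto simp: lookup_trunc lookup_minus when_def)

lemma trunc_eq_0_iff: "trunc W f = 0 \<longleftrightarrow> keys f \<inter> W = {}"
  by (metis keys_eq_empty keys_trunc)

lemma span_on_0 [simp]: "0 \<in> span_on W"
  by (simp add: span_on_def)

lemma span_on_mono: "V \<subseteq> W \<Longrightarrow> span_on V \<subseteq> span_on W"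
  by (auto simp: span_on_def)

lemma span_on_add: "f \<in> span_on W \<Longrightarrow> g \<in> span_on W \<Longrightarrow> f + (g :: 'g \<Rightarrow>\<^sub>0 'k::monoid_add) \<in> span_on W"
  unfolding span_on_def using keys_add[of f g] by blast

lemma span_on_uminus: "f \<in> span_on W \<Longrightarrow> - (f :: 'g \<Rightarrow>\<^sub>0 'k::ab_group_add) \<in> span_on W"
  by (auto simp: span_on_def in_keys_iff)

lemma span_on_diff: "f \<in> span_on W \<Longrightarrow> g \<in> span_on W \<Longrightarrow> f - (g :: 'g \<Rightarrow>\<^sub>0 'k::ab_group_add) \<in> span_on W"
  using span_on_add[of f W "- g"] span_on_uminus[of g W] by simp

lemma span_on_single: "single g c \<in> span_on W \<longleftrightarrow> c = 0 \<or> g \<in> W"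
  by (auto simp: span_on_def)

lemma span_on_mult:
  assumes "f \<in> span_on V" "g \<in> span_on W" "\<And>v w. v \<in> V \<Longrightarrow> w \<in> W \<Longrightarrow> v + w \<in> Z"
  shows "f * (g :: 'g::monoid_add \<Rightarrow>\<^sub>0 'k::semiring_0) \<in> span_on Z"
  using assms keys_mult[of f g] unfolding span_on_def by blast

text \<open>Polynomials are finite sums of monomials; splitting off one monomial at a time proves the rule.\<close>

lemma span_on_induct [consumes 1, case_names zero single add]:
  assumes f: "f \<in> span_on W"
    and 0: "P 0"
    and s: "\<And>g c. g \<in> W \<Longrightarrow> c \<noteq> 0 \<Longrightarrow> P (single g c)"
    and a: "\<And>f h. f \<in> span_on W \<Longrightarrow> h \<in> span_on W \<Longrightarrow> P f \<Longrightarrow> P h \<Longrightarrow> P (f + h)"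
  shows "P (f :: 'g \<Rightarrow>\<^sub>0 'k::ab_group_add)"
  using f
proof (induction "card (keys f)" arbitrary: f rule: less_induct)
  case less
  show ?case
  proof (cases "f = 0")
    case False
    then obtain g where g: "g \<in> keys f"
      by (metis ex_in_conv keys_eq_empty)
    let ?h = "trunc (- {g}) f"
    have h: "?h \<in> span_on W" "card (keys ?h) < card (keys f)"
      using less.prems g by (auto simp: span_on_def keys_trunc intro!: psubset_card_mono)
    have "f = single g (lookup f g) + ?h"
      by (rule poly_mapping_eqI) (auto simp: lookup_add lookup_single lookup_trunc when_def)
    moreover have "P (single g (lookup f g) + ?h)"
      by (rule a) (use less.prems g s[of g "lookup f g"] less.hyps[OF h(2,1)] h(1)
          in \<open>auto simp: span_on_def in_keys_iff\<close>)
    ultimately show ?thesis by simp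
  qed (simp add: 0)
qed

lemma lookup_single_mult:
  "lookup (single a c * f) k = c * lookup (f :: 'g::ab_group_add \<Rightarrow>\<^sub>0 'k::field) (k - a)"
proof -
  have "f \<in> span_on UNIV" by (simp add: span_on_def)
  then show ?thesis
    by (induction f rule: span_on_induct)
      (auto simp: mult_single lookup_single when_def distrib_left lookup_add algebra_simps)
qed

lemma keys_single_mult:
  "c \<noteq> 0 \<Longrightarrow> keys (single a c * f) = (+) a ` keys (f :: 'g::ab_group_add \<Rightarrow>\<^sub>0 'k::field)"
proof (intro Set.set_eqI)
  fix k assume "c \<noteq> 0"
  have "k \<in> (+) a ` keys f \<longleftrightarrow> k - a \<in> keys f"
    by (metis (no_types, lifting) add_diff_cancel_left' diff_add_cancel add.commute image_iff)
  with \<open>c \<noteq> 0\<close> show "k \<in> keys (single a c * f) \<longleftrightarrow> k \<in> (+) a ` keys f"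
    by (simp add: in_keys_iff lookup_single_mult)
qed

text \<open>
  What truncation to \<open>A - B\<close> discards is supported in \<open>B\<close>, and multiplication by \<open>r\<close> keeps it off
  \<open>W\<close>. With \<open>W = A - B\<close> this makes truncated multiplication associative; with the support of
  a localization as \<open>W\<close> it allows computing there with untruncated representatives.
\<close>

lemma trunc_mult_trunc:
  fixes r f :: "'g::ab_group_add \<Rightarrow>\<^sub>0 'k::field"
  assumes r: "r \<in> span_on Q" and f: "f \<in> span_on A"
    and B: "\<And>q b. q \<in> Q \<Longrightarrow> b \<in> B \<Longrightarrow> q + b \<notin> W"
  shows "trunc W (r * trunc (A - B) f) = trunc W (r * f)"
proof -
  have "f - trunc (A - B) f \<in> span_on B"
    using f by (auto simp: span_on_def in_keys_iff lookup_minus lookup_trunc when_def split: if_splits)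
  then have "r * (f - trunc (A - B) f) \<in> span_on (- W)"
    using r B by (blast intro: span_on_mult)
  then have "trunc W (r * (f - trunc (A - B) f)) = 0"
    by (auto simp: trunc_eq_0_iff span_on_def)
  then show ?thesis
    by (simp add: right_diff_distrib trunc_diff)
qed

section \<open>Modules modelled by truncated multiplication\<close>

lemma single_eq_0_iff [simp]: "single g c = 0 \<longleftrightarrow> c = 0"
  by (metis lookup_single_eq lookup_zero single_zero)

text \<open>The module \<open>K[A]/K[A \<inter> B]\<close> over \<open>K[Q]\<close>, up to isomorphism: \<open>\<theta>\<close> identifies polynomials supported on \<open>A - B\<close>
  with elements of \<open>N\<close>, and \<open>\<eta>\<close> maps polynomials supported on \<open>Q\<close> onto the ring. Leaving the carriers
  abstract lets the same lemmas apply to submodules of polynomials, to sets of cosets, and to sets of fractions.\<close>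

locale truncated_module =
  fixes R :: "('r, 'c) ring_scheme"
    and \<eta> :: "('g::ab_group_add \<Rightarrow>\<^sub>0 'k::field) \<Rightarrow> 'r"
    and Q :: "'g set"
    and N :: "('r, 'm, 'd) module_scheme"
    and NC :: "'g \<Rightarrow> 'm set"
    and \<theta> :: "('g \<Rightarrow>\<^sub>0 'k) \<Rightarrow> 'm"
    and A B :: "'g set"
  assumes Q_0: "0 \<in> Q"
    and Q_add: "\<And>p q. p \<in> Q \<Longrightarrow> q \<in> Q \<Longrightarrow> p + q \<in> Q"
    and A_add: "\<And>q a. q \<in> Q \<Longrightarrow> a \<in> A \<Longrightarrow> q + a \<in> A"
    and B_add: "\<And>q b. q \<in> Q \<Longrightarrow> b \<in> B \<Longrightarrow> q + b \<in> B"
    and R_carrier: "carrier R = \<eta> ` span_on Q"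
    and R_add: "\<And>a b. a \<in> span_on Q \<Longrightarrow> b \<in> span_on Q \<Longrightarrow> \<eta> a \<oplus>\<^bsub>R\<^esub> \<eta> b = \<eta> (a + b)"
    and R_mult: "\<And>a b. a \<in> span_on Q \<Longrightarrow> b \<in> span_on Q \<Longrightarrow> \<eta> a \<otimes>\<^bsub>R\<^esub> \<eta> b = \<eta> (a * b)"
    and N_carrier: "carrier N = \<theta> ` span_on (A - B)"
    and inj: "inj_on \<theta> (span_on (A - B))"
    and N_zero: "\<zero>\<^bsub>N\<^esub> = \<theta> 0"
    and N_add: "\<And>v w. v \<in> span_on (A - B) \<Longrightarrow> w \<in> span_on (A - B) \<Longrightarrow> \<theta> v \<oplus>\<^bsub>N\<^esub> \<theta> w = \<theta> (v + w)"
    and N_smult: "\<And>a v. a \<in> span_on Q \<Longrightarrow> v \<in> span_on (A - B) \<Longrightarrow>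
      \<eta> a \<odot>\<^bsub>N\<^esub> \<theta> v = \<theta> (trunc (A - B) (a * v))"
    and NC_eq: "\<And>g. NC g = \<theta> ` span_on ((A - B) \<inter> {g})"

text \<open>The supports of graded submodules of a module with support \<open>D\<close>: like an ideal, such a set absorbs \<open>Q\<close>, except
  that sums outside \<open>D\<close> belong to monomials that are zero.\<close>

definition truncated_ideal :: "'g::ab_group_add set \<Rightarrow> 'g set \<Rightarrow> 'g set \<Rightarrow> bool"
  where "truncated_ideal Q D W \<longleftrightarrow> W \<subseteq> D \<and> (\<forall>w\<in>W. \<forall>q\<in>Q. w + q \<in> D \<longrightarrow> w + q \<in> W)"

context truncated_module
begin

lemma theta_eq_iff: "v \<in> span_on (A - B) \<Longrightarrow> w \<in> span_on (A - B) \<Longrightarrow> \<theta> v = \<theta> w \<longleftrightarrow> v = w"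
  using inj by (auto dest: inj_onD)

lemma theta_image_subset_iff:
  assumes "W \<subseteq> A - B" "V \<subseteq> A - B"
  shows "\<theta> ` span_on W \<subseteq> \<theta> ` span_on V \<longleftrightarrow> W \<subseteq> V"
proof
  assume *: "\<theta> ` span_on W \<subseteq> \<theta> ` span_on V"
  show "W \<subseteq> V"
  proof
    fix g assume g: "g \<in> W"
    then have "\<theta> (single g 1) \<in> \<theta> ` span_on V"
      using * by (auto simp: span_on_single)
    then obtain v where v: "v \<in> span_on V" "\<theta> (single g 1) = \<theta> v" by blast
    then have "single g 1 = v"
      using assms g span_on_mono[OF assms(2)] by (subst (asm) theta_eq_iff) (auto simp: span_on_single)
    with v(1) show "g \<in> V" by (auto simp: span_on_single)
  qed
qed (use span_on_mono in blast)

lemma theta_image_psubset_iff: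
  assumes "W \<subseteq> A - B" "V \<subseteq> A - B"
  shows "\<theta> ` span_on W \<subset> \<theta> ` span_on V \<longleftrightarrow> W \<subset> V"
  using theta_image_subset_iff[OF assms] theta_image_subset_iff[OF assms(2,1)] by (simp add: less_le_not_le)

lemma group_N: "group (add_monoid N)"
proof (rule groupI)
  fix x assume "x \<in> carrier (add_monoid N)"
  then obtain v where v: "v \<in> span_on (A - B)" "x = \<theta> v" by (auto simp: N_carrier)
  then have "- v \<in> span_on (A - B)" "\<theta> (- v) \<oplus>\<^bsub>N\<^esub> x = \<zero>\<^bsub>N\<^esub>"
    by (auto simp: span_on_uminus N_add N_zero)
  then show "\<exists>y\<in>carrier (add_monoid N). y \<otimes>\<^bsub>add_monoid N\<^esub> x = \<one>\<^bsub>add_monoid N\<^esub>"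
    by (auto simp: N_carrier)
qed (auto simp: N_carrier N_add N_zero span_on_add add.assoc)

lemma inv_theta:
  assumes "v \<in> span_on (A - B)"
  shows "inv\<^bsub>add_monoid N\<^esub> (\<theta> v) = \<theta> (- v)"
  by (rule group.inv_equality[OF group_N]) (use assms in \<open>auto simp: N_carrier span_on_uminus N_add N_zero\<close>)

lemma span_on_closed_smult:
  assumes W: "truncated_ideal Q (A - B) W" and a: "a \<in> span_on Q" and v: "v \<in> span_on W"
  shows "trunc (A - B) (a * v) \<in> span_on W"
proof -
  have "keys (a * v) \<inter> (A - B) \<subseteq> W"
  proof
    fix k assume k: "k \<in> keys (a * v) \<inter> (A - B)"
    then obtain q w where "k = q + w" "q \<in> keys a" "w \<in> keys v"
      using keys_mult[of a v] by blast
    with k W a v show "k \<in> W"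
      unfolding span_on_def truncated_ideal_def by (metis IntD2 add.commute mem_Collect_eq subsetD)
  qed
  then show ?thesis by (simp add: span_on_def keys_trunc)
qed

text \<open>This lemma and the next one identify graded submodules with their supports. The elements of a span are sums of
  homogeneous ones, and its closure under scalars is the absorption property of its support.\<close>

lemma graded_submodule_theta_image:
  assumes W: "truncated_ideal Q (A - B) W"
  shows "graded_submodule R N NC (\<theta> ` span_on W)"
proof -
  have WD: "W \<subseteq> A - B" using W by (simp add: truncated_ideal_def)
  note sub = subsetD[OF span_on_mono[OF WD]]
  have "\<theta> v \<in> generate (add_monoid N) (\<Union>g. \<theta> ` span_on W \<inter> NC g)" if "v \<in> span_on W" for v
    using that
  proof (induction v rule: span_on_induct)
    case zero
    show ?case using generate.one[of "add_monoid N"] by (simp add: N_zero)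
  next
    case (single g c)
    then show ?case
      using WD by (intro generate.incl UN_I[of g]) (auto simp: NC_eq span_on_single intro!: imageI)
  next
    case (add v w)
    then show ?case
      using generate.eng[OF add.IH] by (simp add: N_add sub)
  qed
  moreover have "submodule (\<theta> ` span_on W) R N"
  proof (intro submodule.intro subgroup.intro submodule_axioms.intro)
    fix a x assume "a \<in> carrier R" "x \<in> \<theta> ` span_on W"
    then show "a \<odot>\<^bsub>N\<^esub> x \<in> \<theta> ` span_on W"
      by (auto simp: R_carrier N_smult sub span_on_closed_smult[OF W])
  next
    fix x assume "x \<in> \<theta> ` span_on W"
    then show "inv\<^bsub>add_monoid N\<^esub> x \<in> \<theta> ` span_on W"
      by (force simp: inv_theta sub intro!: imageI span_on_uminus)
  qed (auto simp: N_carrier N_zero sub N_add intro!: imageI span_on_add)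
  ultimately show ?thesis by (auto simp: graded_submodule_def)
qed

text \<open>Conversely, components of \<open>N\<close> are at most one-dimensional, so a nonzero homogeneous element of \<open>L\<close> can be scaled
  to a monomial. The degrees of these monomials form the support, and they span \<open>L\<close> because \<open>L\<close> is generated by its
  homogeneous elements.\<close>

lemma graded_submoduleE:
  assumes L: "graded_submodule R N NC L"
  obtains W where "truncated_ideal Q (A - B) W" "L = \<theta> ` span_on W"
proof -
  define W where "W = {g \<in> A - B. \<theta> (single g 1) \<in> L}"
  interpret submodule L R N using L by (simp add: graded_submodule_def)
  have scal: "\<theta> (single g (c * d)) \<in> L" if "g \<in> A - B" "\<theta> (single g d) \<in> L" for g c d
  proof -
    have "\<eta> (single 0 c) \<odot>\<^bsub>N\<^esub> \<theta> (single g d) \<in> L"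
      using that by (intro smult_closed) (auto simp: R_carrier span_on_single Q_0)
    then show ?thesis
      using that by (simp add: N_smult span_on_single Q_0 mult_single trunc_id)
  qed
  have sub: "span_on W \<subseteq> (span_on (A - B) :: ('g \<Rightarrow>\<^sub>0 'k) set)"
    by (rule span_on_mono) (auto simp: W_def)
  have "L \<subseteq> \<theta> ` span_on W"
  proof
    have hom: "h \<in> \<theta> ` span_on W" if h: "h \<in> L" "h \<in> NC g" for h g
    proof -
      obtain v where v: "v \<in> span_on ((A - B) \<inter> {g})" "h = \<theta> v" using h by (auto simp: NC_eq)
      have vs: "v = single g (lookup v g)"
        using v by (intro poly_mapping_eqI) (auto simp: span_on_def lookup_single when_def in_keys_iff subset_iff)
      show ?thesis
      proof (cases "lookup v g = 0")
        case True then show ?thesis using v vs by (metis image_eqI single_zero span_on_0)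
      next
        case False
        then have "g \<in> A - B" using v by (auto simp: span_on_def in_keys_iff)
        moreover have "\<theta> (single g (inverse (lookup v g) * lookup v g)) \<in> L"
          using h(1) v(2) vs \<open>g \<in> A - B\<close> by (intro scal) auto
        ultimately have "g \<in> W" using False by (simp add: W_def)
        then have "v \<in> span_on W" using vs by (metis span_on_single)
        then show ?thesis using v by blast
      qed
    qed
    fix x assume "x \<in> L"
    then have "x \<in> generate (add_monoid N) (\<Union>g. L \<inter> NC g)"
      using L by (auto simp: graded_submodule_def)
    then show "x \<in> \<theta> ` span_on W"
    proof (induction rule: generate.induct)
      case (inv h)
      then obtain v where "v \<in> span_on W" "h = \<theta> v" using hom by blast
      then show ?case using sub by (auto simp: inv_theta span_on_uminus)
    next
      case (eng h1 h2)
      then show ?case using sub by (auto simp: N_add subset_iff intro!: imageI span_on_add)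
    qed (use hom in \<open>auto simp: N_zero\<close>)
  qed
  moreover have "\<theta> v \<in> L" if "v \<in> span_on W" for v
    using that
  proof (induction v rule: span_on_induct)
    case zero
    show ?case using one_closed by (simp add: N_zero)
  next
    case (single g c)
    then show ?case using scal[of g 1 c] by (simp add: W_def)
  next
    case (add v w)
    then show ?case using m_closed[OF add.IH] sub by (simp add: N_add subset_iff)
  qed
  moreover have "truncated_ideal Q (A - B) W"
    unfolding truncated_ideal_def
  proof (intro conjI ballI impI)
    fix w q assume w: "w \<in> W" "q \<in> Q" "w + q \<in> A - B"
    then have "\<eta> (single q 1) \<odot>\<^bsub>N\<^esub> \<theta> (single w 1) \<in> L"
      by (intro smult_closed) (auto simp: R_carrier span_on_single W_def)
    also have "\<eta> (single q 1) \<odot>\<^bsub>N\<^esub> \<theta> (single w 1) = \<theta> (single (w + q) 1)"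
      using w by (subst N_smult) (auto simp: span_on_single W_def mult_single trunc_id add.commute)
    finally show "w + q \<in> W" using w by (simp add: W_def)
  qed (auto simp: W_def)
  ultimately show thesis using that[of W] by blast
qed

text \<open>A submodule with support \<open>T\<close> is again of the form \<open>K[A']/K[B]\<close>, with \<open>A' = T \<union> B\<close>; so everything proved about
  modules applies to submodules.\<close>

lemma restrict:
  assumes T: "truncated_ideal Q (A - B) T"
  shows "truncated_module R \<eta> Q (N\<lparr>carrier := \<theta> ` span_on T\<rparr>) (\<lambda>g. \<theta> ` span_on T \<inter> NC g) \<theta> (T \<union> B) B"
proof -
  have TD: "T \<subseteq> A - B" using T by (simp add: truncated_ideal_def)
  then have eq: "T \<union> B - B = T" by blast
  note sub = subsetD[OF span_on_mono[OF TD]]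
  show ?thesis
  proof
    fix q a assume q: "q \<in> Q" "a \<in> T \<union> B"
    show "q + a \<in> T \<union> B"
    proof (cases "a \<in> T \<and> q + a \<notin> B")
      case True
      then have "q + a \<in> A - B" using A_add q TD by blast
      then show ?thesis using T q True unfolding truncated_ideal_def by (metis UnI1 add.commute)
    qed (use q B_add in auto)
  next
    fix a v :: "'g \<Rightarrow>\<^sub>0 'k" assume "a \<in> span_on Q" "v \<in> span_on (T \<union> B - B)"
    then have av: "a \<in> span_on Q" "v \<in> span_on T" by (simp_all only: eq)
    have "\<eta> a \<odot>\<^bsub>N\<^esub> \<theta> v = \<theta> (trunc (A - B) (a * v))"
      using av(1) sub[OF av(2)] by (rule N_smult)
    moreover have "trunc (A - B) (a * v) \<in> span_on T"
      using T av by (rule span_on_closed_smult)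
    moreover have "trunc (A - B) (a * v) = trunc T (trunc (A - B) (a * v))"
      by (rule trunc_id[symmetric], fact)
    moreover have "trunc T (trunc (A - B) (a * v)) = trunc T (a * v)"
      using TD by (intro poly_mapping_eqI) (auto simp: lookup_trunc)
    ultimately show "\<eta> a \<odot>\<^bsub>N\<lparr>carrier := \<theta> ` span_on T\<rparr>\<^esub> \<theta> v = \<theta> (trunc (T \<union> B - B) (a * v))"
      by (simp add: eq)
  next
    fix g :: 'g
    have "span_on T \<inter> span_on ((A - B) \<inter> {g}) = (span_on (T \<inter> {g}) :: ('g \<Rightarrow>\<^sub>0 'k) set)"
      using TD by (auto simp: span_on_def)
    then show "\<theta> ` span_on T \<inter> NC g = \<theta> ` span_on ((T \<union> B - B) \<inter> {g})"
      using inj_on_image_Int[OF inj, of "span_on T" "span_on ((A - B) \<inter> {g})"] TD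
      by (simp add: eq NC_eq span_on_mono)
  next
    show "inj_on \<theta> (span_on (T \<union> B - B))"
      unfolding eq by (rule inj_on_subset[OF inj span_on_mono[OF TD]])
  qed (simp_all add: Q_0 Q_add B_add R_carrier R_add R_mult N_zero N_add eq sub)
qed

lemma Supp_eq: "Supp N NC = A - B"
proof -
  have "NC g = {\<theta> 0}" if "g \<notin> A - B" for g
    using that by (auto simp: NC_eq span_on_def)
  moreover have "\<theta> (single g 1) \<in> NC g" "\<theta> (single g 1) \<noteq> \<theta> 0" if "g \<in> A - B" for g
    using that by (auto simp: NC_eq span_on_single theta_eq_iff)
  ultimately show ?thesis
    unfolding Supp_def N_zero by blast
qed

end

section \<open>Torsion and graded length\<close>

text \<open>The support of the \<open>n\<close>-th power of the ideal with support \<open>J\<close>; the zeroth power is the whole ring.\<close>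

primrec sum_power :: "'g::ab_group_add set \<Rightarrow> 'g set \<Rightarrow> nat \<Rightarrow> 'g set"
  where "sum_power Q J 0 = Q"
  | "sum_power Q J (Suc n) = {a + b | a b. a \<in> sum_power Q J n \<and> b \<in> J}"

definition torsion_support :: "'g::ab_group_add set \<Rightarrow> 'g set \<Rightarrow> 'g set \<Rightarrow> 'g set"
  where "torsion_support Q J D = {g \<in> D. \<exists>n. \<forall>j\<in>sum_power Q J n. g + j \<notin> D}"

lemma sum_power_mult_closed:
  assumes "\<And>p q. p \<in> Q \<Longrightarrow> q \<in> Q \<Longrightarrow> p + q \<in> Q" "a \<in> sum_power Q J n" "q \<in> Q"
  shows "a + q \<in> sum_power Q J n"
  using assms(2)
proof (induction n arbitrary: a)
  case (Suc n)
  then obtain b c where "a = b + c" "b + q \<in> sum_power Q J n" "c \<in> J" by auto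
  moreover from this have "a + q = (b + q) + c" by (simp add: algebra_simps)
  ultimately show ?case unfolding sum_power.simps by blast
qed (use assms in auto)

lemma sum_power_antimono:
  assumes Q: "\<And>p q. p \<in> Q \<Longrightarrow> q \<in> Q \<Longrightarrow> p + q \<in> Q" and J: "J \<subseteq> Q"
  shows "m \<le> n \<Longrightarrow> sum_power Q J n \<subseteq> sum_power Q J m"
proof (induction n rule: dec_induct)
  case (step n)
  have "sum_power Q J (Suc n) \<subseteq> sum_power Q J n"
    using sum_power_mult_closed[of Q, OF Q] J by auto
  with step.IH show ?case by blast
qed auto

lemma sum_power_subset:
  assumes Q: "\<And>p q. p \<in> Q \<Longrightarrow> q \<in> Q \<Longrightarrow> p + q \<in> Q" and J: "J \<subseteq> Q"
  shows "sum_power Q J n \<subseteq> Q"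
  using sum_power_antimono[of Q J 0 n, OF Q J] by auto

context truncated_module
begin

lemma ideal_prod_eta:
  assumes V: "V \<subseteq> Q" and J: "J \<subseteq> Q"
  shows "ideal_prod R (\<eta> ` span_on V) (\<eta> ` span_on J) = \<eta> ` span_on {a + b | a b. a \<in> V \<and> b \<in> J}"
    (is "?I = \<eta> ` span_on ?S")
proof
  have S: "?S \<subseteq> Q" using V J Q_add by blast
  note sub = subsetD[OF span_on_mono[OF V]] subsetD[OF span_on_mono[OF J]] subsetD[OF span_on_mono[OF S]]
  show "?I \<subseteq> \<eta> ` span_on ?S"
  proof
    fix x assume "x \<in> ?I"
    then show "x \<in> \<eta> ` span_on ?S"
    proof (induction rule: ideal_prod.induct)
      case (prod i j)
      then obtain a b where ab: "a \<in> span_on V" "i = \<eta> a" "b \<in> span_on J" "j = \<eta> b" by blast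
      have "a * b \<in> span_on ?S" using ab(1,3) by (rule span_on_mult) blast
      then show ?case using ab by (simp add: R_mult sub)
    next
      case (sum s1 s2)
      then obtain a b where "a \<in> span_on ?S" "s1 = \<eta> a" "b \<in> span_on ?S" "s2 = \<eta> b" by blast
      then show ?case by (simp only: R_add[OF sub(3) sub(3)] imageI span_on_add)
    qed
  qed
  show "\<eta> ` span_on ?S \<subseteq> ?I"
  proof safe
    fix f :: "'g \<Rightarrow>\<^sub>0 'k" assume "f \<in> span_on ?S"
    then show "\<eta> f \<in> ?I"
    proof (induction f rule: span_on_induct)
      case zero
      have "\<eta> 0 \<otimes>\<^bsub>R\<^esub> \<eta> 0 \<in> ?I" by (intro ideal_prod.prod) auto
      then show ?case by (simp add: R_mult)
    next
      case (single g c)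
      then obtain a b where ab: "g = a + b" "a \<in> V" "b \<in> J" by blast
      have "\<eta> (single a c) \<otimes>\<^bsub>R\<^esub> \<eta> (single b 1) \<in> ?I"
        by (intro ideal_prod.prod imageI) (simp_all add: span_on_single ab)
      then show ?case
        using ab V J by (simp add: R_mult span_on_single subset_iff mult_single)
    next
      case (add f h)
      then show ?case using ideal_prod.sum[OF add.IH] by (simp add: R_add sub)
    qed
  qed
qed

text \<open>Products of ideals spanned by monomials are spanned by the products of these monomials.\<close>

lemma power_eta:
  assumes J: "J \<subseteq> Q"
  shows "(\<eta> ` span_on J) [^]\<^bsub>ideals_set R\<^esub> n = \<eta> ` span_on (sum_power Q J n)"
proof (induction n)
  case 0
  show ?case by (simp add: nat_pow_def ideals_set_def R_carrier)
next
  case (Suc n)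
  have "(\<eta> ` span_on J) [^]\<^bsub>ideals_set R\<^esub> Suc n
      = ideal_prod R ((\<eta> ` span_on J) [^]\<^bsub>ideals_set R\<^esub> n) (\<eta> ` span_on J)"
    by (simp add: nat_pow_def ideals_set_def)
  also have "\<dots> = \<eta> ` span_on (sum_power Q J (Suc n))"
    unfolding Suc.IH by (simp add: ideal_prod_eta[OF sum_power_subset J] Q_add J)
  finally show ?case .
qed

text \<open>An element is killed by a power of a monomial ideal iff each of its monomials is, because no cancellation
  can occur between the products of a monomial with distinct monomials.\<close>

lemma local_cohomology0_eq:
  assumes J: "J \<subseteq> Q"
  shows "local_cohomology0 R (\<eta> ` span_on J) N = \<theta> ` span_on (torsion_support Q J (A - B))"
    (is "?H = \<theta> ` span_on ?T")
proof
  note pw = power_eta[OF J]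
  note sp = sum_power_subset[of Q J, OF Q_add J]
  show "?H \<subseteq> \<theta> ` span_on ?T"
  proof
    fix x assume "x \<in> ?H"
    then obtain v n where v: "v \<in> span_on (A - B)" "x = \<theta> v"
      and n: "\<And>a. a \<in> span_on (sum_power Q J n) \<Longrightarrow> \<eta> a \<odot>\<^bsub>N\<^esub> \<theta> v = \<theta> 0"
      unfolding local_cohomology0_def pw N_zero N_carrier by blast
    have "g + j \<notin> A - B" if "g \<in> keys v" "j \<in> sum_power Q J n" for g j
    proof -
      have j: "j \<in> Q" using that sp by blast
      have "\<theta> (trunc (A - B) (single j 1 * v)) = \<theta> 0"
        using n[of "single j 1"] that j v by (simp add: span_on_single N_smult)
      then have "keys (single j 1 * v) \<inter> (A - B) = {}"
        by (simp add: theta_eq_iff trunc_eq_0_iff)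
      moreover have "j + g \<in> keys (single j 1 * v)"
        using that by (simp add: keys_single_mult)
      ultimately show ?thesis by (auto simp: add.commute)
    qed
    then have "v \<in> span_on ?T"
      using v by (auto simp: span_on_def torsion_support_def)
    then show "x \<in> \<theta> ` span_on ?T" using v by blast
  qed
  show "\<theta> ` span_on ?T \<subseteq> ?H"
  proof safe
    fix v :: "'g \<Rightarrow>\<^sub>0 'k" assume v: "v \<in> span_on ?T"
    then have vD: "v \<in> span_on (A - B)"
      by (auto simp: span_on_def torsion_support_def)
    have "\<forall>g\<in>keys v. \<exists>n. \<forall>j\<in>sum_power Q J n. g + j \<notin> A - B"
      using v by (auto simp: span_on_def torsion_support_def)
    then obtain m where m: "\<And>g j. g \<in> keys v \<Longrightarrow> j \<in> sum_power Q J (m g) \<Longrightarrow> g + j \<notin> A - B"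
      by metis
    \<comment> \<open>powers of an ideal decrease, so the largest exponent works for all monomials of \<open>v\<close>\<close>
    define n where "n = Max (m ` keys v)"
    have n: "g + j \<notin> A - B" if "g \<in> keys v" "j \<in> sum_power Q J n" for g j
    proof -
      have "m g \<le> n" using that by (simp add: n_def)
      then show ?thesis
        using m that sum_power_antimono[of Q J "m g" n, OF Q_add J] by blast
    qed
    have "r \<odot>\<^bsub>N\<^esub> \<theta> v = \<zero>\<^bsub>N\<^esub>" if r: "r \<in> (\<eta> ` span_on J) [^]\<^bsub>ideals_set R\<^esub> n" for r
    proof -
      obtain a where a: "a \<in> span_on (sum_power Q J n)" "r = \<eta> a" using r unfolding pw by blast
      have aQ: "a \<in> span_on Q" using a span_on_mono[OF sp] by blast
      have "keys (a * v) \<inter> (A - B) = {}"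
      proof (rule ccontr)
        assume "keys (a * v) \<inter> (A - B) \<noteq> {}"
        then obtain k where k: "k \<in> keys (a * v)" "k \<in> A - B" by blast
        then obtain j g where "k = j + g" "j \<in> keys a" "g \<in> keys v"
          using keys_mult[of a v] by blast
        with n[of g j] a k(2) show False by (auto simp: span_on_def add.commute)
      qed
      then have "trunc (A - B) (a * v) = 0" by (simp only: trunc_eq_0_iff)
      then show ?thesis using a aQ vD by (simp add: N_smult N_zero)
    qed
    then show "\<theta> v \<in> ?H"
      using vD by (auto simp: local_cohomology0_def N_carrier)
  qed
qed

text \<open>Monomials with exponent in \<open>Z\<close> are units, and multiplication by a unit preserves supports.\<close>

lemma coset_in_module_support:
  assumes "Z \<subseteq> Q" "\<And>z. z \<in> Z \<Longrightarrow> - z \<in> Z" "g \<in> A - B" "z \<in> Z"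
  shows "g + z \<in> A - B"
proof -
  have z: "z \<in> Q" "- z \<in> Q" using assms by auto
  have "g + z \<in> A" using A_add[OF z(1)] assms(3) by (simp add: add.commute)
  moreover have "g + z \<notin> B"
  proof
    assume "g + z \<in> B"
    then have "- z + (g + z) \<in> B" by (rule B_add[OF z(2)])
    then show False using assms(3) by simp
  qed
  ultimately show ?thesis by blast
qed

text \<open>The support of a graded submodule is a union of cosets of \<open>Z\<close>, so a strict chain has at most as many steps as there
  are cosets. For a chain of this length, order the cosets by \<open>Q\<close>: a coset is below those it reaches by adding elements
  of \<open>Q\<close>. The face property of \<open>Z\<close> makes this relation antisymmetric, and removing a minimal coset from the
  support of a graded submodule leaves the support of a graded submodule.\<close>

lemma graded_length_eq:
  assumes ZQ: "Z \<subseteq> Q" and Z0: "0 \<in> Z" and Z_add: "\<And>y z. y \<in> Z \<Longrightarrow> z \<in> Z \<Longrightarrow> y + z \<in> Z"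
    and Z_minus: "\<And>z. z \<in> Z \<Longrightarrow> - z \<in> Z"
    and Z_face: "\<And>p q. p \<in> Q \<Longrightarrow> q \<in> Q \<Longrightarrow> p + q \<in> Z \<Longrightarrow> q \<in> Z"
    and fin: "finite ((\<lambda>g. (+) g ` Z) ` (A - B))"
  shows "graded_length R N NC = enat (card ((\<lambda>g. (+) g ` Z) ` (A - B)))"
proof -
  define \<kappa> where "\<kappa> = (\<lambda>g. (+) g ` Z)"
  have \<kappa>: "\<kappa> g = \<kappa> h \<longleftrightarrow> h - g \<in> Z" for g h
  proof
    assume "\<kappa> g = \<kappa> h"
    moreover have "h \<in> \<kappa> h" unfolding \<kappa>_def using Z0 by (auto intro!: image_eqI[of _ _ 0])
    ultimately obtain z where "h = g + z" "z \<in> Z" by (auto simp: \<kappa>_def)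
    then show "h - g \<in> Z" by simp
  next
    assume hg: "h - g \<in> Z"
    have sub: "\<kappa> a \<subseteq> \<kappa> b" if "a - b \<in> Z" for a b
    proof
      fix x assume "x \<in> \<kappa> a"
      then obtain z where "x = b + ((a - b) + z)" "z \<in> Z" by (auto simp: \<kappa>_def)
      then show "x \<in> \<kappa> b" unfolding \<kappa>_def using that Z_add by blast
    qed
    show "\<kappa> g = \<kappa> h" using sub[of h g] sub[of g h] hg Z_minus[OF hg] by auto
  qed
  define ideal where "ideal = truncated_ideal Q (A - B)"
  have sat: "h \<in> W" if "ideal W" "g \<in> W" "\<kappa> g = \<kappa> h" for W g h
  proof -
    have "g \<in> A - B" "h - g \<in> Z" using that \<kappa> by (auto simp: ideal_def truncated_ideal_def)
    then have "g + (h - g) \<in> A - B" using coset_in_module_support[of Z g "h - g"] ZQ Z_minus by blast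
    then show ?thesis
      using that(1,2) \<open>h - g \<in> Z\<close> ZQ unfolding ideal_def truncated_ideal_def
      by (metis add.commute diff_add_cancel subsetD)
  qed
  have finW: "finite (\<kappa> ` W)" if "ideal W" for W
    using fin by (rule finite_subset[rotated]) (use that in \<open>auto simp: ideal_def truncated_ideal_def \<kappa>_def\<close>)
  have upper: "n \<le> card (\<kappa> ` (A - B))"
    if L: "\<forall>i\<le>n. graded_submodule R N NC (L i)" "\<forall>i<n. L i \<subset> L (Suc i)" for n L
  proof -
    have "\<exists>W. ideal W \<and> L i = \<theta> ` span_on W" if "i \<le> n" for i
    proof -
      have "graded_submodule R N NC (L i)" using L(1) that by blast
      then show ?thesis unfolding ideal_def by (rule graded_submoduleE) blast
    qed
    then have "\<exists>W. \<forall>i\<le>n. ideal (W i) \<and> L i = \<theta> ` span_on (W i)"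
      by metis
    then obtain W where W: "\<And>i. i \<le> n \<Longrightarrow> ideal (W i)" "\<And>i. i \<le> n \<Longrightarrow> L i = \<theta> ` span_on (W i)"
      by blast
    have "i \<le> n \<Longrightarrow> i \<le> card (\<kappa> ` W i)" for i
    proof (induction i)
      case (Suc i)
      have "W i \<subset> W (Suc i)"
        using L(2) Suc.prems W theta_image_psubset_iff[of "W i" "W (Suc i)"]
        by (simp add: ideal_def truncated_ideal_def)
      then obtain g where g: "g \<in> W (Suc i)" "g \<notin> W i" by blast
      have "\<kappa> g \<notin> \<kappa> ` W i" using g sat[OF W(1)[of i]] Suc.prems by fastforce
      then have "\<kappa> ` W i \<subset> \<kappa> ` W (Suc i)" using g \<open>W i \<subset> W (Suc i)\<close> by blast
      then have "card (\<kappa> ` W i) < card (\<kappa> ` W (Suc i))"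
        using finW[OF W(1)[OF Suc.prems]] by (rule psubset_card_mono[rotated])
      then show ?case using Suc by simp
    qed simp
    then have "n \<le> card (\<kappa> ` W n)" by simp
    also have "\<dots> \<le> card (\<kappa> ` (A - B))"
      using W(1)[of n] fin by (intro card_mono) (auto simp: ideal_def truncated_ideal_def \<kappa>_def)
    finally show ?thesis .
  qed
  have chain: "\<exists>W'. W' (card (\<kappa> ` W)) = W \<and> (\<forall>i\<le>card (\<kappa> ` W). ideal (W' i)) \<and>
      (\<forall>i<card (\<kappa> ` W). W' i \<subset> W' (Suc i))" if "ideal W" for W
    using that
  proof (induction "card (\<kappa> ` W)" arbitrary: W)
    case 0
    then show ?case by (intro exI[of _ "\<lambda>_. W"]) auto
  next
    case (Suc n)
    \<comment> \<open>a coset with the fewest cosets below it is minimal\<close>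
    define below where "below w = \<kappa> ` {u \<in> W. \<exists>q\<in>Q. w = u + q}" for w
    have "W \<noteq> {}" using Suc.hyps(2) by auto
    then obtain w where w: "w \<in> W" "\<And>u. u \<in> W \<Longrightarrow> card (below w) \<le> card (below u)"
      using ex_has_least_nat[of "\<lambda>w. w \<in> W" _ "\<lambda>w. card (below w)"] by blast
    have min: "\<kappa> u = \<kappa> w" if u: "u \<in> W" "w = u + q" "q \<in> Q" for u q
    proof (rule ccontr)
      assume ne: "\<kappa> u \<noteq> \<kappa> w"
      have "below u \<subseteq> below w"
        using u Q_add by (auto simp: below_def)
      moreover have "\<kappa> w \<in> below w" using w(1) Q_0 unfolding below_def by force
      moreover have "\<kappa> w \<notin> below u"
      proof
        assume "\<kappa> w \<in> below u"
        then obtain v p where v: "\<kappa> w = \<kappa> v" "u = v + p" "p \<in> Q" by (auto simp: below_def)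
        then have "- (v - w) \<in> Z" using Z_minus \<kappa>[of w v] by blast
        then have "p + q \<in> Z" using u(2) v(2) by (simp add: algebra_simps)
        then have "q \<in> Z" using Z_face v u by blast
        then show False using ne \<kappa>[of u w] u by simp
      qed
      ultimately have "below u \<subset> below w" by blast
      moreover have "finite (below w)"
        using finW[OF Suc.prems] by (rule finite_subset[rotated]) (auto simp: below_def)
      ultimately have "card (below u) < card (below w)" by (intro psubset_card_mono)
      with w(2)[OF u(1)] show False by simp
    qed
    define V where "V = {u \<in> W. \<kappa> u \<noteq> \<kappa> w}"
    have "ideal V"
      unfolding ideal_def truncated_ideal_def
    proof (intro conjI ballI impI)
      show "V \<subseteq> A - B" using Suc.prems by (auto simp: V_def ideal_def truncated_ideal_def)
      fix u q assume u: "u \<in> V" "q \<in> Q" "u + q \<in> A - B"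
      then have uq: "u + q \<in> W" using Suc.prems by (auto simp: V_def ideal_def truncated_ideal_def)
      have "\<kappa> (u + q) \<noteq> \<kappa> w"
      proof
        assume "\<kappa> (u + q) = \<kappa> w"
        then have "w - (u + q) \<in> Z" using \<kappa> by blast
        then have "q + (w - (u + q)) \<in> Q" using ZQ u Q_add by blast
        then have "\<kappa> u = \<kappa> w" using min[of u "q + (w - (u + q))"] u by (simp add: V_def)
        then show False using u by (simp add: V_def)
      qed
      then show "u + q \<in> V" using uq by (simp add: V_def)
    qed
    moreover have \<kappa>V: "\<kappa> ` W = insert (\<kappa> w) (\<kappa> ` V)" "\<kappa> w \<notin> \<kappa> ` V"
      using w by (auto simp: V_def)
    then have n: "card (\<kappa> ` V) = n" using Suc.hyps(2) finW[OF \<open>ideal V\<close>] by simp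
    ultimately obtain W' where W': "W' n = V" "\<forall>i\<le>n. ideal (W' i)" "\<forall>i<n. W' i \<subset> W' (Suc i)"
      using Suc.hyps(1)[of V] by auto
    have "V \<subset> W" using w by (auto simp: V_def)
    then show ?case
      using W' Suc.prems
      by (intro exI[of _ "W'(Suc n := W)"]) (auto simp: Suc.hyps(2)[symmetric] le_Suc_eq less_Suc_eq)
  qed
  have "ideal (A - B)" by (auto simp: ideal_def truncated_ideal_def)
  from chain[OF this] obtain W where W: "\<forall>i\<le>card (\<kappa> ` (A - B)). ideal (W i)"
    "\<forall>i<card (\<kappa> ` (A - B)). W i \<subset> W (Suc i)" by blast
  have "\<exists>L. (\<forall>i\<le>card (\<kappa> ` (A - B)). graded_submodule R N NC (L i)) \<and>
      (\<forall>i<card (\<kappa> ` (A - B)). L i \<subset> L (Suc i))"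
    using W graded_submodule_theta_image theta_image_psubset_iff
    by (intro exI[of _ "\<lambda>i. \<theta> ` span_on (W i)"]) (auto simp: ideal_def truncated_ideal_def)
  then show ?thesis
    unfolding graded_length_def \<kappa>_def[symmetric]
    by (intro cSup_eq_maximum) (auto dest: upper)
qed

end

section \<open>Fractions along a face\<close>

text \<open>The set \<open>W - F\<close> of differences: the exponents in the localization at the monomials of \<open>F\<close>.\<close>

definition localize :: "'g::ab_group_add set \<Rightarrow> 'g set \<Rightarrow> 'g set"
  where "localize F W = {g. \<exists>f\<in>F. g + f \<in> W}"

lemma localize_empty [simp]: "localize F {} = {}"
  by (simp add: localize_def)

lemma is_faceD:
  assumes "is_face Q F" "0 \<in> (Q :: 'g::ab_group_add set)"
  shows "F \<subseteq> Q" "0 \<in> F" "\<And>a b. a \<in> F \<Longrightarrow> b \<in> F \<Longrightarrow> a + b \<in> F"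
    "\<And>a b. a \<in> Q \<Longrightarrow> b \<in> Q \<Longrightarrow> a + b \<in> F \<Longrightarrow> b \<in> F"
proof -
  show 1: "F \<subseteq> Q" "\<And>a b. a \<in> F \<Longrightarrow> b \<in> F \<Longrightarrow> a + b \<in> F"
    "\<And>a b. a \<in> Q \<Longrightarrow> b \<in> Q \<Longrightarrow> a + b \<in> F \<Longrightarrow> b \<in> F"
    using assms(1) by (auto simp: is_face_def)
  obtain f where "f \<in> F" using assms(1) by (auto simp: is_face_def)
  then show "0 \<in> F" using 1(1) 1(3)[of f 0] assms(2) by auto
qed

locale additive_submonoid =
  fixes F :: "'g::ab_group_add set"
  assumes F_0: "0 \<in> F" and F_add: "\<And>a b. a \<in> F \<Longrightarrow> b \<in> F \<Longrightarrow> a + b \<in> F"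
begin

lemma localize_self: "localize F F = group_closure F"
proof
  show "localize F F \<subseteq> group_closure F"
  proof
    fix g assume "g \<in> localize F F"
    then obtain f where "f \<in> F" "g + f \<in> F" by (auto simp: localize_def)
    then have "g + f - f \<in> group_closure F"
      by (intro group_closure.diff group_closure.base) auto
    then show "g \<in> group_closure F" by simp
  qed
  show "group_closure F \<subseteq> localize F F"
  proof
    fix g assume "g \<in> group_closure F"
    then show "g \<in> localize F F"
    proof (induction rule: group_closure.induct)
      case (base s)
      then show ?case using F_0 by (auto simp: localize_def intro!: bexI[of _ 0])
    next
      case (diff s t)
      then obtain a b where ab: "a \<in> F" "s + a \<in> F" "b \<in> F" "t + b \<in> F" by (auto simp: localize_def)
      have "s - t + (a + (t + b)) = s + a + b" by (simp add: algebra_simps)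
      then have "s - t + (a + (t + b)) \<in> F" "a + (t + b) \<in> F" 
        using F_add[OF ab(2,3)] F_add[OF ab(1) ab(4)] by (simp_all only:)
      then show ?case unfolding localize_def by blast
    qed
  qed
qed

lemma subset_localize: "W \<subseteq> localize F W"
  using F_0 by (auto simp: localize_def intro!: bexI[of _ 0])

lemma localize_add:
  assumes "\<And>q a. q \<in> V \<Longrightarrow> a \<in> W \<Longrightarrow> q + a \<in> W" "p \<in> localize F V" "w \<in> localize F W"
  shows "p + w \<in> localize F W"
proof -
  obtain f g where fg: "f \<in> F" "p + f \<in> V" "g \<in> F" "w + g \<in> W"
    using assms by (auto simp: localize_def)
  then have "(p + f) + (w + g) \<in> W" using assms(1) by blast
  then have "p + w + (f + g) \<in> W" by (simp add: algebra_simps)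
  then show ?thesis unfolding localize_def using fg F_add by blast
qed

text \<open>Finitely many exponents have a common denominator.\<close>

lemma localize_uniform:
  assumes W: "\<And>f a. f \<in> F \<Longrightarrow> a \<in> W \<Longrightarrow> f + a \<in> W" and "finite K" "K \<subseteq> localize F W"
  shows "\<exists>f\<in>F. \<forall>k\<in>K. f + k \<in> W"
  using assms(2,3)
proof (induction K rule: finite_induct)
  case (insert k K)
  then obtain f g where fg: "f \<in> F" "\<forall>k\<in>K. f + k \<in> W" "g \<in> F" "k + g \<in> W"
    by (auto simp: localize_def)
  have "f + (k + g) \<in> W" "\<forall>x\<in>K. g + (f + x) \<in> W" using fg W by auto
  then have "\<forall>x\<in>insert k K. f + g + x \<in> W" by (auto simp: algebra_simps)
  then show ?case using F_add[OF fg(1,3)] by blast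
qed (use F_0 in auto)

end

definition face_monomials :: "'g set \<Rightarrow> ('g \<Rightarrow>\<^sub>0 'k::field) set"
  where "face_monomials F = {single f c | f c. f \<in> F \<and> c \<noteq> 0}"

text \<open>The denominators of the homogeneous localization at the prime of \<open>F\<close>, which the definition of multiplicity
  describes as homogeneous elements outside that prime; zero lies in the prime.\<close>

lemma homogeneous_minus_face_prime:
  assumes "F \<subseteq> Q"
  shows "(\<Union>g. monoid_algebra_grading Q g) - face_prime Q F = face_monomials F"
proof (intro Set.set_eqI iffI)
  fix s :: "'a \<Rightarrow>\<^sub>0 'b" assume "s \<in> (\<Union>g. monoid_algebra_grading Q g) - face_prime Q F"
  then obtain g where "keys s \<subseteq> Q \<inter> {g}" "\<not> keys s \<subseteq> Q - F"
    by (auto simp: monoid_algebra_grading_def face_prime_def)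
  then have g: "keys s \<subseteq> {g}" "g \<in> F" "keys s \<noteq> {}" by auto
  then have "s = single g (lookup s g)"
    by (intro poly_mapping_eqI) (auto simp: lookup_single when_def in_keys_iff subset_iff)
  moreover have "g \<in> keys s" using g by blast
  then have "lookup s g \<noteq> 0" by (simp add: in_keys_iff)
  ultimately show "s \<in> face_monomials F" using g(2) unfolding face_monomials_def by blast
next
  fix s :: "'a \<Rightarrow>\<^sub>0 'b" assume "s \<in> face_monomials F"
  then show "s \<in> (\<Union>g. monoid_algebra_grading Q g) - face_prime Q F"
    using assms by (auto simp: monoid_algebra_grading_def face_prime_def face_monomials_def)
qed

text \<open>Monomials with nonzero coefficient are units of the group algebra; this is their inverse.\<close>

definition unit_inverse :: "'a::comm_ring_1 \<Rightarrow> 'a"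
  where "unit_inverse s = (THE u. s * u = 1)"

lemma unit_inverse_eq:
  assumes "s * u = 1"
  shows "unit_inverse s = u"
  unfolding unit_inverse_def
proof (rule the_equality)
  show "s * u = 1" by (fact assms)
next
  fix v assume "s * v = 1"
  then have "u = u * (s * v)" by simp
  also have "\<dots> = (s * u) * v" by (simp add: mult_ac)
  finally show "v = u" using assms by simp
qed

lemma single_unit_inverse:
  "c \<noteq> 0 \<Longrightarrow> unit_inverse (single f c) = single (- f :: 'g::ab_group_add) (inverse (c :: 'k::field))"
  by (rule unit_inverse_eq) (simp add: mult_single)

lemma face_monomial_inverse:
  "s \<in> face_monomials F \<Longrightarrow> s * unit_inverse s = (1 :: 'g::ab_group_add \<Rightarrow>\<^sub>0 'k::field)"
  by (auto simp: face_monomials_def single_unit_inverse mult_single)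

lemma face_monomial_inverse_mult:
  assumes "s \<in> face_monomials F" "t \<in> face_monomials F"
  shows "unit_inverse (s * t) = unit_inverse s * unit_inverse (t :: 'g::ab_group_add \<Rightarrow>\<^sub>0 'k::field)"
proof (rule unit_inverse_eq)
  have "s * t * (unit_inverse s * unit_inverse t) = (s * unit_inverse s) * (t * unit_inverse t)"
    by (simp only: mult_ac)
  then show "s * t * (unit_inverse s * unit_inverse t) = 1"
    using assms by (simp add: face_monomial_inverse)
qed

lemma UN_pairs_const:
  assumes "X \<noteq> {}" "\<And>x s. (x, s) \<in> X \<Longrightarrow> f x s = c"
  shows "(\<Union>(x, s)\<in>X. f x s) = c"
proof -
  have "(\<Union>p\<in>X. case p of (x, s) \<Rightarrow> f x s) = (\<Union>p\<in>X. c)"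
    using assms(2) by (intro SUP_cong) auto
  then show ?thesis using assms(1) by simp
qed

text \<open>The fraction \<open>v/s\<close> computed inside the group algebra, reduced modulo the localization of \<open>K[B]\<close>.\<close>

definition fraction_value ::
    "'g::ab_group_add set \<Rightarrow> 'g set \<Rightarrow> 'g set \<Rightarrow> ('g \<Rightarrow>\<^sub>0 'k::field) \<Rightarrow> ('g \<Rightarrow>\<^sub>0 'k) \<Rightarrow> ('g \<Rightarrow>\<^sub>0 'k)"
  where "fraction_value F A B v s = trunc (localize F A - localize F B) (unit_inverse s * v)"

locale localizable_module = truncated_module "monoid_algebra Q" "\<lambda>a. a" Q N NC \<theta> A B
  for Q :: "'g::ab_group_add set"
    and N :: "('g \<Rightarrow>\<^sub>0 'k::field, 'm, 'd) module_scheme" and NC \<theta> A B +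
  fixes F :: "'g set"
  assumes face: "is_face Q F"
begin

abbreviation "D \<equiv> A - B"
abbreviation "Q' \<equiv> localize F Q"
abbreviation "A' \<equiv> localize F A"
abbreviation "B' \<equiv> localize F B"
abbreviation "D' \<equiv> A' - B'"
abbreviation "S \<equiv> face_monomials F :: ('g \<Rightarrow>\<^sub>0 'k) set"
abbreviation "val \<equiv> fraction_value F A B"

text \<open>The fibre of the value map over \<open>u\<close>. Fractions turn out to be exactly these fibres, which makes \<open>frac_of\<close> the
  identification of polynomials with elements of the localized module.\<close>

definition frac_of :: "('g \<Rightarrow>\<^sub>0 'k) \<Rightarrow> ('m \<times> ('g \<Rightarrow>\<^sub>0 'k)) set"
  where "frac_of u = {(\<theta> w, t) | w t. w \<in> span_on D \<and> t \<in> S \<and> val w t = u}"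

lemma F_Q: "F \<subseteq> Q" using is_faceD(1)[OF face Q_0] .

sublocale additive_submonoid F
  using is_faceD(2,3)[OF face Q_0] by unfold_locales

lemma A_add_F: "f \<in> F \<Longrightarrow> a \<in> A \<Longrightarrow> f + a \<in> A"
  using F_Q A_add by blast

lemma B_add_F: "f \<in> F \<Longrightarrow> b \<in> B \<Longrightarrow> f + b \<in> B"
  using F_Q B_add by blast

lemma Q'_add_B': "q \<in> Q' \<Longrightarrow> b \<in> B' \<Longrightarrow> q + b \<in> B'"
  by (rule localize_add[OF B_add])

lemma Q'_add_A': "q \<in> Q' \<Longrightarrow> a \<in> A' \<Longrightarrow> q + a \<in> A'"
  by (rule localize_add[OF A_add])

lemma minus_F_Q': "f \<in> F \<Longrightarrow> - f \<in> Q'"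
  using Q_0 by (auto simp: localize_def intro!: bexI[of _ f])

lemma Q_Q': "q \<in> Q \<Longrightarrow> q \<in> Q'"
  using subset_localize[of Q] by blast

lemma S_Q: "s \<in> S \<Longrightarrow> s \<in> span_on Q"
  using F_Q by (auto simp: face_monomials_def span_on_single)

lemma S_inv_Q': "s \<in> S \<Longrightarrow> unit_inverse s \<in> span_on Q'"
  by (auto simp: face_monomials_def single_unit_inverse span_on_single minus_F_Q')

lemma S_mult: "s \<in> S \<Longrightarrow> t \<in> S \<Longrightarrow> s * t \<in> S"
proof -
  assume "s \<in> S" "t \<in> S"
  then obtain f c g d where "s = single f c" "f \<in> F" "c \<noteq> 0" "t = single g d" "g \<in> F" "d \<noteq> 0"
    by (auto simp: face_monomials_def)
  then have "s * t = single (f + g) (c * d)" "f + g \<in> F" "c * d \<noteq> 0"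
    by (simp_all add: mult_single F_add)
  then show "s * t \<in> S" unfolding face_monomials_def by blast
qed

lemma single_F_S: "f \<in> F \<Longrightarrow> single f 1 \<in> S"
  unfolding face_monomials_def by (rule CollectI, intro exI[of _ f] exI[of _ 1]) simp

lemma one_S: "1 \<in> S"
  using single_F_S[OF F_0] by simp

lemma D_A: "v \<in> span_on D \<Longrightarrow> v \<in> span_on A"
  using span_on_mono[of D A] by auto

lemma A_A': "v \<in> span_on A \<Longrightarrow> v \<in> span_on A'"
  by (rule subsetD[OF span_on_mono[OF subset_localize]])

lemma span_Q_Q': "a \<in> span_on Q \<Longrightarrow> a \<in> span_on Q'"
  by (rule subsetD[OF span_on_mono[OF subset_localize]])

lemma Q_mult_A: "a \<in> span_on Q \<Longrightarrow> v \<in> span_on A \<Longrightarrow> a * v \<in> span_on A"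
  by (rule span_on_mult[OF _ _ A_add])

lemma Q'_mult_A': "a \<in> span_on Q' \<Longrightarrow> v \<in> span_on A' \<Longrightarrow> a * v \<in> span_on A'"
  by (rule span_on_mult[OF _ _ Q'_add_A'])

lemma trunc_Q: "(a :: 'g \<Rightarrow>\<^sub>0 'k) \<in> span_on Q \<Longrightarrow> v \<in> span_on A \<Longrightarrow> trunc D (a * trunc D v) = trunc D (a * v)"
  using B_add by (elim trunc_mult_trunc) auto

lemma trunc_Q': "(a :: 'g \<Rightarrow>\<^sub>0 'k) \<in> span_on Q' \<Longrightarrow> v \<in> span_on A' \<Longrightarrow> trunc D' (a * trunc D' v) = trunc D' (a * v)"
  using Q'_add_B' by (elim trunc_mult_trunc) auto

lemma trunc_Q'_Q: "(a :: 'g \<Rightarrow>\<^sub>0 'k) \<in> span_on Q' \<Longrightarrow> v \<in> span_on A \<Longrightarrow> trunc D' (a * trunc D v) = trunc D' (a * v)"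
  using Q'_add_B' subset_localize[of B] by (elim trunc_mult_trunc) auto

lemma val_span: "val v s \<in> span_on D'"
  by (simp add: fraction_value_def)

text \<open>
  Two fractions \<open>v/s\<close> and \<open>w/t\<close> are equal iff some monomial with exponent in \<open>F\<close> moves all exponents of \<open>t v - s w\<close>
  into \<open>B\<close>. As there are finitely many exponents, this happens iff each of them lies in the localization of \<open>B\<close>, that
  is, iff the difference of the two values is truncated to zero.
\<close>

lemma fraction_rel_iff:
  assumes v: "v \<in> span_on D" and w: "w \<in> span_on D" and s: "s \<in> S" and t: "t \<in> S"
  shows "((\<theta> v, s), (\<theta> w, t)) \<in> fraction_rel (monoid_algebra Q) S N \<longleftrightarrow> val v s = val w t"
proof -
  define h where "h = t * v - s * w"
  have h: "h \<in> span_on A"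
    unfolding h_def using v w s t by (intro span_on_diff Q_mult_A S_Q D_A)
  have smult: "u \<odot>\<^bsub>N\<^esub> (r \<odot>\<^bsub>N\<^esub> \<theta> x) = \<theta> (trunc D (u * (r * x)))"
    if "u \<in> S" "r \<in> S" "x \<in> span_on D" for u r x
    using that by (simp add: N_smult S_Q trunc_Q Q_mult_A D_A)
  have "((\<theta> v, s), (\<theta> w, t)) \<in> fraction_rel (monoid_algebra Q) S N \<longleftrightarrow>
      (\<exists>u\<in>S. \<theta> (trunc D (u * (t * v))) = \<theta> (trunc D (u * (s * w))))"
    using assms by (auto simp: fraction_rel_def smult N_carrier)
  also have "\<dots> \<longleftrightarrow> (\<exists>u\<in>S. trunc D (u * h) = 0)"
    by (simp add: theta_eq_iff h_def right_diff_distrib trunc_diff)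
  also have "\<dots> \<longleftrightarrow> (\<exists>f\<in>F. \<forall>k\<in>keys h. f + k \<in> B)"
  proof -
    have "trunc D (single f c * h) = 0 \<longleftrightarrow> (\<forall>k\<in>keys h. f + k \<in> B)" if "f \<in> F" "c \<noteq> 0" for f c
    proof -
      have "f + k \<in> A" if "k \<in> keys h" for k
        using that h A_add_F[OF \<open>f \<in> F\<close>] by (auto simp: span_on_def)
      then show ?thesis using that by (auto simp: trunc_eq_0_iff keys_single_mult)
    qed
    then show ?thesis by (auto simp: face_monomials_def) (metis one_neq_zero)
  qed
  also have "\<dots> \<longleftrightarrow> keys h \<subseteq> B'"
  proof
    assume "\<exists>f\<in>F. \<forall>k\<in>keys h. f + k \<in> B"
    then obtain f where f: "f \<in> F" "\<And>k. k \<in> keys h \<Longrightarrow> k + f \<in> B" by (auto simp: add.commute)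
    show "keys h \<subseteq> B'"
    proof
      fix k assume "k \<in> keys h"
      then show "k \<in> B'" unfolding localize_def using f by blast
    qed
  qed (simp add: localize_uniform[of B "keys h", OF B_add_F])
  also have "\<dots> \<longleftrightarrow> trunc D' (unit_inverse (s * t) * h) = 0"
  proof -
    obtain a c where ac: "s * t = single a c" "a \<in> F" "c \<noteq> 0"
      using S_mult[OF s t] by (auto simp: face_monomials_def)
    have "- a + k \<in> D' \<longleftrightarrow> k \<notin> B'" if "k \<in> keys h" for k
    proof -
      have "k \<in> A" using that h by (auto simp: span_on_def)
      then have "- a + k \<in> A'" using subset_localize[of A] by (intro Q'_add_A' minus_F_Q' ac) auto
      moreover have "- a + k \<in> B' \<longleftrightarrow> k \<in> B'"
        using Q'_add_B'[of "- a" k] Q'_add_B'[of a "- a + k"] minus_F_Q' ac F_Q Q_Q' by auto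
      ultimately show ?thesis by blast
    qed
    then show ?thesis
      using ac by (auto simp: trunc_eq_0_iff single_unit_inverse keys_single_mult)
  qed
  also have "unit_inverse (s * t) * h =
      (t * unit_inverse t) * (unit_inverse s * v) - (s * unit_inverse s) * (unit_inverse t * w)"
    by (simp add: h_def face_monomial_inverse_mult[OF s t] algebra_simps)
  also have "\<dots> = unit_inverse s * v - unit_inverse t * w"
    by (simp add: face_monomial_inverse[OF s] face_monomial_inverse[OF t])
  finally show ?thesis by (simp add: fraction_value_def trunc_diff)
qed

lemma fraction_eq:
  assumes v: "v \<in> span_on D" and s: "s \<in> S"
  shows "fraction (monoid_algebra Q) S N (\<theta> v) s = frac_of (val v s)"
proof -
  have "p \<in> fraction_rel (monoid_algebra Q) S N `` {(\<theta> v, s)} \<longleftrightarrow> p \<in> frac_of (val v s)" for p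
  proof
    assume p: "p \<in> fraction_rel (monoid_algebra Q) S N `` {(\<theta> v, s)}"
    then obtain w t where "p = (\<theta> w, t)" "w \<in> span_on D" "t \<in> S"
      by (auto simp: fraction_rel_def N_carrier)
    then show "p \<in> frac_of (val v s)"
      using p fraction_rel_iff[OF v _ s, of w t] by (auto simp: frac_of_def)
  next
    assume "p \<in> frac_of (val v s)"
    then obtain w t where "p = (\<theta> w, t)" "w \<in> span_on D" "t \<in> S" "val v s = val w t"
      by (auto simp: frac_of_def)
    then show "p \<in> fraction_rel (monoid_algebra Q) S N `` {(\<theta> v, s)}"
      using fraction_rel_iff[OF v _ s, of w t] by auto
  qed
  then show ?thesis unfolding fraction_def by blast
qed

text \<open>Each polynomial on the localized support is a value: a common denominator of its exponents clears it.\<close>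

lemma val_surj:
  assumes u: "u \<in> span_on D'"
  obtains v f where "f \<in> F" "v = single f 1 * u" "v \<in> span_on D" "val v (single f 1) = u"
proof -
  have "keys u \<subseteq> A'" using u by (auto simp: span_on_def)
  then obtain f where f: "f \<in> F" "\<And>k. k \<in> keys u \<Longrightarrow> f + k \<in> A"
    using localize_uniform[of A "keys u", OF A_add_F] by auto
  have "f + k \<notin> B" if "k \<in> keys u" for k
  proof
    assume "f + k \<in> B"
    then have "k \<in> B'" using f(1) by (auto simp: localize_def add.commute[of k])
    then show False using that u by (auto simp: span_on_def)
  qed
  then have "single f 1 * u \<in> span_on D"
    using f(2) by (auto simp: span_on_def keys_single_mult)
  moreover have "val (single f 1 * u) (single f 1) = u"
  proof -
    have "unit_inverse (single f 1) * (single f 1 * u) = single f 1 * unit_inverse (single f 1) * u"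
      by (simp only: mult_ac)
    also have "\<dots> = u" by (simp add: single_unit_inverse mult_single)
    finally show ?thesis using u by (simp add: fraction_value_def trunc_id)
  qed
  ultimately show thesis using that f(1) by blast
qed

lemma frac_of_nonempty: "u \<in> span_on D' \<Longrightarrow> frac_of u \<noteq> {}"
proof -
  assume "u \<in> span_on D'"
  then obtain v f where "f \<in> F" "v \<in> span_on D" "val v (single f 1) = u" by (rule val_surj)
  then have "(\<theta> v, single f 1) \<in> frac_of u" unfolding frac_of_def using single_F_S by blast
  then show ?thesis by blast
qed

lemma frac_ofE:
  assumes "(x, t) \<in> frac_of u"
  obtains w where "x = \<theta> w" "w \<in> span_on D" "t \<in> S" "val w t = u"
  using assms unfolding frac_of_def by blast

lemma frac_of_inj: "inj_on frac_of (span_on D')"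
proof (rule inj_onI)
  fix u u' assume u: "u \<in> span_on D'" and eq: "frac_of u = frac_of u'"
  obtain x t where xt: "(x, t) \<in> frac_of u" using frac_of_nonempty[OF u] by auto
  from xt obtain w where w: "x = \<theta> w" "w \<in> span_on D" "val w t = u" by (rule frac_ofE)
  from xt[unfolded eq] obtain w' where w': "x = \<theta> w'" "w' \<in> span_on D" "val w' t = u'" by (rule frac_ofE)
  have "w = w'" using w w' theta_eq_iff by simp
  with w w' show "u = u'" by simp
qed

lemma fraction_carrier:
  "{fraction (monoid_algebra Q) S N x s | x s. x \<in> carrier N \<and> s \<in> S} = frac_of ` span_on D'"
proof (intro Set.equalityI subsetI)
  fix X assume "X \<in> frac_of ` span_on D'"
  then obtain u where u: "u \<in> span_on D'" "X = frac_of u" by blast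
  from val_surj[OF this(1)] obtain v f
    where "f \<in> F" "v \<in> span_on D" "val v (single f 1) = u" by blast
  then have "X = fraction (monoid_algebra Q) S N (\<theta> v) (single f 1)" "\<theta> v \<in> carrier N" "single f 1 \<in> S"
    using u single_F_S by (auto simp: fraction_eq N_carrier)
  then show "X \<in> {fraction (monoid_algebra Q) S N x s | x s. x \<in> carrier N \<and> s \<in> S}" by blast
next
  fix X assume "X \<in> {fraction (monoid_algebra Q) S N x s | x s. x \<in> carrier N \<and> s \<in> S}"
  then obtain v s where "v \<in> span_on D" "s \<in> S" "X = fraction (monoid_algebra Q) S N (\<theta> v) s"
    unfolding N_carrier by blast
  then show "X \<in> frac_of ` span_on D'" by (simp add: fraction_eq val_span)
qed

text \<open>The sum of two fractions is defined as a union over all representatives. All members of this union have the same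
  value \<open>p + q\<close>, so they are one and the same fibre.\<close>

lemma fraction_add:
  assumes "X = frac_of p" "Y = frac_of q" "p \<in> span_on D'" "q \<in> span_on D'"
  shows "(\<Union>(x, s)\<in>X. \<Union>(y, t)\<in>Y.
      fraction (monoid_algebra Q) S N (t \<odot>\<^bsub>N\<^esub> x \<oplus>\<^bsub>N\<^esub> s \<odot>\<^bsub>N\<^esub> y) (s \<otimes>\<^bsub>monoid_algebra Q\<^esub> t)) = frac_of (p + q)"
proof -
  have "fraction (monoid_algebra Q) S N (t \<odot>\<^bsub>N\<^esub> x \<oplus>\<^bsub>N\<^esub> s \<odot>\<^bsub>N\<^esub> y) (s \<otimes>\<^bsub>monoid_algebra Q\<^esub> t) = frac_of (p + q)"
    if xs: "(x, s) \<in> X" and yt: "(y, t) \<in> Y" for x s y t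
  proof -
    from xs[unfolded assms(1)] obtain v where v: "x = \<theta> v" "v \<in> span_on D" "s \<in> S" "val v s = p"
      by (rule frac_ofE)
    from yt[unfolded assms(2)] obtain w where w: "y = \<theta> w" "w \<in> span_on D" "t \<in> S" "val w t = q"
      by (rule frac_ofE)
    have st: "s * t \<in> S" using v w S_mult by blast
    have "t \<odot>\<^bsub>N\<^esub> x \<oplus>\<^bsub>N\<^esub> s \<odot>\<^bsub>N\<^esub> y = \<theta> (trunc D (t * v + s * w))"
      using v w by (simp add: N_smult S_Q N_add trunc_add)
    then have "fraction (monoid_algebra Q) S N (t \<odot>\<^bsub>N\<^esub> x \<oplus>\<^bsub>N\<^esub> s \<odot>\<^bsub>N\<^esub> y) (s * t)
        = frac_of (val (trunc D (t * v + s * w)) (s * t))"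
      using st by (simp add: fraction_eq)
    also have "val (trunc D (t * v + s * w)) (s * t) = trunc D' (unit_inverse (s * t) * (t * v + s * w))"
      unfolding fraction_value_def using v w st
      by (intro trunc_Q'_Q S_inv_Q' span_on_add Q_mult_A S_Q D_A)
    also have "unit_inverse (s * t) * (t * v + s * w) =
        (t * unit_inverse t) * (unit_inverse s * v) + (s * unit_inverse s) * (unit_inverse t * w)"
      by (simp add: face_monomial_inverse_mult[OF v(3) w(3)] algebra_simps)
    also have "\<dots> = unit_inverse s * v + unit_inverse t * w"
      by (simp add: face_monomial_inverse[OF v(3)] face_monomial_inverse[OF w(3)])
    also have "trunc D' \<dots> = p + q"
      using v w by (simp add: trunc_add fraction_value_def)
    finally show ?thesis by (simp add: monoid_algebra_def)
  qed
  moreover have "X \<noteq> {}" "Y \<noteq> {}" using assms frac_of_nonempty by auto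
  ultimately show ?thesis by (intro UN_pairs_const)
qed

text \<open>The set \<open>X\<close> stands for a fraction of ring elements with value \<open>p\<close>; it enters only through the value of its
  members.\<close>

lemma fraction_smult:
  assumes "\<And>a s. (a, s) \<in> X \<Longrightarrow> a \<in> span_on Q \<and> s \<in> S \<and> unit_inverse s * a = p"
    and "Y = frac_of q" "X \<noteq> {}" "q \<in> span_on D'"
  shows "(\<Union>(a, s)\<in>X. \<Union>(y, t)\<in>Y.
      fraction (monoid_algebra Q) S N (a \<odot>\<^bsub>N\<^esub> y) (s \<otimes>\<^bsub>monoid_algebra Q\<^esub> t)) = frac_of (trunc D' (p * q))"
proof -
  have "fraction (monoid_algebra Q) S N (a \<odot>\<^bsub>N\<^esub> y) (s \<otimes>\<^bsub>monoid_algebra Q\<^esub> t) = frac_of (trunc D' (p * q))"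
    if as: "(a, s) \<in> X" and yt: "(y, t) \<in> Y" for a s y t
  proof -
    from yt[unfolded assms(2)] obtain w where w: "y = \<theta> w" "w \<in> span_on D" "t \<in> S" "val w t = q"
      by (rule frac_ofE)
    have a: "a \<in> span_on Q" "s \<in> S" "unit_inverse s * a = p" using assms(1)[OF as] by auto
    have st: "s * t \<in> S" using a w S_mult by blast
    have "fraction (monoid_algebra Q) S N (a \<odot>\<^bsub>N\<^esub> y) (s * t) = frac_of (val (trunc D (a * w)) (s * t))"
      using a w st by (simp add: N_smult fraction_eq)
    also have "val (trunc D (a * w)) (s * t) = trunc D' (unit_inverse (s * t) * (a * w))"
      unfolding fraction_value_def using a w st
      by (intro trunc_Q'_Q S_inv_Q' Q_mult_A D_A)
    also have "unit_inverse (s * t) * (a * w) = (unit_inverse s * a) * (unit_inverse t * w)"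
      by (simp add: face_monomial_inverse_mult[OF a(2) w(3)] mult_ac)
    also have "trunc D' \<dots> = trunc D' ((unit_inverse s * a) * trunc D' (unit_inverse t * w))"
      using a w by (intro trunc_Q'[symmetric] Q'_mult_A' S_inv_Q' A_A' D_A
          span_on_mult[OF S_inv_Q' span_Q_Q'] localize_add[OF Q_add]) auto
    also have "\<dots> = trunc D' (p * q)" using a w by (simp add: fraction_value_def)
    finally show ?thesis by (simp add: monoid_algebra_def)
  qed
  moreover have "Y \<noteq> {}" using assms frac_of_nonempty by auto
  ultimately show ?thesis using \<open>X \<noteq> {}\<close> by (intro UN_pairs_const)
qed

lemma fraction_grading:
  "localized_grading (monoid_algebra Q) (monoid_algebra_grading Q) S N NC g = frac_of ` span_on (D' \<inter> {g})"
proof (intro Set.equalityI subsetI)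
  fix X assume "X \<in> localized_grading (monoid_algebra Q) (monoid_algebra_grading Q) S N NC g"
  then obtain v s h d where v: "X = fraction (monoid_algebra Q) S N (\<theta> v) s"
    "v \<in> span_on (D \<inter> {h})" "s \<in> S" "s \<in> monoid_algebra_grading Q d" "g = h - d"
    by (auto simp: localized_grading_def NC_eq)
  obtain c where c: "s = single d c" "c \<noteq> 0"
    using v(3,4) by (auto simp: face_monomials_def monoid_algebra_grading_def split: if_splits)
  have vD: "v \<in> span_on D" using v(2) by (auto simp: span_on_def)
  have "val v s \<in> span_on (D' \<inter> {g})"
    using v(2,5) c by (auto simp: fraction_value_def span_on_def keys_trunc single_unit_inverse keys_single_mult)
  then show "X \<in> frac_of ` span_on (D' \<inter> {g})"
    using fraction_eq[OF vD v(3)] v(1) by auto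
next
  fix X assume "X \<in> frac_of ` span_on (D' \<inter> {g})"
  then obtain u where u: "u \<in> span_on (D' \<inter> {g})" "X = frac_of u" by blast
  then have "u \<in> span_on D'" by (auto simp: span_on_def)
  then obtain v f where v: "f \<in> F" "v = single f 1 * u" "v \<in> span_on D" "val v (single f 1) = u"
    by (rule val_surj)
  have "v \<in> span_on (D \<inter> {g + f})"
    using u(1) v(2,3) by (auto simp: span_on_def keys_single_mult add.commute)
  then have "\<theta> v \<in> NC (g + f)" by (auto simp: NC_eq)
  moreover have "single f (1::'k) \<in> S \<inter> monoid_algebra_grading Q f"
    using v(1) F_Q single_F_S by (auto simp: monoid_algebra_grading_def)
  moreover have "X = fraction (monoid_algebra Q) S N (\<theta> v) (single f 1)" "g = (g + f) - f"
    using u v single_F_S by (simp_all add: fraction_eq)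
  ultimately show "X \<in> localized_grading (monoid_algebra Q) (monoid_algebra_grading Q) S N NC g"
    unfolding localized_grading_def by blast
qed

end

section \<open>Localization and multiplicity\<close>

text \<open>
  With \<open>B\<close> empty nothing is truncated. For \<open>A = Q\<close> this is the ring as a module over itself, whose localization
  is thereby a special case of the localization of modules; for \<open>A = \<int>Q\<close> it is the ambient module of the theorem.
\<close>

lemma self_module_truncated:
  fixes Q :: "'g::ab_group_add set"
  assumes "0 \<in> Q" "\<And>p q. p \<in> Q \<Longrightarrow> q \<in> Q \<Longrightarrow> p + q \<in> Q" "Q \<subseteq> A" "\<And>q a. q \<in> Q \<Longrightarrow> a \<in> A \<Longrightarrow> q + a \<in> A"
  shows "truncated_module (monoid_algebra Q :: ('g \<Rightarrow>\<^sub>0 'k::field) ring) (\<lambda>a. a) Q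
    (self_module (monoid_algebra A)) (monoid_algebra_grading A) (\<lambda>a. a) A {}"
proof
  fix a v :: "'g \<Rightarrow>\<^sub>0 'k" assume "a \<in> span_on Q" "v \<in> span_on (A - {})"
  then have "a * v \<in> span_on A" using assms(4) by (auto intro: span_on_mult[of a Q v A])
  then show "a \<odot>\<^bsub>self_module (monoid_algebra A)\<^esub> v = trunc (A - {}) (a * v)"
    by (simp add: self_module_def monoid_algebra_def trunc_id)
qed (use assms in \<open>auto simp: self_module_def monoid_algebra_def monoid_algebra_grading_def span_on_def\<close>)

text \<open>The support of \<open>H\<^sup>0\<close> of the localization of \<open>K[A]/K[B]\<close> at the prime of \<open>F\<close>. The exponents of the localized
  ring outside \<open>\<int>F\<close> are those of the extension of this prime.\<close>

definition torsion_degrees :: "'g::ab_group_add set \<Rightarrow> 'g set \<Rightarrow> 'g set \<Rightarrow> 'g set \<Rightarrow> 'g set"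
  where "torsion_degrees Q A B F = torsion_support (localize F Q) (localize F Q - group_closure F)
    (localize F A - localize F B)"

context localizable_module
begin

abbreviation "face_torsion \<equiv> torsion_degrees Q A B F"

lemma ring_localizable:
  "localizable_module Q (self_module (monoid_algebra Q :: ('g \<Rightarrow>\<^sub>0 'k) ring)) (monoid_algebra_grading Q) (\<lambda>a. a) Q {} F"
  using self_module_truncated[of Q Q, OF Q_0 Q_add order_refl Q_add] face
  by (simp add: localizable_module_def localizable_module_axioms_def)

definition ring_frac_of :: "('g \<Rightarrow>\<^sub>0 'k) \<Rightarrow> (('g \<Rightarrow>\<^sub>0 'k) \<times> ('g \<Rightarrow>\<^sub>0 'k)) set"
  where "ring_frac_of = localizable_module.frac_of (\<lambda>a. a) Q {} F"

lemma ring_frac_of_iff: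
  assumes "(a, s) \<in> ring_frac_of p"
  shows "a \<in> span_on Q" "s \<in> S" "unit_inverse s * a = p"
proof -
  interpret ring: localizable_module Q "self_module (monoid_algebra Q :: ('g \<Rightarrow>\<^sub>0 'k) ring)"
    "monoid_algebra_grading Q" "\<lambda>a. a" Q "{}" F by (rule ring_localizable)
  from assms have as: "a \<in> span_on Q" "s \<in> S" "fraction_value F Q {} a s = p"
    by (auto simp: ring_frac_of_def elim: ring.frac_ofE)
  moreover have "unit_inverse s * a \<in> span_on Q'"
    using as by (intro ring.Q'_mult_A' S_inv_Q' span_Q_Q')
  ultimately show "a \<in> span_on Q" "s \<in> S" "unit_inverse s * a = p"
    by (auto simp: fraction_value_def trunc_id)
qed

text \<open>The localization of \<open>K[A]/K[B]\<close> is the module \<open>K[A - F]/K[B - F]\<close> over \<open>K[Q - F]\<close>; in particular the results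
  on graded submodules and torsion apply to it.\<close>

lemma localized_truncated:
  "truncated_module (localized_ring (monoid_algebra Q) S) ring_frac_of Q'
    (localized_module (monoid_algebra Q) S N)
    (localized_grading (monoid_algebra Q) (monoid_algebra_grading Q) S N NC) frac_of A' B'"
proof -
  interpret ring: localizable_module Q "self_module (monoid_algebra Q :: ('g \<Rightarrow>\<^sub>0 'k) ring)"
    "monoid_algebra_grading Q" "\<lambda>a. a" Q "{}" F by (rule ring_localizable)
  have Q': "Q' - localize F {} = Q'" by simp
  have nonempty: "ring_frac_of a \<noteq> {}" if "a \<in> span_on Q'" for a
    using ring.frac_of_nonempty[of a] that by (simp add: ring_frac_of_def)
  show ?thesis
  proof
    show "0 \<in> Q'" using Q_0 Q_Q' by blast
    show "p + q \<in> Q'" if "p \<in> Q'" "q \<in> Q'" for p q using ring.Q'_add_A' that by blast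
    show "q + a \<in> A'" if "q \<in> Q'" "a \<in> A'" for q a using Q'_add_A' that by blast
    show "q + b \<in> B'" if "q \<in> Q'" "b \<in> B'" for q b using Q'_add_B' that by blast
    show "carrier (localized_ring (monoid_algebra Q) S) = ring_frac_of ` span_on Q'"
      using ring.fraction_carrier
      by (simp add: localized_ring_def localized_module_def ring_frac_of_def)
  next
    fix a b :: "'g \<Rightarrow>\<^sub>0 'k" assume a: "a \<in> span_on Q'" and b: "b \<in> span_on Q'"
    show "ring_frac_of a \<oplus>\<^bsub>localized_ring (monoid_algebra Q) S\<^esub> ring_frac_of b = ring_frac_of (a + b)"
      using ring.fraction_add[OF refl refl, of a b] a b
      by (simp add: localized_ring_def localized_module_def ring_frac_of_def)
    have "a * b \<in> span_on Q'" by (rule ring.Q'_mult_A'[OF a b])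
    then show "ring_frac_of a \<otimes>\<^bsub>localized_ring (monoid_algebra Q) S\<^esub> ring_frac_of b = ring_frac_of (a * b)"
      using ring.fraction_smult[of "ring_frac_of a" a "ring_frac_of b" b] a b nonempty[OF a] ring_frac_of_iff[of _ _ a]
      by (simp add: localized_ring_def localized_module_def trunc_id) (simp add: ring_frac_of_def)
  next
    show "carrier (localized_module (monoid_algebra Q) S N) = frac_of ` span_on D'"
      using fraction_carrier by (simp add: localized_module_def)
    show "inj_on frac_of (span_on D')" by (rule frac_of_inj)
    have "fraction (monoid_algebra Q) S N (\<theta> 0) 1 = frac_of (val 0 1)"
      by (rule fraction_eq) (simp_all add: one_S)
    then show "\<zero>\<^bsub>localized_module (monoid_algebra Q) S N\<^esub> = frac_of 0"
      by (simp add: localized_module_def N_zero monoid_algebra_def fraction_value_def)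
  next
    fix v w :: "'g \<Rightarrow>\<^sub>0 'k" assume "v \<in> span_on D'" "w \<in> span_on D'"
    then show "frac_of v \<oplus>\<^bsub>localized_module (monoid_algebra Q) S N\<^esub> frac_of w = frac_of (v + w)"
      using fraction_add[OF refl refl, of v w] by (simp add: localized_module_def)
  next
    fix a v :: "'g \<Rightarrow>\<^sub>0 'k" assume a: "a \<in> span_on Q'" and v: "v \<in> span_on D'"
    show "ring_frac_of a \<odot>\<^bsub>localized_module (monoid_algebra Q) S N\<^esub> frac_of v = frac_of (trunc D' (a * v))"
      using fraction_smult[of "ring_frac_of a" a "frac_of v" v] v nonempty[OF a] ring_frac_of_iff[of _ _ a]
      by (simp add: localized_module_def)
  next
    show "localized_grading (monoid_algebra Q) (monoid_algebra_grading Q) S N NC g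
        = frac_of ` span_on (D' \<inter> {g})" for g by (rule fraction_grading)
  qed
qed

text \<open>An exponent of \<open>Q - F\<close> (as a set of differences) lies outside \<open>\<int>F\<close> iff the numerators that represent it lie
  outside \<open>F\<close>, because \<open>F\<close> is a face.\<close>

lemma extended_face_prime:
  "extended_ideal (monoid_algebra Q) S (face_prime Q F) = ring_frac_of ` span_on (Q' - group_closure F)"
proof -
  interpret ring: localizable_module Q "self_module (monoid_algebra Q :: ('g \<Rightarrow>\<^sub>0 'k) ring)"
    "monoid_algebra_grading Q" "\<lambda>a. a" Q "{}" F by (rule ring_localizable)
  have shift: "- f + q \<in> Q' - group_closure F" if "f \<in> F" "q \<in> Q - F" for f q
  proof -
    have "- f + q \<in> Q'" using that by (intro ring.Q'_add_A' minus_F_Q') (auto simp: Q_Q')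
    moreover have "- f + q \<notin> group_closure F"
    proof
      assume "- f + q \<in> group_closure F"
      then obtain g where g: "g \<in> F" "- f + q + g \<in> F" using localize_self by (auto simp: localize_def)
      from F_add[OF that(1) g(2)] have "g + q \<in> F" by (simp add: algebra_simps)
      then show False using is_faceD(4)[OF face Q_0, of g q] g F_Q that(2) by blast
    qed
    ultimately show ?thesis by blast
  qed
  show ?thesis
  proof (intro Set.equalityI subsetI)
    fix X assume "X \<in> extended_ideal (monoid_algebra Q) S (face_prime Q F)"
    then obtain a s where a: "X = fraction (monoid_algebra Q) S (self_module (monoid_algebra Q)) a s"
      "keys a \<subseteq> Q - F" "s \<in> S" by (auto simp: extended_ideal_def face_prime_def)
    then obtain f c where s: "s = single f c" "f \<in> F" "c \<noteq> 0" by (auto simp: face_monomials_def)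
    have aQ: "a \<in> span_on Q" using a(2) by (auto simp: span_on_def)
    have J: "unit_inverse s * a \<in> span_on (Q' - group_closure F)"
      using a(2) s shift by (auto simp: span_on_def single_unit_inverse keys_single_mult)
    then have "unit_inverse s * a \<in> span_on Q'" by (auto simp: span_on_def)
    then have "X = ring_frac_of (unit_inverse s * a)"
      using ring.fraction_eq[of a s] aQ a(1,3) by (simp add: ring_frac_of_def fraction_value_def trunc_id)
    then show "X \<in> ring_frac_of ` span_on (Q' - group_closure F)" using J by blast
  next
    fix X assume "X \<in> ring_frac_of ` span_on (Q' - group_closure F)"
    then obtain u where u: "u \<in> span_on (Q' - group_closure F)" "X = ring_frac_of u" by blast
    then have uQ: "u \<in> span_on (Q' - localize F {})" by (auto simp: span_on_def)
    obtain v f where v: "f \<in> F" "v = single f 1 * u" "v \<in> span_on (Q - {})"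
      "fraction_value F Q {} v (single f 1) = u" by (rule ring.val_surj[OF uQ])
    have "f + k \<notin> F" if "k \<in> keys u" for k
    proof
      assume "f + k \<in> F"
      then have "k \<in> group_closure F" using v(1) unfolding localize_self[symmetric]
        by (auto simp: localize_def add.commute[of k])
      then show False using u(1) that by (auto simp: span_on_def)
    qed
    then have "v \<in> face_prime Q F"
      using v(2,3) by (auto simp: span_on_def face_prime_def keys_single_mult)
    moreover have "X = fraction (monoid_algebra Q) S (self_module (monoid_algebra Q)) v (single f 1)"
      using ring.fraction_eq[OF v(3) single_F_S[OF v(1)]] v(4) u(2) by (simp add: ring_frac_of_def)
    ultimately show "X \<in> extended_ideal (monoid_algebra Q) S (face_prime Q F)"
      unfolding extended_ideal_def using single_F_S[OF v(1)] by blast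
  qed
qed

text \<open>The multiplicity is the graded length of the torsion submodule of the localized module. The units among the monomials of
  the localized ring have exponents in \<open>\<int>F\<close>, and \<open>\<int>F\<close> inherits the face property from \<open>F\<close>, so the length
  counts cosets of \<open>\<int>F\<close>.\<close>

lemma multiplicity_on_face_prime:
  assumes fin: "finite ((\<lambda>g. (+) g ` group_closure F) ` face_torsion)"
  shows "multiplicity_on (monoid_algebra Q) (monoid_algebra_grading Q) N NC (face_prime Q F)
    = enat (card ((\<lambda>g. (+) g ` group_closure F) ` face_torsion))"
proof -
  interpret loc: truncated_module "localized_ring (monoid_algebra Q) S" ring_frac_of Q'
    "localized_module (monoid_algebra Q) S N"
    "localized_grading (monoid_algebra Q) (monoid_algebra_grading Q) S N NC" frac_of A' B'
    by (rule localized_truncated)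
  let ?H = "frac_of ` span_on face_torsion"
  have H: "local_cohomology0 (localized_ring (monoid_algebra Q) S)
      (extended_ideal (monoid_algebra Q) S (face_prime Q F)) (localized_module (monoid_algebra Q) S N) = ?H"
    unfolding extended_face_prime torsion_degrees_def by (rule loc.local_cohomology0_eq) auto
  have T: "truncated_ideal Q' D' face_torsion"
    unfolding truncated_ideal_def
  proof (intro conjI ballI impI)
    show "face_torsion \<subseteq> D'" by (auto simp: torsion_degrees_def torsion_support_def)
    fix t q assume t: "t \<in> face_torsion" "q \<in> Q'" "t + q \<in> D'"
    obtain n where n: "\<And>j. j \<in> sum_power Q' (Q' - group_closure F) n \<Longrightarrow> t + j \<notin> D'"
      using t(1) by (auto simp: torsion_degrees_def torsion_support_def)
    have "t + q + j \<notin> D'" if "j \<in> sum_power Q' (Q' - group_closure F) n" for j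
      using n[of "j + q"] sum_power_mult_closed[OF loc.Q_add that t(2)] by (simp add: algebra_simps)
    then show "t + q \<in> face_torsion" using t(3) by (auto simp: torsion_degrees_def torsion_support_def)
  qed
  interpret H: truncated_module "localized_ring (monoid_algebra Q) S" ring_frac_of Q'
    "localized_module (monoid_algebra Q) S N\<lparr>carrier := ?H\<rparr>"
    "\<lambda>g. ?H \<inter> localized_grading (monoid_algebra Q) (monoid_algebra_grading Q) S N NC g"
    frac_of "face_torsion \<union> B'" B'
    by (rule loc.restrict[OF T])
  have eq: "face_torsion \<union> B' - B' = face_torsion" using T by (auto simp: truncated_ideal_def)
  have FQ': "group_closure F \<subseteq> Q'"
    unfolding localize_self[symmetric] using F_Q by (auto simp: localize_def)
  have "graded_length (localized_ring (monoid_algebra Q) S) (localized_module (monoid_algebra Q) S N\<lparr>carrier := ?H\<rparr>)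
      (\<lambda>g. ?H \<inter> localized_grading (monoid_algebra Q) (monoid_algebra_grading Q) S N NC g)
    = enat (card ((\<lambda>g. (+) g ` group_closure F) ` (face_torsion \<union> B' - B')))"
  proof (rule H.graded_length_eq)
    fix p q assume p: "p \<in> Q'" "q \<in> Q'" "p + q \<in> group_closure F"
    obtain f where f: "f \<in> F" "p + f \<in> Q" using p(1) by (auto simp: localize_def)
    obtain g where g: "g \<in> F" "q + g \<in> Q" using p(2) by (auto simp: localize_def)
    obtain h where h: "h \<in> F" "p + q + h \<in> F" using p(3) unfolding localize_self[symmetric] by (auto simp: localize_def)
    have "(p + f + h) + (q + g) = (p + q + h) + (f + g)" by (simp add: algebra_simps)
    also have "\<dots> \<in> F" by (intro F_add f(1) g(1) h(2))
    finally have sum: "(p + f + h) + (q + g) \<in> F" .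
    have "p + f + h \<in> Q" using h(1) F_Q by (intro Q_add f(2)) auto
    from is_faceD(4)[OF face Q_0 this g(2) sum] have "q + g \<in> F" .
    then show "q \<in> group_closure F" unfolding localize_self[symmetric] using g(1) by (auto simp: localize_def)
  qed (use fin FQ' in \<open>auto simp: eq group_closure_add\<close>)
  then show ?thesis
    by (simp add: multiplicity_on_def Let_def homogeneous_minus_face_prime[OF F_Q] H eq)
qed

end

locale monomial_quotient =
  fixes Q A B :: "'g::ab_group_add set"
  assumes Q_0: "0 \<in> Q" and Q_add: "\<And>p q. p \<in> Q \<Longrightarrow> q \<in> Q \<Longrightarrow> p + q \<in> Q"
    and A_add: "\<And>q a. q \<in> Q \<Longrightarrow> a \<in> A \<Longrightarrow> q + a \<in> A"
    and B_add: "\<And>q b. q \<in> Q \<Longrightarrow> b \<in> B \<Longrightarrow> q + b \<in> B"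
    and B_A: "B \<subseteq> A"
begin

text \<open>Truncation to \<open>A - B\<close> has kernel \<open>K[B]\<close> on \<open>K[A]\<close>, so cosets of \<open>K[B]\<close> are its fibres.\<close>

lemma coset_eq:
  fixes P :: "('r, 'g \<Rightarrow>\<^sub>0 'k::field, 'd) module_scheme"
  assumes "add P = (+)" "m \<in> span_on A"
  shows "span_on B +>\<^bsub>P\<^esub> m = {f \<in> span_on A. trunc (A - B) f = trunc (A - B) m}"
proof -
  have "f \<in> span_on B +>\<^bsub>P\<^esub> m \<longleftrightarrow> f - m \<in> span_on B" for f
    using assms(1) by (auto simp: a_r_coset_def' intro: bexI[of _ "f - m"])
  moreover have "f - m \<in> span_on B \<longleftrightarrow> f \<in> span_on A \<and> trunc (A - B) f = trunc (A - B) m" for f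
  proof
    assume f: "f - m \<in> span_on B"
    then have "f - m \<in> span_on A" using span_on_mono[OF B_A] by blast
    from span_on_add[OF this assms(2)] have "f \<in> span_on A" by simp
    moreover have "trunc (A - B) (f - m) = 0" using f by (auto simp: trunc_eq_0_iff span_on_def)
    ultimately show "f \<in> span_on A \<and> trunc (A - B) f = trunc (A - B) m" by (simp add: trunc_diff)
  next
    assume f: "f \<in> span_on A \<and> trunc (A - B) f = trunc (A - B) m"
    then have "f - m \<in> span_on A" "trunc (A - B) (f - m) = 0" using assms(2) by (simp_all add: span_on_diff trunc_diff)
    then show "f - m \<in> span_on B" by (auto simp: trunc_eq_0_iff span_on_def)
  qed
  ultimately show ?thesis by blast
qed

definition coset_of :: "('g \<Rightarrow>\<^sub>0 'k::field) \<Rightarrow> ('g \<Rightarrow>\<^sub>0 'k) set"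
  where "coset_of v = {f \<in> span_on A. trunc (A - B) f = v}"

lemma quotient_truncated:
  fixes P :: "('g \<Rightarrow>\<^sub>0 'k::field, 'g \<Rightarrow>\<^sub>0 'k, 'd) module_scheme"
  assumes P: "add P = (+)" "smult P = (*)" "carrier P = span_on A"
    and MC: "\<And>g. MC g = span_on (A \<inter> {g})"
  shows "truncated_module (monoid_algebra Q) (\<lambda>a. a) Q (quotient_module P (span_on B))
    (quotient_grading P MC (span_on B)) coset_of A B"
proof -
  have coset: "span_on B +>\<^bsub>P\<^esub> m = coset_of (trunc (A - B) m)" if "m \<in> span_on A" for m
    using coset_eq[of P m] P that by (simp add: coset_of_def)
  have DA: "v \<in> span_on A" if "v \<in> span_on (A - B)" for v :: "'g \<Rightarrow>\<^sub>0 'k"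
    using that by (auto simp: span_on_def)
  have mem: "v \<in> coset_of v" if "v \<in> span_on (A - B)" for v :: "'g \<Rightarrow>\<^sub>0 'k"
    using that by (simp add: coset_of_def trunc_id DA)
  have mult: "a * v \<in> span_on A" if "a \<in> span_on Q" "v \<in> span_on A" for a v :: "'g \<Rightarrow>\<^sub>0 'k"
    using that by (rule span_on_mult) (rule A_add)
  show ?thesis
  proof
    show "carrier (quotient_module P (span_on B)) = coset_of ` span_on (A - B)"
    proof (intro Set.equalityI subsetI)
      fix X assume "X \<in> carrier (quotient_module P (span_on B))"
      then obtain m where "m \<in> span_on A" "X = span_on B +>\<^bsub>P\<^esub> m"
        by (auto simp: quotient_module_def A_RCOSETS_def' P)
      then show "X \<in> coset_of ` span_on (A - B)" by (simp add: coset)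
    next
      fix X :: "('g \<Rightarrow>\<^sub>0 'k) set" assume "X \<in> coset_of ` span_on (A - B)"
      then obtain v where "v \<in> span_on (A - B)" "X = coset_of v" by blast
      then have "v \<in> carrier P" "X = span_on B +>\<^bsub>P\<^esub> v" by (simp_all add: P coset DA trunc_id)
      then show "X \<in> carrier (quotient_module P (span_on B))"
        by (auto simp: quotient_module_def A_RCOSETS_def')
    qed
    show "inj_on coset_of (span_on (A - B) :: ('g \<Rightarrow>\<^sub>0 'k) set)"
    proof (rule inj_onI)
      fix v w :: "'g \<Rightarrow>\<^sub>0 'k" assume "v \<in> span_on (A - B)" "w \<in> span_on (A - B)" "coset_of v = coset_of w"
      then have "v \<in> coset_of w" using mem by blast
      then show "v = w" using \<open>v \<in> span_on (A - B)\<close> by (simp add: coset_of_def trunc_id)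
    qed
    have "coset_of 0 = (span_on B :: ('g \<Rightarrow>\<^sub>0 'k) set)"
      using B_A by (auto simp: coset_of_def trunc_eq_0_iff span_on_def)
    then show "\<zero>\<^bsub>quotient_module P (span_on B)\<^esub> = coset_of 0" by (simp add: quotient_module_def)
  next
    fix v w :: "'g \<Rightarrow>\<^sub>0 'k" assume v: "v \<in> span_on (A - B)" and w: "w \<in> span_on (A - B)"
    have "coset_of v <+>\<^bsub>P\<^esub> coset_of w = coset_of (v + w)"
    proof (intro Set.equalityI subsetI)
      fix f assume "f \<in> coset_of v <+>\<^bsub>P\<^esub> coset_of w"
      then obtain x y where "x \<in> coset_of v" "y \<in> coset_of w" "f = x + y"
        unfolding set_add_def' P(1) by blast
      then show "f \<in> coset_of (v + w)"
        by (simp add: coset_of_def span_on_add trunc_add)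
    next
      fix f :: "'g \<Rightarrow>\<^sub>0 'k" assume "f \<in> coset_of (v + w)"
      then have "f - w \<in> coset_of v"
        using w DA[OF w] by (simp add: coset_of_def span_on_diff trunc_diff trunc_id)
      moreover have "f = (f - w) \<oplus>\<^bsub>P\<^esub> w" by (simp add: P)
      ultimately show "f \<in> coset_of v <+>\<^bsub>P\<^esub> coset_of w"
        unfolding set_add_def' using mem[OF w] by blast
    qed
    then show "coset_of v \<oplus>\<^bsub>quotient_module P (span_on B)\<^esub> coset_of w = coset_of (v + w)"
      by (simp add: quotient_module_def)
  next
    fix a v :: "'g \<Rightarrow>\<^sub>0 'k" assume a: "a \<in> span_on Q" and v: "v \<in> span_on (A - B)"
    have "span_on B +>\<^bsub>P\<^esub> (a \<odot>\<^bsub>P\<^esub> x) = coset_of (trunc (A - B) (a * v))" if "x \<in> coset_of v" for x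
    proof -
      have x: "x \<in> span_on A" "trunc (A - B) x = v" using that by (auto simp: coset_of_def)
      have "trunc (A - B) (a * trunc (A - B) x) = trunc (A - B) (a * x)"
        using a x(1) by (rule trunc_mult_trunc) (use B_add in auto)
      then show ?thesis using coset[OF mult[OF a x(1)]] x(2) by (simp add: P)
    qed
    then have "(\<Union>x\<in>coset_of v. span_on B +>\<^bsub>P\<^esub> (a \<odot>\<^bsub>P\<^esub> x)) = coset_of (trunc (A - B) (a * v))"
      using mem[OF v] by auto
    then show "a \<odot>\<^bsub>quotient_module P (span_on B)\<^esub> coset_of v = coset_of (trunc (A - B) (a * v))"
      by (simp add: quotient_module_def)
  next
    fix g
    show "quotient_grading P MC (span_on B) g = coset_of ` span_on ((A - B) \<inter> {g})"
    proof (intro Set.equalityI subsetI)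
      fix X assume "X \<in> quotient_grading P MC (span_on B) g"
      then obtain m where m: "m \<in> span_on (A \<inter> {g})" "X = span_on B +>\<^bsub>P\<^esub> m"
        by (auto simp: quotient_grading_def MC)
      then have "m \<in> span_on A" "trunc (A - B) m \<in> span_on ((A - B) \<inter> {g})"
        by (auto simp: span_on_def keys_trunc)
      then show "X \<in> coset_of ` span_on ((A - B) \<inter> {g})" using m(2) coset by blast
    next
      fix X :: "('g \<Rightarrow>\<^sub>0 'k) set" assume "X \<in> coset_of ` span_on ((A - B) \<inter> {g})"
      then obtain v where v: "v \<in> span_on ((A - B) \<inter> {g})" "X = coset_of v" by blast
      then have "v \<in> MC g" "v \<in> span_on (A - B)" by (auto simp: span_on_def MC)
      moreover from this have "X = span_on B +>\<^bsub>P\<^esub> v" using v by (simp add: coset DA trunc_id)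
      ultimately show "X \<in> quotient_grading P MC (span_on B) g" by (auto simp: quotient_grading_def)
    qed
  qed (auto simp: Q_0 Q_add A_add B_add monoid_algebra_def span_on_def)
qed

end

section \<open>Combinatorics of faces of affine monoids\<close>

lemma coset_shift:
  assumes "w \<in> group_closure F"
  shows "(+) t ` group_closure F = (+) (t + w) ` group_closure F"
proof (intro Set.equalityI image_subsetI)
  fix z assume z: "z \<in> group_closure F"
  have "t + z = (t + w) + (z - w)" by simp
  then show "t + z \<in> (+) (t + w) ` group_closure F" using group_closure.diff[OF z assms] by blast
  have "t + w + z = t + (w + z)" by (simp add: add.assoc)
  then show "t + w + z \<in> (+) t ` group_closure F" using group_closure_add[OF assms z] by blast
qed

lemma sum_mset_replicate_add:
  "sum_mset (replicate_mset (m + n) g) = sum_mset (replicate_mset m g) + sum_mset (replicate_mset n (g :: 'a::comm_monoid_add))"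
  by (induction m) (simp_all add: add_ac)

lemma mem_repeat_mset: "x \<in># repeat_mset n M \<longleftrightarrow> 0 < n \<and> x \<in># M"
  by (simp flip: count_greater_zero_iff)

text \<open>Sequences of naturals have monotone subsequences, and a decreasing one is eventually constant.\<close>

lemma incseq_subseq_nat:
  fixes s :: "nat \<Rightarrow> nat"
  shows "\<exists>h :: nat \<Rightarrow> nat. strict_mono h \<and> (\<forall>i j. i \<le> j \<longrightarrow> s (h i) \<le> s (h j))"
proof -
  obtain h where h: "strict_mono h" "monoseq (\<lambda>n. s (h n))" using seq_monosub[of s] by blast
  show ?thesis
  proof (cases "\<forall>m. \<forall>n\<ge>m. s (h m) \<le> s (h n)")
    case False
    then have dec: "\<And>m n. m \<le> n \<Longrightarrow> s (h n) \<le> s (h m)" using h(2) unfolding monoseq_def by blast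
    obtain N where N: "\<And>n. s (h N) \<le> s (h n)" using ex_has_least_nat[of "\<lambda>_. True" _ "\<lambda>n. s (h n)"] by blast
    have "s (h (N + i)) = s (h N)" for i using dec[of N "N + i"] N[of "N + i"] by simp
    moreover have "strict_mono (\<lambda>i. h (N + i))" using h(1) by (simp add: strict_mono_def)
    ultimately show ?thesis by (intro exI[of _ "\<lambda>i. h (N + i)"]) simp
  qed (use h in blast)
qed

lemma incseq_subseq_count:
  fixes c :: "nat \<Rightarrow> 'a multiset"
  assumes "finite K"
  shows "\<exists>h :: nat \<Rightarrow> nat. strict_mono h \<and> (\<forall>k\<in>K. \<forall>i j. i \<le> j \<longrightarrow> count (c (h i)) k \<le> count (c (h j)) k)"
  using assms
proof (induction K rule: finite_induct)
  case empty
  show ?case by (auto intro: exI[of _ id] simp: strict_mono_def)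
next
  case (insert k K)
  then obtain h :: "nat \<Rightarrow> nat" where h: "strict_mono h" "\<forall>k\<in>K. \<forall>i j. i \<le> j \<longrightarrow> count (c (h i)) k \<le> count (c (h j)) k"
    by blast
  obtain h' :: "nat \<Rightarrow> nat" where h': "strict_mono h'" "\<forall>i j. i \<le> j \<longrightarrow> count (c (h (h' i))) k \<le> count (c (h (h' j))) k"
    using incseq_subseq_nat[of "\<lambda>n. count (c (h n)) k"] by blast
  have "strict_mono (\<lambda>i. h (h' i))" using h(1) h'(1) by (simp add: strict_mono_def)
  moreover have "h' i \<le> h' j" if "i \<le> j" for i j using h'(1) that by (simp add: strict_mono_less_eq)
  ultimately show ?case using h(2) h'(2) by (intro exI[of _ "\<lambda>i. h (h' i)"]) auto
qed

text \<open>A form of Dickson's lemma: passing to subsequences for one element of \<open>K\<close> after the other yields an ascending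
  sequence of distinct multisets, whose sizes then grow without bound.\<close>

lemma infinite_multisets_chain:
  assumes E: "infinite E" and K: "finite K" "\<And>C. C \<in> E \<Longrightarrow> set_mset C \<subseteq> K"
  shows "\<exists>C\<in>E. \<forall>n. \<exists>X. C + X \<in> E \<and> n \<le> size X"
proof -
  obtain c :: "nat \<Rightarrow> 'a multiset" where c: "inj c" "range c \<subseteq> E" using E infinite_countable_subset by blast
  obtain h :: "nat \<Rightarrow> nat" where h: "strict_mono h" "\<And>k i j. k \<in> K \<Longrightarrow> i \<le> j \<Longrightarrow> count (c (h i)) k \<le> count (c (h j)) k"
    using incseq_subseq_count[OF K(1), of c] by blast
  have sub: "c (h i) \<subseteq># c (h j)" if "i \<le> j" for i j
  proof (rule mset_subset_eqI)
    fix k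
    show "count (c (h i)) k \<le> count (c (h j)) k"
    proof (cases "k \<in> K")
      case False
      then have "k \<notin># c (h i)" using K(2)[of "c (h i)"] c(2) by auto
      then show ?thesis by (simp add: not_in_iff)
    qed (use h(2) that in blast)
  qed
  have "size (c (h i)) + 1 \<le> size (c (h (Suc i)))" for i
  proof -
    have "h i \<noteq> h (Suc i)" using h(1) by (simp add: strict_mono_eq)
    then have "c (h i) \<noteq> c (h (Suc i))" using c(1) by (simp add: inj_eq)
    then have "c (h i) \<subset># c (h (Suc i))" using sub[of i "Suc i"] by (simp add: subset_mset.less_le)
    then have "size (c (h i)) < size (c (h (Suc i)))" by (rule mset_subset_size)
    then show ?thesis by simp
  qed
  then have size: "size (c (h 0)) + n \<le> size (c (h n))" for n
    by (induction n) (auto simp: algebra_simps intro: order_trans[rotated])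
  have "\<exists>X. c (h 0) + X \<in> E \<and> n \<le> size X" for n
  proof -
    obtain X where X: "c (h n) = c (h 0) + X" using sub[of 0 n] by (auto simp: mset_subset_eq_exists_conv)
    moreover have "c (h n) \<in> E" using c(2) by blast
    ultimately show ?thesis using size[of n] by (intro exI[of _ X]) simp
  qed
  then show ?thesis using c(2) by blast
qed

text \<open>Elements of a finitely generated monoid are written as sums of multisets of generators, so that the number of factors
  of an element of a power of an ideal can be read off as a size.\<close>

locale affine_quotient = monomial_quotient Q A B for Q A B :: "'g::ab_group_add set" +
  fixes gens :: "'g set"
  assumes finite_gens: "finite gens" and Q_gens: "Q = sum_mset ` {C. set_mset C \<subseteq> gens}"
begin

lemma sum_gens_Q: "set_mset C \<subseteq> gens \<Longrightarrow> sum_mset C \<in> Q"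
  using Q_gens by blast

lemma gens_Q: "gens \<subseteq> Q"
  using sum_gens_Q[of "{#_#}"] by auto

lemma face_gens:
  assumes F: "is_face Q F" and C: "set_mset C \<subseteq> gens"
  shows "sum_mset C \<in> F \<longleftrightarrow> set_mset C \<subseteq> F"
  using C
proof (induction C)
  case (add g C)
  have "g \<in> Q" "sum_mset C \<in> Q" using add.prems gens_Q sum_gens_Q[of C] by auto
  then have "g + sum_mset C \<in> F \<longleftrightarrow> g \<in> F \<and> sum_mset C \<in> F" using F by (simp add: is_face_def)
  then show ?case using add by simp
qed (use is_faceD(2)[OF F Q_0] in simp)

lemma face_subset_iff:
  assumes F: "is_face Q F" and G: "is_face Q G"
  shows "F \<subseteq> G \<longleftrightarrow> gens \<inter> F \<subseteq> G"
proof
  assume sub: "gens \<inter> F \<subseteq> G"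
  show "F \<subseteq> G"
  proof
    fix f assume f: "f \<in> F"
    then obtain C where C: "f = sum_mset C" "set_mset C \<subseteq> gens"
      using is_faceD(1)[OF F Q_0] Q_gens by blast
    then show "f \<in> G" using f sub face_gens[OF F C(2)] face_gens[OF G C(2)] by blast
  qed
qed auto

lemma finite_faces: "finite {F. is_face Q F}"
proof (rule inj_on_finite)
  show "inj_on (\<lambda>F. gens \<inter> F) {F. is_face Q F}"
    using face_subset_iff by (auto intro!: inj_onI)
  show "(\<lambda>F. gens \<inter> F) ` {F. is_face Q F} \<subseteq> Pow gens" by auto
qed (simp add: finite_gens)

end

locale affine_quotient_face = affine_quotient Q A B gens for Q A B :: "'g::ab_group_add set" and gens +
  fixes F :: "'g set"
  assumes face: "is_face Q F"
begin

abbreviation "Q' \<equiv> localize F Q"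
abbreviation "A' \<equiv> localize F A"
abbreviation "B' \<equiv> localize F B"
abbreviation "D' \<equiv> A' - B'"
abbreviation "J \<equiv> Q' - group_closure F"
abbreviation "T \<equiv> torsion_degrees Q A B F"

sublocale additive_submonoid F
  using is_faceD(2,3)[OF face Q_0] by unfold_locales

lemma F_Q: "F \<subseteq> Q" using is_faceD(1)[OF face Q_0] .

lemma group_closure_Q_F:
  assumes "q \<in> Q" "q \<in> group_closure F"
  shows "q \<in> F"
proof -
  obtain f where f: "f \<in> F" "q + f \<in> F" using assms(2) unfolding localize_self[symmetric] by (auto simp: localize_def)
  have "f \<in> Q" using f F_Q by blast
  from is_faceD(4)[OF face Q_0 this assms(1)] f(2) show ?thesis by (simp add: add.commute)
qed

lemma Q_Q': "q \<in> Q \<Longrightarrow> q \<in> Q'"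
  by (rule subsetD[OF subset_localize])

lemma Q'_add: "p \<in> Q' \<Longrightarrow> q \<in> Q' \<Longrightarrow> p + q \<in> Q'"
  by (rule localize_add[OF Q_add])

lemma Q'_add_A': "q \<in> Q' \<Longrightarrow> a \<in> A' \<Longrightarrow> q + a \<in> A'"
  by (rule localize_add[OF A_add])

lemma Q'_add_B': "q \<in> Q' \<Longrightarrow> b \<in> B' \<Longrightarrow> q + b \<in> B'"
  by (rule localize_add[OF B_add])

lemma group_closure_Q': "group_closure F \<subseteq> Q'"
  unfolding localize_self[symmetric] using F_Q by (auto simp: localize_def)

lemma D'_add_group:
  assumes "g \<in> D'" "z \<in> group_closure F"
  shows "g + z \<in> D'"
proof -
  have z: "z \<in> Q'" "- z \<in> Q'" using assms(2) group_closure_Q' by auto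
  have "z + g \<in> A'" using assms(1) z(1) by (intro Q'_add_A') auto
  moreover have "z + g \<notin> B'" using Q'_add_B'[OF z(2), of "z + g"] assms(1) by auto
  ultimately show ?thesis by (simp add: add.commute)
qed

text \<open>Generators in \<open>F\<close> are units of the localized monoid; they are collected in \<open>z\<close>.\<close>

lemma Q'_decompose:
  assumes "q \<in> Q'"
  obtains C z where "set_mset C \<subseteq> gens - F" "z \<in> group_closure F" "q = sum_mset C + z"
proof -
  obtain f where f: "f \<in> F" "q + f \<in> Q" using assms by (auto simp: localize_def)
  then obtain C where C: "q + f = sum_mset C" "set_mset C \<subseteq> gens" using Q_gens by blast
  define C1 C2 where "C1 = filter_mset (\<lambda>g. g \<notin> F) C" and "C2 = filter_mset (\<lambda>g. g \<in> F) C"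
  have "C = C2 + C1" using multiset_partition[of C "\<lambda>g. g \<in> F"] by (simp add: C1_def C2_def)
  then have "q = sum_mset C1 + (sum_mset C2 - f)" using C(1) by (simp add: algebra_simps eq_diff_eq)
  moreover have "sum_mset C2 \<in> F" using face_gens[OF face, of C2] C(2) by (auto simp: C2_def)
  then have "sum_mset C2 - f \<in> group_closure F"
    using f(1) by (intro group_closure.diff group_closure.base) auto
  moreover have "set_mset C1 \<subseteq> gens - F" using C(2) by (auto simp: C1_def)
  ultimately show thesis using that by blast
qed

lemma gens_J: "gens - F \<subseteq> J"
  using gens_Q Q_Q' group_closure_Q_F by blast

lemma sum_power_sum_mset:
  "set_mset C \<subseteq> gens - F \<Longrightarrow> sum_mset C \<in> sum_power Q' J (size C)"
proof (induction C)
  case empty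
  show ?case using Q_Q'[OF Q_0] by simp
next
  case (add g C)
  then have "sum_mset C \<in> sum_power Q' J (size C)" "g \<in> J" using gens_J by auto
  then show ?case by (auto simp: add.commute[of g])
qed

text \<open>Each factor outside \<open>\<int>F\<close> contributes at least one generator outside \<open>F\<close>. Together with \<open>sum_power_sum_mset\<close>
  this says that powers of the ideal are generated by products of generators.\<close>

lemma sum_power_decompose:
  "j \<in> sum_power Q' J n \<Longrightarrow> \<exists>C q. set_mset C \<subseteq> gens - F \<and> size C = n \<and> q \<in> Q' \<and> j = sum_mset C + q"
proof (induction n arbitrary: j)
  case 0
  then show ?case by (intro exI[of _ "{#}"] exI[of _ j]) auto
next
  case (Suc n)
  then obtain a b where ab: "a \<in> sum_power Q' J n" "b \<in> J" "j = a + b" by auto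
  obtain C q where C: "set_mset C \<subseteq> gens - F" "size C = n" "q \<in> Q'" "a = sum_mset C + q"
    using Suc.IH[OF ab(1)] by blast
  have "b \<in> Q'" using ab by blast
  then obtain C1 z where b: "set_mset C1 \<subseteq> gens - F" "z \<in> group_closure F" "b = sum_mset C1 + z"
    by (rule Q'_decompose)
  have "C1 \<noteq> {#}" using b ab(2) by auto
  then obtain g C2 where C1: "C1 = add_mset g C2" by (meson multiset_cases)
  have "sum_mset C2 \<in> Q" using b C1 by (intro sum_gens_Q) auto
  moreover have "z \<in> Q'" using b group_closure_Q' by blast
  ultimately have "q + (sum_mset C2 + z) \<in> Q'" using C(3) Q'_add Q_Q' by simp
  moreover have "j = sum_mset (add_mset g C) + (q + (sum_mset C2 + z))"
    using ab C b C1 by (simp add: algebra_simps)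
  ultimately show ?case using C b C1 by (intro exI[of _ "add_mset g C"] exI[of _ "q + (sum_mset C2 + z)"]) auto
qed

lemma torsionD:
  assumes "t \<in> T"
  shows "t \<in> D'" and "\<exists>n. \<forall>j\<in>sum_power Q' J n. t + j \<notin> D'"
  using assms by (auto simp: torsion_degrees_def torsion_support_def)

lemma torsion_add_group:
  assumes t: "t \<in> T" and z: "z \<in> group_closure F"
  shows "t + z \<in> T"
proof -
  obtain n where n: "\<And>j. j \<in> sum_power Q' J n \<Longrightarrow> t + j \<notin> D'" using torsionD(2)[OF t] by blast
  have "t + z + j \<notin> D'" if "j \<in> sum_power Q' J n" for j
  proof
    assume "t + z + j \<in> D'"
    moreover have "- z \<in> group_closure F" using z by simp
    ultimately have "t + z + j + - z \<in> D'" by (rule D'_add_group)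
    then show False using n[OF that] by (simp add: algebra_simps)
  qed
  then show ?thesis
    using D'_add_group[OF torsionD(1)[OF t] z] by (auto simp: torsion_degrees_def torsion_support_def)
qed

lemma torsion_base_point:
  assumes "t \<in> T"
  obtains a where "a \<in> T" "a \<in> A" "a - t \<in> F"
proof -
  obtain f where f: "f \<in> F" "t + f \<in> A" using torsionD(1)[OF assms] by (auto simp: localize_def)
  have "t + f \<in> T" using f(1) by (intro torsion_add_group[OF assms] group_closure.base) auto
  then show thesis using that[of "t + f"] f by simp
qed

text \<open>Starting from a torsion degree, add as many exponents of the localized ring outside \<open>\<int>F\<close> as possible without leaving the
  support; the result is killed by every exponent outside \<open>\<int>F\<close> in the localization. Adding a common denominator from \<open>F\<close> turns the finitely
  many conditions, one for each generator outside \<open>F\<close>, into conditions in \<open>Q\<close>, \<open>A\<close> and \<open>B\<close> themselves.\<close>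

lemma torsion_witness:
  assumes t: "t \<in> T"
  shows "\<exists>a\<in>A - B. \<forall>q\<in>Q. a + q \<in> A - B \<longleftrightarrow> q \<in> F"
proof -
  define n where "n = (LEAST n. \<forall>j\<in>sum_power Q' J n. t + j \<notin> D')"
  have n: "\<forall>j\<in>sum_power Q' J n. t + j \<notin> D'"
    unfolding n_def using torsionD(2)[OF t] by (rule LeastI_ex)
  have "n \<noteq> 0" using n torsionD(1)[OF t] Q_Q'[OF Q_0] by (intro notI) force
  then obtain m where m: "n = Suc m" by (cases n) auto
  then have "\<not> (\<forall>j\<in>sum_power Q' J m. t + j \<notin> D')"
    using not_less_Least[of m "\<lambda>n. \<forall>j\<in>sum_power Q' J n. t + j \<notin> D'", folded n_def] by simp
  then obtain j where j: "j \<in> sum_power Q' J m" "t + j \<in> D'" by blast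
  have kill: "t + j + i \<in> B'" if "i \<in> J" for i
  proof -
    have "j + i \<in> sum_power Q' J n" using j(1) that m by auto
    then have "t + j + i \<notin> D'" using n by (simp add: add.assoc)
    moreover have "i + (t + j) \<in> A'" using that j(2) by (simp add: Q'_add_A' del: add.assoc)
    ultimately show ?thesis by (simp add: add.commute)
  qed
  obtain f0 where f0: "f0 \<in> F" "t + j + f0 \<in> A" using j(2) by (auto simp: localize_def)
  have B_F: "f + b \<in> B" if "f \<in> F" "b \<in> B" for f b using that F_Q B_add by blast
  have "(\<lambda>g. t + j + f0 + g) ` (gens - F) \<subseteq> B'"
  proof safe
    fix g assume g: "g \<in> gens" "g \<notin> F"
    then have "t + j + g \<in> B'" using gens_J by (intro kill) auto
    then have "f0 + (t + j + g) \<in> B'" using Q'_add_B' Q_Q' f0(1) F_Q by blast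
    then show "t + j + f0 + g \<in> B'" by (simp add: algebra_simps)
  qed
  then obtain f where f: "f \<in> F" "\<And>g. g \<in> gens - F \<Longrightarrow> f + (t + j + f0 + g) \<in> B"
    using localize_uniform[of B "(\<lambda>g. t + j + f0 + g) ` (gens - F)"] B_F finite_gens by auto
  define a where "a = t + j + f0 + f"
  have "t + j + (f0 + f) \<in> D'" using F_add[OF f0(1) f(1)]
    by (intro D'_add_group[OF j(2)] group_closure.base) auto
  then have aD: "a \<notin> B'" by (simp add: a_def add.assoc)
  have aA: "a \<in> A" using A_add[of f "t + j + f0"] f(1) F_Q f0(2) by (auto simp: a_def add.commute)
  have "a + q \<in> A - B \<longleftrightarrow> q \<in> F" if q: "q \<in> Q" for q
  proof
    assume aq: "a + q \<in> A - B"
    show "q \<in> F"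
    proof (rule ccontr)
      assume "q \<notin> F"
      obtain C where C: "q = sum_mset C" "set_mset C \<subseteq> gens" using q Q_gens by blast
      then obtain g where g: "g \<in># C" "g \<notin> F" using face_gens[OF face C(2)] \<open>q \<notin> F\<close> by blast
      then obtain C' where C': "C = add_mset g C'" by (meson multi_member_split)
      have "a + g \<in> B" using f(2)[of g] g C by (auto simp: a_def algebra_simps)
      moreover have "sum_mset C' \<in> Q" using C C' by (intro sum_gens_Q) auto
      ultimately have "sum_mset C' + (a + g) \<in> B" by (rule B_add[rotated])
      then show False using aq C C' by (simp add: algebra_simps)
    qed
  next
    assume "q \<in> F"
    then have "a + q \<notin> B" using aD by (auto simp: localize_def)
    then show "a + q \<in> A - B" using A_add[OF q aA] by (simp add: add.commute)
  qed
  moreover have "a \<in> A - B" using aA aD subset_localize[of B] by blast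
  ultimately show ?thesis by blast
qed

text \<open>Modulo \<open>\<int>F\<close>, a torsion degree is a generator degree \<open>a\<close> of the module plus a multiset of generators outside \<open>F\<close>. If
  infinitely many multisets occurred for one \<open>a\<close>, then by Dickson's lemma one of them could be enlarged arbitrarily
  and still give torsion degrees; but every torsion degree is killed by sufficiently large products.\<close>

lemma finite_torsion_cosets:
  assumes A0: "finite A0" "A \<subseteq> {a + q | a q. a \<in> A0 \<and> q \<in> Q}"
  shows "finite ((\<lambda>g. (+) g ` group_closure F) ` T)"
proof -
  define E where "E a = {C. set_mset C \<subseteq> gens - F \<and> a + sum_mset C \<in> T}" for a
  have "finite (E a)" for a
  proof (rule ccontr)
    assume "infinite (E a)"
    then obtain C where C: "C \<in> E a" "\<And>n. \<exists>X. C + X \<in> E a \<and> n \<le> size X"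
      using infinite_multisets_chain[of "E a" gens] finite_gens by (auto simp: E_def)
    then have "a + sum_mset C \<in> T" by (simp add: E_def)
    then obtain n where n: "\<And>j. j \<in> sum_power Q' J n \<Longrightarrow> a + sum_mset C + j \<notin> D'"
      using torsionD(2) by blast
    obtain X where X: "C + X \<in> E a" "n \<le> size X" using C(2) by blast
    then have "sum_mset X \<in> sum_power Q' J (size X)" by (intro sum_power_sum_mset) (auto simp: E_def)
    moreover have "sum_power Q' J (size X) \<subseteq> sum_power Q' J n"
      using X(2) by (intro sum_power_antimono Q'_add) auto
    ultimately have "a + sum_mset C + sum_mset X \<notin> D'" using n by blast
    moreover have "a + sum_mset (C + X) \<in> D'" using X(1) torsionD(1) by (simp add: E_def)
    ultimately show False by (simp add: add.assoc)
  qed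
  then have "finite (\<Union>a\<in>A0. (\<lambda>C. (+) (a + sum_mset C) ` group_closure F) ` E a)"
    using A0(1) by blast
  moreover have "(\<lambda>g. (+) g ` group_closure F) ` T \<subseteq>
      (\<Union>a\<in>A0. (\<lambda>C. (+) (a + sum_mset C) ` group_closure F) ` E a)"
  proof safe
    fix t assume t: "t \<in> T"
    then obtain s where s: "s \<in> T" "s \<in> A" "s - t \<in> F" by (rule torsion_base_point)
    then obtain a q where a: "a \<in> A0" "q \<in> Q" "s = a + q" using A0(2) by blast
    from Q_Q'[OF a(2)] obtain C z where C: "set_mset C \<subseteq> gens - F" "z \<in> group_closure F" "q = sum_mset C + z"
      by (rule Q'_decompose)
    have "s + - z \<in> T" using s C by (intro torsion_add_group) auto
    then have "C \<in> E a" using C a by (simp add: E_def)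
    moreover have "(+) t ` group_closure F = (+) (a + sum_mset C) ` group_closure F"
    proof -
      have w: "a + sum_mset C = t + (s - t - z)" using a C by (simp add: algebra_simps)
      have "s - t - z \<in> group_closure F"
        using group_closure.diff[OF group_closure.base[of "s - t"] C(2)] s(3) by simp
      then show ?thesis unfolding w by (rule coset_shift)
    qed
    ultimately show "(+) t ` group_closure F \<in> (\<Union>a\<in>A0. (\<lambda>C. (+) (a + sum_mset C) ` group_closure F) ` E a)"
      using a(1) by blast
  qed
  ultimately show ?thesis by (rule finite_subset[rotated])
qed

end

context affine_quotient
begin

text \<open>The units form the smallest face. It serves as a starting point for the choice of a maximal face: no unit moves a
  degree of \<open>A - B\<close> into \<open>B\<close>.\<close>

lemma group_elements_face: "is_face Q {q \<in> Q. - q \<in> Q}"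
  unfolding is_face_def
proof (intro conjI ballI)
  fix a b assume ab: "a \<in> Q" "b \<in> Q"
  show "a + b \<in> {q \<in> Q. - q \<in> Q} \<longleftrightarrow> a \<in> {q \<in> Q. - q \<in> Q} \<and> b \<in> {q \<in> Q. - q \<in> Q}"
  proof
    assume "a + b \<in> {q \<in> Q. - q \<in> Q}"
    then have "- (a + b) + b \<in> Q" "- (a + b) + a \<in> Q"
      using Q_add[of "- (a + b)" b] Q_add[of "- (a + b)" a] ab by simp_all
    then show "a \<in> {q \<in> Q. - q \<in> Q} \<and> b \<in> {q \<in> Q. - q \<in> Q}" using ab by simp
  next
    assume "a \<in> {q \<in> Q. - q \<in> Q} \<and> b \<in> {q \<in> Q. - q \<in> Q}"
    then have "- a + - b \<in> Q" using Q_add by blast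
    then show "a + b \<in> {q \<in> Q. - q \<in> Q}" using ab Q_add by (simp add: add.commute)
  qed
qed (use Q_0 in auto)

text \<open>This is the smallest face containing \<open>F\<close> and \<open>g\<close>: the elements that divide \<open>f + n g\<close> for some \<open>f\<close> and \<open>n\<close>.\<close>

lemma face_extension:
  assumes F: "is_face Q F" and g: "g \<in> Q"
  shows "is_face Q {q \<in> Q. \<exists>p\<in>Q. \<exists>f\<in>F. \<exists>n. q + p = f + sum_mset (replicate_mset n g)}" (is "is_face Q ?G")
  unfolding is_face_def
proof (intro conjI ballI)
  have "0 \<in> ?G" using Q_0 is_faceD(2)[OF F Q_0] by (auto intro!: bexI[of _ 0] exI[of _ 0])
  then show "?G \<noteq> {}" by blast
  fix a b assume ab: "a \<in> Q" "b \<in> Q"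
  show "a + b \<in> ?G \<longleftrightarrow> a \<in> ?G \<and> b \<in> ?G"
  proof
    assume "a + b \<in> ?G"
    then obtain p f n where "p \<in> Q" "f \<in> F" "a + b + p = f + sum_mset (replicate_mset n g)" by blast
    then have "b + p \<in> Q" "a + p \<in> Q" "f \<in> F" "a + (b + p) = f + sum_mset (replicate_mset n g)"
      "b + (a + p) = f + sum_mset (replicate_mset n g)"
      using ab Q_add by (simp_all add: add_ac)
    then show "a \<in> ?G \<and> b \<in> ?G" using ab by blast
  next
    assume "a \<in> ?G \<and> b \<in> ?G"
    then obtain p f n p' f' n' where *: "p \<in> Q" "f \<in> F" "a + p = f + sum_mset (replicate_mset n g)"
      "p' \<in> Q" "f' \<in> F" "b + p' = f' + sum_mset (replicate_mset n' g)" by blast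
    have "a + b + (p + p') = (a + p) + (b + p')" by (simp add: add_ac)
    also have "\<dots> = (f + f') + sum_mset (replicate_mset (n + n') g)"
      unfolding * by (simp add: sum_mset_replicate_add add_ac)
    finally show "a + b \<in> ?G" using Q_add[OF ab] Q_add[OF *(1,4)] is_faceD(3)[OF F Q_0 *(2,5)] by blast
  qed
qed auto

text \<open>
  Take \<open>F\<close> maximal among the faces with \<open>a + F\<close> disjoint from \<open>B\<close>. For every generator \<open>g\<close> outside \<open>F\<close> the face
  spanned by \<open>F\<close> and \<open>g\<close> is larger, so a multiple of \<open>g\<close> moves \<open>a\<close> into the localization of \<open>B\<close>. A
  sufficiently long product of such generators contains one of these multiples by the pigeonhole principle.
\<close>

lemma exists_torsion_face:
  assumes a: "a \<in> A - B"
  shows "\<exists>F. is_face Q F \<and> a \<in> torsion_degrees Q A B F"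
proof -
  define alive where "alive F \<longleftrightarrow> is_face Q F \<and> (\<forall>f\<in>F. a + f \<notin> B)" for F
  have "alive {q \<in> Q. - q \<in> Q}"
    unfolding alive_def using group_elements_face
  proof (intro conjI ballI notI)
    fix f assume "f \<in> {q \<in> Q. - q \<in> Q}" "a + f \<in> B"
    then have "- f + (a + f) \<in> B" using B_add[of "- f" "a + f"] by simp
    then show False using a by simp
  qed
  moreover have "\<forall>F. alive F \<longrightarrow> card (gens \<inter> F) < Suc (card gens)"
    using finite_gens by (auto intro: le_imp_less_Suc card_mono)
  ultimately obtain F where F: "alive F" "\<And>G. alive G \<Longrightarrow> card (gens \<inter> G) \<le> card (gens \<inter> F)"
    using ex_has_greatest_nat[of alive _ "\<lambda>F. card (gens \<inter> F)"] by blast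
  have face: "is_face Q F" using F(1) by (simp add: alive_def)
  interpret affine_quotient_face Q A B gens F using face by unfold_locales
  have "\<exists>n. a + sum_mset (replicate_mset n g) \<in> B'" if g: "g \<in> gens - F" for g
  proof -
    define G where "G = {q \<in> Q. \<exists>p\<in>Q. \<exists>f\<in>F. \<exists>n. q + p = f + sum_mset (replicate_mset n g)}"
    have gQ: "g \<in> Q" using g gens_Q by blast
    have G: "is_face Q G" unfolding G_def by (rule face_extension[OF face gQ])
    have "F \<subseteq> G" 
    proof
      fix f assume "f \<in> F"
      moreover have "f + 0 = f + sum_mset (replicate_mset 0 g)" by simp
      ultimately show "f \<in> G" unfolding G_def using F_Q Q_0 by blast
    qed
    moreover have "g \<in> G" using gQ Q_0 F_0 by (auto simp: G_def intro!: bexI[of _ 0] exI[of _ "1 :: nat"])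
    ultimately have "card (gens \<inter> F) < card (gens \<inter> G)"
      using g finite_gens by (intro psubset_card_mono) auto
    then have "\<not> alive G" using F(2)[of G] by auto
    then obtain b where b: "b \<in> G" "a + b \<in> B" using G by (auto simp: alive_def)
    then obtain p f n where p: "p \<in> Q" "f \<in> F" "b + p = f + sum_mset (replicate_mset n g)"
      unfolding G_def by blast
    have "a + sum_mset (replicate_mset n g) + f = p + (a + b)"
      using p(3) by (simp add: algebra_simps)
    also have "\<dots> \<in> B" using p(1) b(2) by (rule B_add)
    finally show ?thesis using p(2) unfolding localize_def by blast
  qed
  then obtain n where n: "\<And>g. g \<in> gens - F \<Longrightarrow> a + sum_mset (replicate_mset (n g) g) \<in> B'"
    by metis
  \<comment> \<open>one more than can be distributed without some generator \<open>g\<close> reaching multiplicity \<open>n g\<close>\<close>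
  define N where "N = Suc (\<Sum>g\<in>gens - F. n g)"
  have "a + j \<notin> D'" if j: "j \<in> sum_power Q' J N" for j
  proof -
    obtain C q where C: "set_mset C \<subseteq> gens - F" "size C = N" "q \<in> Q'" "j = sum_mset C + q"
      using sum_power_decompose[OF j] by blast
    have "\<exists>g\<in>gens - F. n g \<le> count C g"
    proof (rule ccontr)
      assume "\<not> ?thesis"
      then have "count C g \<le> n g" if "g \<in> gens - F" for g using that by (metis linear)
      then have "(\<Sum>g\<in>gens - F. count C g) \<le> (\<Sum>g\<in>gens - F. n g)" by (rule sum_mono)
      moreover have "size C = (\<Sum>g\<in>gens - F. count C g)"
        unfolding size_multiset_overloaded_eq
        using C(1) finite_gens by (intro sum.mono_neutral_left) (auto simp: not_in_iff)
      ultimately show False using C(2) by (simp add: N_def)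
    qed
    then obtain g where g: "g \<in> gens - F" "n g \<le> count C g" by blast
    then obtain X where X: "C = replicate_mset (n g) g + X"
      unfolding count_le_replicate_mset_subset_eq by (auto simp: mset_subset_eq_exists_conv)
    have "sum_mset X \<in> Q" using C(1) X by (intro sum_gens_Q) auto
    then have "sum_mset X + q \<in> Q'" using C(3) Q'_add Q_Q' by simp
    then have "(sum_mset X + q) + (a + sum_mset (replicate_mset (n g) g)) \<in> B'"
      using n[OF g(1)] by (rule Q'_add_B')
    then show ?thesis by (simp add: C(4) X add_ac)
  qed
  moreover have "a \<in> D'"
    using a F(1) subset_localize[of A] by (auto simp: alive_def localize_def)
  ultimately have "a \<in> T" by (auto simp: torsion_degrees_def torsion_support_def)
  then show ?thesis using face by blast
qed

lemma face_coset_eq: "face_coset F q = {x. x - q \<in> group_closure F}"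
  by (force simp: face_coset_def intro: image_eqI[of _ _ "x - q" for x])

lemma face_coset_cong:
  assumes "x \<in> face_coset F q"
  shows "face_coset F q = face_coset F x"
proof -
  have x: "x - q \<in> group_closure F" using assms by (simp add: face_coset_eq)
  have "y - q \<in> group_closure F \<longleftrightarrow> y - x \<in> group_closure F" for y
    using group_closure.diff[of "y - q" F "x - q"] group_closure_add[of "y - x" F "x - q"] x by auto
  then show ?thesis by (auto simp: face_coset_eq)
qed

text \<open>
  Let \<open>a\<close> be a torsion degree in \<open>A\<close> and \<open>f\<close> the sum of the generators in \<open>F\<close>. Two of the infinitely many
  degrees \<open>a + n f\<close> lie in the same member \<open>\<int>G + p\<close> of the family, so a positive multiple of \<open>f\<close> lies in \<open>\<int>G\<close>, hence in
  \<open>G\<close>, and therefore \<open>F \<subseteq> G\<close>. If \<open>G\<close> had an element \<open>g\<close> outside \<open>F\<close>, then a multiple of \<open>g\<close> plus an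
  element of \<open>F\<close> would move \<open>a\<close> into \<open>B\<close> without leaving \<open>\<int>G + p\<close>, although this coset does not meet \<open>B\<close>.
\<close>

lemma torsion_coset_in_cover:
  assumes face: "is_face Q F" and t: "t \<in> torsion_degrees Q A B F"
    and I: "finite I" and G: "\<And>i. i \<in> I \<Longrightarrow> is_face Q (G i)"
    and cover: "A - B = (\<Union>i\<in>I. face_coset (G i) (p i) \<inter> A)"
  shows "\<exists>i\<in>I. G i = F \<and> face_coset (G i) (p i) = face_coset F t"
proof -
  interpret affine_quotient_face Q A B gens F using face by unfold_locales
  obtain a where a: "a \<in> T" "a \<in> A" "a - t \<in> F" using t by (rule torsion_base_point)
  have fin: "finite (gens \<inter> F)" using finite_gens by simp
  \<comment> \<open>the multiples of the sum of the generators in \<open>F\<close>\<close>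
  define m where "m n = sum_mset (repeat_mset n (mset_set (gens \<inter> F)))" for n
  have mF: "m n \<in> F" for n
    unfolding m_def using fin by (subst face_gens[OF face]) (auto simp: mem_repeat_mset)
  have m_add: "m (k + n) = m k + m n" for k n
  proof -
    have rep: "repeat_mset (k + n) M = repeat_mset k M + repeat_mset n M" for M :: "'g multiset"
      by (intro multiset_eqI) (simp add: algebra_simps)
    show ?thesis unfolding m_def rep by (rule sum_mset.union)
  qed
  have aD: "a + m n \<in> A - B" for n
  proof -
    have "m n + a \<in> A" using mF F_Q a(2) by (intro A_add) auto
    moreover have "a + m n \<notin> B" using torsionD(1)[OF a(1)] mF[of n] by (auto simp: localize_def)
    ultimately show ?thesis by (simp add: add.commute)
  qed
  have "\<forall>n. \<exists>i. i \<in> I \<and> a + m n \<in> face_coset (G i) (p i)" using aD cover by blast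
  then obtain c where c: "\<And>n. c n \<in> I" "\<And>n. a + m n \<in> face_coset (G (c n)) (p (c n))" by metis
  have "\<not> inj c"
    using finite_subset[of "range c" I] I c(1) finite_imageD[of c UNIV] by auto
  then obtain k l where kl: "k < l" "c k = c l" by (metis injI linorder_neqE_nat)
  define i where "i = c k"
  interpret Gi: affine_quotient_face Q A B gens "G i" using G[OF c(1)] unfolding i_def by unfold_locales
  have l: "m l = m k + m (l - k)" using m_add[of k "l - k"] kl(1) by simp
  have "a + m k - p i \<in> group_closure (G i)" "a + m l - p i \<in> group_closure (G i)"
    using c(2)[of k] c(2)[of l] kl(2) by (simp_all add: face_coset_eq i_def)
  then have "(a + m l - p i) - (a + m k - p i) \<in> group_closure (G i)" by (rule group_closure.diff[rotated])
  then have "m (l - k) \<in> group_closure (G i)" using l by simp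
  then have mG: "m (l - k) \<in> G i" using mF F_Q by (intro Gi.group_closure_Q_F) auto
  have FG: "F \<subseteq> G i"
  proof (subst face_subset_iff[OF face Gi.face])
    have "set_mset (repeat_mset (l - k) (mset_set (gens \<inter> F))) \<subseteq> G i"
      using mG fin unfolding m_def by (subst (asm) face_gens[OF Gi.face]) (auto simp: mem_repeat_mset)
    then show "gens \<inter> F \<subseteq> G i" using fin kl(1) by (auto simp: subset_iff mem_repeat_mset)
  qed
  have "a + m k - m k - p i \<in> group_closure (G i)"
  proof -
    have "a + m k - p i - m k \<in> group_closure (G i)"
      using \<open>a + m k - p i \<in> group_closure (G i)\<close>
      by (rule group_closure.diff) (use mF FG in \<open>auto intro: group_closure.base\<close>)
    then show ?thesis by (simp add: algebra_simps)
  qed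
  then have coset: "face_coset (G i) (p i) = face_coset (G i) a"
    by (intro face_coset_cong) (simp add: face_coset_eq)
  have "G i \<subseteq> F"
  proof
    fix g assume g: "g \<in> G i"
    show "g \<in> F"
    proof (rule ccontr)
      assume gF: "g \<notin> F"
      have gQ: "g \<in> Q" using g Gi.F_Q by blast
      have gJ: "g \<in> J" using gF gQ Q_Q' group_closure_Q_F by blast
      have gn: "sum_mset (replicate_mset n g) \<in> sum_power Q' J n \<and> sum_mset (replicate_mset n g) \<in> G i" for n
      proof (induction n)
        case (Suc n)
        then show ?case using gJ g Gi.F_add by (auto simp: add.commute[of g])
      qed (use Q_Q'[OF Q_0] Gi.F_0 in simp)
      obtain n where "\<And>j. j \<in> sum_power Q' J n \<Longrightarrow> a + j \<notin> D'" using torsionD(2)[OF a(1)] by blast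
      then have "a + sum_mset (replicate_mset n g) \<notin> D'" using gn by blast
      moreover have gA: "sum_mset (replicate_mset n g) + a \<in> A"
        using gn Gi.F_Q a(2) by (intro A_add) auto
      then have "a + sum_mset (replicate_mset n g) \<in> A'"
        using subset_localize[of A] by (auto simp: add.commute)
      ultimately obtain h where h: "h \<in> F" "a + sum_mset (replicate_mset n g) + h \<in> B"
        by (auto simp: localize_def)
      have "sum_mset (replicate_mset n g) + h \<in> G i" using gn h(1) FG Gi.F_add by blast
      then have "a + sum_mset (replicate_mset n g) + h \<in> face_coset (G i) (p i)"
        unfolding coset unfolding face_coset_eq by (auto simp: add.assoc intro: group_closure.base)
      moreover have "h + (sum_mset (replicate_mset n g) + a) \<in> A" using h(1) F_Q gA by (intro A_add[OF _ gA]) auto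
      then have "a + sum_mset (replicate_mset n g) + h \<in> A" by (simp add: add_ac)
      moreover have "i \<in> I" using c(1) by (simp add: i_def)
      ultimately have "a + sum_mset (replicate_mset n g) + h \<in> A - B" using cover by blast
      then show False using h(2) by blast
    qed
  qed
  then have "G i = F" using FG by blast
  moreover have "face_coset F t = face_coset F a"
    using a(3) by (intro face_coset_cong) (auto simp: face_coset_eq intro: group_closure.base)
  ultimately show ?thesis using coset c(1) unfolding i_def by metis
qed

end

section \<open>Associated primes\<close>

text \<open>The positive elements of a total order compatible with addition. With such an order the
  leading term of a product is the product of the leading terms.\<close>

locale positive_cone =
  fixes pos :: "'g::ab_group_add \<Rightarrow> bool"
  assumes pos_add: "\<And>x y. pos x \<Longrightarrow> pos y \<Longrightarrow> pos (x + y)"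
    and not_pos_0: "\<not> pos 0"
    and pos_total: "\<And>x. x \<noteq> 0 \<Longrightarrow> pos x \<or> pos (- x)"
begin

definition leading :: "('g \<Rightarrow>\<^sub>0 'k::zero) \<Rightarrow> 'g \<Rightarrow> bool"
  where "leading f a \<longleftrightarrow> a \<in> keys f \<and> (\<forall>k\<in>keys f. k \<noteq> a \<longrightarrow> pos (a - k))"

lemma ex_leading:
  assumes "f \<noteq> 0"
  obtains a where "leading f a"
proof -
  have "\<exists>m\<in>K. \<forall>k\<in>K. k \<noteq> m \<longrightarrow> pos (m - k)" if "finite K" "K \<noteq> {}" for K :: "'g set"
    using that
  proof (induction K rule: finite_ne_induct)
    case (insert x K)
    then obtain m where m: "m \<in> K" "\<forall>k\<in>K. k \<noteq> m \<longrightarrow> pos (m - k)" by blast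
    have "x \<noteq> m" using m insert by blast
    then consider "pos (m - x)" | "pos (x - m)" using pos_total[of "m - x"] by auto
    then show ?case
    proof cases
      case 2
      have "pos (x - k)" if "k \<in> K" for k
        using pos_add[OF 2, of "m - k"] m(2) 2 that by (cases "k = m") auto
      then show ?thesis by blast
    qed (use m in blast)
  qed simp
  from this[of "keys f"] show thesis
    using assms that by (auto simp: leading_def)
qed

lemma lookup_leading_mult:
  fixes f g :: "'g \<Rightarrow>\<^sub>0 'k::field"
  assumes f: "leading f a" and g: "leading g b"
  shows "lookup (f * g) (a + b) = lookup f a * lookup g b"
proof -
  define f' where "f' = trunc (- {a}) f"
  have f_eq: "f = single a (lookup f a) + f'"
    by (rule poly_mapping_eqI) (auto simp: f'_def lookup_add lookup_single lookup_trunc when_def)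
  have "a + b \<notin> keys (f' * g)"
  proof
    assume "a + b \<in> keys (f' * g)"
    then obtain k l where kl: "k \<in> keys f" "k \<noteq> a" "l \<in> keys g" "a + b = k + l"
      using keys_mult[of f' g] by (auto simp: f'_def keys_trunc)
    then have pos: "pos (a - k)" "l = b \<or> pos (b - l)" using f g by (auto simp: leading_def)
    have "(a - k) + (b - l) = 0" using kl(4) by (simp add: algebra_simps)
    then show False using pos pos_add[of "a - k" "b - l"] not_pos_0 kl(2) by auto
  qed
  then have "lookup (f' * g) (a + b) = 0" by (simp add: in_keys_iff)
  then show ?thesis
    by (subst f_eq) (simp add: distrib_right lookup_add lookup_single_mult)
qed

lemma mult_eq_0_imp:
  fixes f g :: "'g \<Rightarrow>\<^sub>0 'k::field"
  assumes "f * g = 0"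
  shows "f = 0 \<or> g = 0"
proof (rule ccontr)
  assume "\<not> ?thesis"
  then obtain a b where "leading f a" "leading g b" using ex_leading by metis
  then show False using lookup_leading_mult[of f a g b] assms by (auto simp: leading_def in_keys_iff)
qed

end

text \<open>Lexicographic order: the first nonzero coordinate decides, for an arbitrary enumeration \<open>e\<close> of the coordinates.\<close>

lemma lexicographic_cone:
  "\<exists>pos :: int ^ 'n \<Rightarrow> bool. positive_cone pos"
proof -
  obtain e :: "'n \<Rightarrow> nat" where e: "inj e"
    using finite_imp_inj_to_nat_seg[of "UNIV :: 'n set"] by auto
  define pos where "pos x \<longleftrightarrow> (\<exists>i. x $ i > 0 \<and> (\<forall>j. e j < e i \<longrightarrow> x $ j = 0))" for x :: "int ^ 'n"
  have "positive_cone pos"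
  proof
    fix x y assume "pos x" "pos y"
    then obtain i k where i: "x $ i > 0" "\<forall>j. e j < e i \<longrightarrow> x $ j = 0"
      and k: "y $ k > 0" "\<forall>j. e j < e k \<longrightarrow> y $ j = 0" by (auto simp: pos_def)
    consider "e i < e k" | "i = k" | "e k < e i" using e by (metis injD linorder_neqE_nat)
    then show "pos (x + y)"
    proof cases
      case 1 then show ?thesis unfolding pos_def using i k by (intro exI[of _ i]) auto
    next
      case 2 then show ?thesis unfolding pos_def using i k by (intro exI[of _ i]) auto
    next
      case 3 then show ?thesis unfolding pos_def using i k by (intro exI[of _ k]) auto
    qed
  next
    fix x :: "int ^ 'n" assume "x \<noteq> 0"
    then obtain i0 where "x $ i0 \<noteq> 0" by (auto simp: vec_eq_iff)
    then obtain i where i: "x $ i \<noteq> 0" "\<And>j. x $ j \<noteq> 0 \<Longrightarrow> e i \<le> e j"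
      using ex_has_least_nat[of "\<lambda>i. x $ i \<noteq> 0" i0 e] by blast
    then have "\<forall>j. e j < e i \<longrightarrow> x $ j = 0" by (meson not_le)
    then show "pos x \<or> pos (- x)" unfolding pos_def using i(1) by (cases "x $ i > 0") (auto intro!: exI[of _ i])
  qed (auto simp: pos_def)
  then show ?thesis by blast
qed

lemma monoid_algebra_cring:
  assumes Q: "0 \<in> Q" "\<And>p q. p \<in> Q \<Longrightarrow> q \<in> Q \<Longrightarrow> p + q \<in> (Q :: 'g::ab_group_add set)"
  shows "cring (monoid_algebra Q :: ('g \<Rightarrow>\<^sub>0 'k::field) ring)"
proof (rule cringI)
  show "abelian_group (monoid_algebra Q :: ('g \<Rightarrow>\<^sub>0 'k) ring)"
  proof (rule abelian_groupI)
    fix x :: "'g \<Rightarrow>\<^sub>0 'k" assume "x \<in> carrier (monoid_algebra Q)"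
    then show "\<exists>y\<in>carrier (monoid_algebra Q). y \<oplus>\<^bsub>monoid_algebra Q\<^esub> x = \<zero>\<^bsub>monoid_algebra Q\<^esub>"
      by (intro bexI[of _ "- x"]) (auto simp: monoid_algebra_def)
  qed (auto simp: monoid_algebra_def add_ac dest!: subsetD[OF keys_add])
  show "comm_monoid (monoid_algebra Q :: ('g \<Rightarrow>\<^sub>0 'k) ring)"
  proof (rule comm_monoidI)
    fix x y :: "'g \<Rightarrow>\<^sub>0 'k" assume "x \<in> carrier (monoid_algebra Q)" "y \<in> carrier (monoid_algebra Q)"
    then show "x \<otimes>\<^bsub>monoid_algebra Q\<^esub> y \<in> carrier (monoid_algebra Q)"
      using span_on_mult[of x Q y Q Q] Q(2) by (simp add: monoid_algebra_def span_on_def)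
  qed (use Q(1) in \<open>auto simp: monoid_algebra_def mult_ac keys_one\<close>)
qed (simp add: monoid_algebra_def distrib_right)

context positive_cone
begin

text \<open>The quotient by the prime of \<open>F\<close> is \<open>K[F]\<close>, which is a domain because leading terms multiply.\<close>

lemma face_prime_primeideal:
  assumes Q: "0 \<in> Q" "\<And>p q. p \<in> Q \<Longrightarrow> q \<in> Q \<Longrightarrow> p + q \<in> Q" and F: "is_face Q F"
  shows "primeideal (face_prime Q F :: ('g \<Rightarrow>\<^sub>0 'k::field) set) (monoid_algebra Q)"
proof -
  let ?R = "monoid_algebra Q :: ('g \<Rightarrow>\<^sub>0 'k) ring"
  let ?p = "face_prime Q F :: ('g \<Rightarrow>\<^sub>0 'k) set"
  interpret cring ?R by (rule monoid_algebra_cring[OF Q])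
  have p: "?p = span_on (Q - F)" by (simp add: face_prime_def span_on_def)
  have R: "carrier ?R = span_on Q" by (simp add: monoid_algebra_def span_on_def)
  have QF: "a + b \<in> Q - F" if "a \<in> Q - F" "b \<in> Q" for a b
    using that F Q(2) unfolding is_face_def by blast
  show ?thesis
  proof (rule primeidealI)
    show "ideal ?p ?R"
    proof (rule idealI)
      show "ring ?R" by (rule ring_axioms)
      have "\<ominus>\<^bsub>?R\<^esub> x = - x" if "x \<in> carrier ?R" for x
        by (rule minus_equality) (use that in \<open>auto simp: monoid_algebra_def\<close>)
      then have inv: "inv\<^bsub>add_monoid ?R\<^esub> x = - x" if "x \<in> span_on Q" for x
        using that by (simp add: a_inv_def R)
      show "subgroup ?p (add_monoid ?R)"
      proof
        show "?p \<subseteq> carrier (add_monoid ?R)" by (auto simp: p R span_on_def)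
        fix x y assume x: "x \<in> ?p" and y: "y \<in> ?p"
        then show "x \<otimes>\<^bsub>add_monoid ?R\<^esub> y \<in> ?p" by (simp add: p monoid_algebra_def span_on_add)
        have xQ: "x \<in> span_on Q" using x by (auto simp: p span_on_def)
        show "inv\<^bsub>add_monoid ?R\<^esub> x \<in> ?p" 
          unfolding inv[OF xQ] using x unfolding p by (rule span_on_uminus)
      qed (simp add: p monoid_algebra_def)
      fix a x assume "a \<in> ?p" "x \<in> carrier ?R"
      then have "a * x \<in> span_on (Q - F)" unfolding p R by (rule span_on_mult) (rule QF)
      then show "x \<otimes>\<^bsub>?R\<^esub> a \<in> ?p" "a \<otimes>\<^bsub>?R\<^esub> x \<in> ?p"
        by (simp_all add: p monoid_algebra_def mult.commute)
    qed
    show "cring ?R" by (rule is_cring)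
    have "1 \<in> span_on Q" "1 \<notin> ?p"
      using Q(1) is_faceD(2)[OF F Q(1)] by (auto simp: p span_on_def)
    then show "carrier ?R \<noteq> ?p" using R by metis
    fix f g assume f: "f \<in> carrier ?R" and g: "g \<in> carrier ?R" and fg: "f \<otimes>\<^bsub>?R\<^esub> g \<in> ?p"
    \<comment> \<open>modulo the ideal both factors may be replaced by their parts supported on \<open>F\<close>\<close>
    have split: "h - trunc F h \<in> span_on (Q - F)" if "h \<in> span_on Q" for h :: "'g \<Rightarrow>\<^sub>0 'k"
      using that by (auto simp: span_on_def in_keys_iff lookup_minus lookup_trunc split: if_splits)
    have FQ: "trunc F h \<in> span_on Q" for h :: "'g \<Rightarrow>\<^sub>0 'k"
      using is_faceD(1)[OF F Q(1)] by (auto simp: span_on_def keys_trunc)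
    have FF: "trunc F f * trunc F g \<in> span_on F"
      by (rule span_on_mult[OF trunc_in_span_on trunc_in_span_on]) (rule is_faceD(3)[OF F Q(1)])
    have fg_eq: "trunc F f * trunc F g = f * g - (f - trunc F f) * g - (g - trunc F g) * trunc F f"
      by (simp add: algebra_simps)
    have "(f - trunc F f) * g \<in> span_on (Q - F)" "(g - trunc F g) * trunc F f \<in> span_on (Q - F)"
      using f g FQ split QF unfolding R by (blast intro: span_on_mult)+
    moreover have "f * g \<in> span_on (Q - F)" using fg by (simp add: p monoid_algebra_def)
    ultimately have "trunc F f * trunc F g \<in> span_on (Q - F)"
      unfolding fg_eq by (intro span_on_diff)
    with FF have "keys (trunc F f * trunc F g) = {}" unfolding span_on_def by blast
    then have "trunc F f = 0 \<or> trunc F g = 0" using mult_eq_0_imp[of "trunc F f" "trunc F g"] by simp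
    then show "f \<in> ?p \<or> g \<in> ?p" using split[of f] split[of g] f g by (auto simp: p R)
  qed
qed

end

lemma face_prime_inj:
  assumes "F \<subseteq> Q" "G \<subseteq> Q" "(face_prime Q F :: ('g::ab_group_add \<Rightarrow>\<^sub>0 'k::field) set) = face_prime Q G"
  shows "F = G"
proof -
  have "q \<in> Q - H \<longleftrightarrow> single q 1 \<in> (face_prime Q H :: ('g \<Rightarrow>\<^sub>0 'k) set)" for q H
    by (simp add: face_prime_def)
  then have "Q - F = Q - G" using assms(3) by blast
  then show ?thesis using assms(1,2) by blast
qed

lemma face_of_prime_face_prime:
  assumes "0 \<in> Q" "is_face Q F"
  shows "face_of_prime Q (face_prime Q F :: ('g::ab_group_add \<Rightarrow>\<^sub>0 'k::field) set) = F"
  unfolding face_of_prime_def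
proof (rule the_equality)
  fix G assume "is_face Q G \<and> (face_prime Q F :: ('g \<Rightarrow>\<^sub>0 'k) set) = face_prime Q G"
  then show "G = F"
    using face_prime_inj[of G Q F] is_faceD(1)[OF _ assms(1)] assms(2) by metis
qed (use assms in simp)

locale graded_truncated_module = positive_cone pos + truncated_module "monoid_algebra Q" "\<lambda>a. a" Q N NC \<theta> A B
  for pos :: "'g::ab_group_add \<Rightarrow> bool" and Q :: "'g set"
    and N :: "('g \<Rightarrow>\<^sub>0 'k::field, 'm, 'd) module_scheme" and NC \<theta> A B
begin

text \<open>The annihilator of a monomial is spanned by monomials, and here these are the ones outside \<open>F\<close>.\<close>

lemma face_prime_associated:
  assumes F: "is_face Q F" and a: "a \<in> A - B" "\<And>q. q \<in> Q \<Longrightarrow> a + q \<in> A - B \<longleftrightarrow> q \<in> F"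
  shows "face_prime Q F \<in> associated_primes (monoid_algebra Q) N"
proof -
  have "r \<odot>\<^bsub>N\<^esub> \<theta> (single a 1) = \<zero>\<^bsub>N\<^esub> \<longleftrightarrow> r \<in> face_prime Q F" if "r \<in> span_on Q" for r
  proof -
    have "r \<odot>\<^bsub>N\<^esub> \<theta> (single a 1) = \<theta> (trunc (A - B) (r * single a 1))"
      using that a(1) by (intro N_smult) (auto simp: span_on_single)
    then have "r \<odot>\<^bsub>N\<^esub> \<theta> (single a 1) = \<zero>\<^bsub>N\<^esub> \<longleftrightarrow> keys (single a 1 * r) \<inter> (A - B) = {}"
      by (simp add: N_zero theta_eq_iff trunc_eq_0_iff mult.commute)
    also have "\<dots> \<longleftrightarrow> (\<forall>k\<in>keys r. a + k \<notin> A - B)" by (auto simp: keys_single_mult)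
    also have "\<dots> \<longleftrightarrow> r \<in> face_prime Q F" using that a(2) by (auto simp: face_prime_def span_on_def)
    finally show ?thesis .
  qed
  moreover have "face_prime Q F \<subseteq> (span_on Q :: ('g \<Rightarrow>\<^sub>0 'k) set)" by (auto simp: face_prime_def span_on_def)
  ultimately have "face_prime Q F = {r \<in> carrier (monoid_algebra Q). r \<odot>\<^bsub>N\<^esub> \<theta> (single a 1) = \<zero>\<^bsub>N\<^esub>}"
    unfolding R_carrier by auto
  moreover have "\<theta> (single a 1) \<in> carrier N" using a(1) by (simp add: N_carrier span_on_single)
  ultimately show ?thesis
    unfolding associated_primes_def using face_prime_primeideal[OF Q_0 Q_add F] by blast
qed

text \<open>Stated for polynomials supported on \<open>A - B\<close> instead of the elements of \<open>N\<close> that they represent.\<close>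

definition annihilator :: "('g \<Rightarrow>\<^sub>0 'k) \<Rightarrow> ('g \<Rightarrow>\<^sub>0 'k) set"
  where "annihilator v = {r \<in> span_on Q. trunc (A - B) (r * v) = 0}"

lemma mult_span_A:
  assumes "r \<in> span_on Q" "v \<in> span_on (A - B)"
  shows "r * (v :: 'g \<Rightarrow>\<^sub>0 'k) \<in> span_on A"
  using assms by (rule span_on_mult) (use A_add in auto)

lemma trunc_mult_assoc:
  assumes "a \<in> span_on Q" "r \<in> span_on Q" "v \<in> span_on (A - B)"
  shows "trunc (A - B) (a * trunc (A - B) (r * v)) = trunc (A - B) (a * r * (v :: 'g \<Rightarrow>\<^sub>0 'k))"
  using trunc_mult_trunc[OF assms(1) mult_span_A[OF assms(2,3)], of B "A - B"] B_add
  by (auto simp: mult.assoc)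

lemma Q_mult: "a \<in> span_on Q \<Longrightarrow> r \<in> span_on Q \<Longrightarrow> a * (r :: 'g \<Rightarrow>\<^sub>0 'k) \<in> span_on Q"
  by (rule span_on_mult[OF _ _ Q_add])

lemma annihilator_mult:
  assumes "a \<in> span_on Q" "r \<in> annihilator v" "v \<in> span_on (A - B)"
  shows "a * r \<in> annihilator v"
  using trunc_mult_assoc[of a r v] assms by (simp add: annihilator_def Q_mult)

lemma annihilator_add: "r \<in> annihilator v \<Longrightarrow> s \<in> annihilator v \<Longrightarrow> r + s \<in> annihilator v"
  by (simp add: annihilator_def span_on_add distrib_right trunc_add)

lemma annihilator_diff: "r \<in> annihilator v \<Longrightarrow> s \<in> annihilator v \<Longrightarrow> r - s \<in> annihilator v"
  by (simp add: annihilator_def span_on_diff left_diff_distrib trunc_diff)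

text \<open>Let \<open>v\<close> have as few monomials as possible among the elements with its annihilator. If the leading term of some
  \<open>r\<close> in the annihilator did not kill \<open>v\<close>, its product with \<open>v\<close> would have the same annihilator, by primality, but fewer
  monomials, because the product of the two leading terms vanishes. So leading terms can be split off one by one.\<close>

lemma prime_annihilator_monomials:
  assumes v: "v \<in> span_on (A - B)"
    and prime: "\<And>a b. a \<in> span_on Q \<Longrightarrow> b \<in> span_on Q \<Longrightarrow> a * b \<in> annihilator v \<Longrightarrow>
      a \<in> annihilator v \<or> b \<in> annihilator v"
    and min: "\<And>w. w \<in> span_on (A - B) \<Longrightarrow> annihilator w = annihilator v \<Longrightarrow> card (keys v) \<le> card (keys w)"
  shows "r \<in> annihilator v \<Longrightarrow> k \<in> keys r \<Longrightarrow> single k (lookup r k) \<in> annihilator v"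
proof (induction "card (keys r)" arbitrary: r rule: less_induct)
  case less
  have rQ: "r \<in> span_on Q" and rv: "keys (r * v) \<inter> (A - B) = {}"
    using less.prems(1) by (auto simp: annihilator_def trunc_eq_0_iff)
  have "r \<noteq> 0" using less.prems(2) by auto
  then obtain a where a: "leading r a" by (rule ex_leading)
  define c where "c = lookup r a"
  have ac: "a \<in> keys r" "c \<noteq> 0" using a by (auto simp: leading_def c_def in_keys_iff)
  have mQ: "single a c \<in> span_on Q" using ac(1) rQ by (auto simp: span_on_single span_on_def)
  have lead: "single a c \<in> annihilator v"
  proof (rule ccontr)
    assume not: "single a c \<notin> annihilator v"
    define w where "w = trunc (A - B) (single a c * v)"
    have "annihilator w = annihilator v"
    proof (intro Set.equalityI subsetI)
      fix s assume s: "s \<in> annihilator w"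
      then have "s * single a c \<in> annihilator v"
        using mQ v trunc_mult_assoc[of s "single a c" v] by (auto simp: annihilator_def w_def Q_mult)
      then show "s \<in> annihilator v" using prime[of s "single a c"] not mQ s by (auto simp: annihilator_def)
    next
      fix s assume s: "s \<in> annihilator v"
      then have "single a c * s \<in> annihilator v" using mQ v by (intro annihilator_mult)
      then show "s \<in> annihilator w"
        using s mQ v trunc_mult_assoc[of s "single a c" v] mult.commute[of "single a c" s]
        by (auto simp: annihilator_def w_def)
    qed
    then have le: "card (keys v) \<le> card (keys w)" by (intro min) (simp_all add: w_def)
    have "v \<noteq> 0" using not mQ by (auto simp: annihilator_def)
    then obtain d where d: "leading v d" by (rule ex_leading)
    \<comment> \<open>this monomial does not cancel in \<open>r * v\<close>, which is zero in the module\<close>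
    have "lookup (r * v) (a + d) \<noteq> 0"
      using lookup_leading_mult[OF a d] a d by (auto simp: leading_def in_keys_iff)
    then have "a + d \<notin> A - B" using rv by (auto simp: in_keys_iff)
    then have "keys w \<subseteq> (+) a ` (keys v - {d})"
      using ac(2) by (auto simp: w_def keys_trunc keys_single_mult)
    then have "card (keys w) \<le> card (keys v - {d})"
      using card_mono[of "(+) a ` (keys v - {d})" "keys w"] card_image_le[of "keys v - {d}" "(+) a"] by simp
    also have "\<dots> < card (keys v)" using d by (intro psubset_card_mono) (auto simp: leading_def)
    finally show False using le by simp
  qed
  show ?case
  proof (cases "k = a")
    case False
    define s where "s = r - single a c"
    have look: "lookup s x = (if x = a then 0 else lookup r x)" for x
      by (auto simp: s_def lookup_minus lookup_single c_def when_def)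
    then have keys: "keys s = keys r - {a}" by (auto simp: in_keys_iff split: if_splits)
    have "card (keys s) < card (keys r)" using ac(1) unfolding keys by (intro card_Diff1_less) simp_all
    moreover have "s \<in> annihilator v" unfolding s_def using less.prems(1) lead by (rule annihilator_diff)
    moreover have "k \<in> keys s" using less.prems(2) False by (simp add: keys)
    ultimately have "single k (lookup s k) \<in> annihilator v" by (rule less.hyps)
    then show ?thesis using False by (simp add: look)
  qed (use lead c_def in simp)
qed

text \<open>By the previous lemma an associated prime is spanned by monomials; the exponents of the remaining monomials form a face
  because the ideal is prime.\<close>

lemma associated_prime_face:
  assumes p: "p \<in> associated_primes (monoid_algebra Q) N"
  shows "\<exists>F. is_face Q F \<and> p = face_prime Q F"
proof -
  have R: "carrier (monoid_algebra Q) = (span_on Q :: ('g \<Rightarrow>\<^sub>0 'k) set)" using R_carrier by simp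
  have ann: "{r \<in> carrier (monoid_algebra Q). r \<odot>\<^bsub>N\<^esub> \<theta> v = \<zero>\<^bsub>N\<^esub>} = annihilator v"
    if "v \<in> span_on (A - B)" for v
    using that by (auto simp: annihilator_def R N_smult N_zero theta_eq_iff)
  obtain v0 where "v0 \<in> span_on (A - B)" "p = annihilator v0"
    using p ann by (auto simp: associated_primes_def N_carrier)
  then obtain v where v: "v \<in> span_on (A - B)" "p = annihilator v"
    and min: "\<And>w. w \<in> span_on (A - B) \<Longrightarrow> p = annihilator w \<Longrightarrow> card (keys v) \<le> card (keys w)"
    using ex_has_least_nat[of "\<lambda>v. v \<in> span_on (A - B) \<and> p = annihilator v" v0 "\<lambda>v. card (keys v)"] by blast
  interpret p: primeideal p "monoid_algebra Q" using p by (auto simp: associated_primes_def)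
  have prime: "a \<in> annihilator v \<or> b \<in> annihilator v"
    if "a \<in> span_on Q" "b \<in> span_on Q" "a * b \<in> annihilator v" for a b
    using p.I_prime[of a b] that v(2) R by (auto simp: monoid_algebra_def)
  have one: "1 \<notin> p"
  proof
    assume "1 \<in> p"
    then have "a \<in> p" if "a \<in> span_on Q" for a using annihilator_mult[OF that _ v(1), of 1] v(2) by simp
    then show False using p.I_notcarr R v(2) by (auto simp: annihilator_def)
  qed
  have scale: "single k c \<in> p \<longleftrightarrow> single k 1 \<in> p" if "c \<noteq> 0" for k c
  proof -
    have "single k (d * e) \<in> p" if "single k e \<in> p" for d e
      using annihilator_mult[of "single 0 d" "single k e" v] that v Q_0 by (simp add: span_on_single mult_single)
    from this[of c "inverse c"] this[of 1 c] this[of c 1] this[of "inverse c" c] show ?thesis using that by auto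
  qed
  define F where "F = {q \<in> Q. single q 1 \<notin> p}"
  have "is_face Q F"
    unfolding is_face_def
  proof (intro conjI ballI)
    have "0 \<in> F" using Q_0 one by (simp add: F_def)
    then show "F \<noteq> {}" by blast
    fix a b assume ab: "a \<in> Q" "b \<in> Q"
    have "single a 1 * single b 1 \<in> p \<longleftrightarrow> single a 1 \<in> p \<or> single b 1 \<in> p"
      using prime[of "single a 1" "single b 1"] annihilator_mult[of "single a 1" "single b 1" v]
        annihilator_mult[of "single b 1" "single a 1" v] ab v by (auto simp: span_on_single mult.commute)
    then show "a + b \<in> F \<longleftrightarrow> a \<in> F \<and> b \<in> F" using ab Q_add by (simp add: F_def mult_single)
  qed (auto simp: F_def)
  moreover have "p = face_prime Q F"
  proof (intro Set.equalityI subsetI)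
    fix r assume r: "r \<in> p"
    have "k \<in> Q - F" if k: "k \<in> keys r" for k
    proof -
      have "single k (lookup r k) \<in> annihilator v"
        using prime_annihilator_monomials[OF v(1) prime, of r k] min r k v(2) by simp
      then have "single k 1 \<in> p" using scale[of "lookup r k" k] k v(2) by (simp add: in_keys_iff)
      moreover have "k \<in> Q" using r k v(2) by (auto simp: annihilator_def span_on_def)
      ultimately show ?thesis by (simp add: F_def)
    qed
    then show "r \<in> face_prime Q F" by (auto simp: face_prime_def)
  next
    fix r :: "'g \<Rightarrow>\<^sub>0 'k" assume "r \<in> face_prime Q F"
    then have "r \<in> span_on (Q - F)" by (simp add: face_prime_def span_on_def)
    then show "r \<in> p"
    proof (induction r rule: span_on_induct)
      case zero
      show ?case using v(2) by (simp add: annihilator_def)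
    next
      case (single g c)
      then show ?case using scale[of c g] by (auto simp: F_def)
    next
      case (add f h)
      then show ?case using annihilator_add v(2) by blast
    qed
  qed
  ultimately show ?thesis by blast
qed

end

section \<open>The decomposition of the support\<close>

lemma submonoid_hull_sum_mset:
  "(\<lambda>H. 0 \<in> H \<and> (\<forall>a\<in>H. \<forall>b\<in>H. a + b \<in> H)) hull S = sum_mset ` {C. set_mset C \<subseteq> (S :: 'g::comm_monoid_add set)}"
  (is "?P hull S = ?Q")
proof
  have "S \<subseteq> ?Q"
  proof
    fix s assume "s \<in> S"
    then show "s \<in> ?Q" by (intro image_eqI[of _ _ "{#s#}"]) auto
  qed
  moreover have "?P ?Q"
  proof (intro conjI ballI)
    show "0 \<in> ?Q" by (intro image_eqI[of _ _ "{#}"]) auto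
    fix a b assume "a \<in> ?Q" "b \<in> ?Q"
    then obtain C D where "a = sum_mset C" "b = sum_mset D" "set_mset C \<subseteq> S" "set_mset D \<subseteq> S" by blast
    then show "a + b \<in> ?Q" by (intro image_eqI[of _ _ "C + D"]) auto
  qed
  ultimately show "?P hull S \<subseteq> ?Q" by (rule hull_minimal)
  have P: "?P (?P hull S)" by (rule hull_in) auto
  have "set_mset C \<subseteq> S \<Longrightarrow> sum_mset C \<in> ?P hull S" for C
    using P by (induction C) (auto simp: hull_inc)
  then show "?Q \<subseteq> ?P hull S" by blast
qed

lemma face_coset_plus: "face_coset F q = (+) q ` group_closure F"
  by (simp add: face_coset_def add.commute)

context affine_quotient
begin

text \<open>The combinatorial form of the theorem, for any index set that corresponds to a set of faces containing all those with
  torsion degrees. The representatives \<open>q p i\<close> come from a numbering of the cosets of \<open>T\<^sub>F\<close>.\<close>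

lemma coset_decomposition:
  fixes r :: "'p \<Rightarrow> enat" and face :: "'p \<Rightarrow> 'g set"
  assumes A_Q: "A \<subseteq> group_closure Q" and A0: "finite A0" "A \<subseteq> {a + q | a q. a \<in> A0 \<and> q \<in> Q}"
    and inj: "inj_on face P" and face: "\<And>p. p \<in> P \<Longrightarrow> is_face Q (face p)"
    and onto: "\<And>F. is_face Q F \<Longrightarrow> torsion_degrees Q A B F \<noteq> {} \<Longrightarrow> F \<in> face ` P"
    and r: "\<And>p. p \<in> P \<Longrightarrow> r p = enat (card (face_coset (face p) ` torsion_degrees Q A B (face p)))"
  shows "\<exists>q :: 'p \<Rightarrow> nat \<Rightarrow> 'g.
      let I = (SIGMA p : P. {i. 1 \<le> i \<and> enat i \<le> r p});
          C = (\<lambda>(p, i). face_coset (face p) (q p i))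
      in (\<forall>(p, i) \<in> I. q p i \<in> group_closure Q) \<and>
         A - B = (\<Union>j\<in>I. C j \<inter> A) \<and>
         irredundant_union I (\<lambda>j. C j \<inter> A) \<and>
         (\<forall>(l::nat) G t. (\<forall>j\<in>{1..l}. is_face Q (G j) \<and> t j \<in> group_closure Q) \<and>
            A - B = (\<Union>j\<in>{1..l}. face_coset (G j) (t j) \<inter> A) \<and>
            irredundant_union {1..l} (\<lambda>j. face_coset (G j) (t j) \<inter> A)
            \<longrightarrow> (\<lambda>j. face_coset (G j) (t j)) ` {1..l} = C ` I)"
proof -
  define T where "T p = torsion_degrees Q A B (face p)" for p
  define k where "k p = card (face_coset (face p) ` T p)" for p
  have fin: "finite (face_coset (face p) ` T p)" if "p \<in> P" for p
  proof -
    interpret affine_quotient_face Q A B gens "face p" using face[OF that] by unfold_locales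
    show ?thesis using finite_torsion_cosets[OF A0] by (simp add: face_coset_plus T_def)
  qed
  define enum where "enum p h \<longleftrightarrow> inj_on (\<lambda>i. face_coset (face p) (h i)) {1..k p} \<and> h ` {1..k p} \<subseteq> T p \<and>
      (\<lambda>i. face_coset (face p) (h i)) ` {1..k p} = face_coset (face p) ` T p"
    for p and h :: "nat \<Rightarrow> 'g"
  have "\<exists>h :: nat \<Rightarrow> 'g. enum p h" if pP: "p \<in> P" for p
  proof -
    obtain e where e: "bij_betw e {1..k p} (face_coset (face p) ` T p)"
      using ex_bij_betw_nat_finite_1[OF fin[OF pP]] unfolding k_def by blast
    define h where "h = inv_into (T p) (face_coset (face p)) \<circ> e"
    have h: "face_coset (face p) (h i) = e i" "h i \<in> T p" if "i \<in> {1..k p}" for i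
    proof -
      have "e i \<in> face_coset (face p) ` T p" using bij_betwE[OF e] that by blast
      then show "face_coset (face p) (h i) = e i" "h i \<in> T p"
        unfolding h_def comp_def by (rule f_inv_into_f, rule inv_into_into)
    qed
    have "inj_on (\<lambda>i. face_coset (face p) (h i)) {1..k p}"
      using bij_betw_imp_inj_on[OF e] h(1) by (subst inj_on_cong[of _ _ e]) auto
    moreover have "h ` {1..k p} \<subseteq> T p" using h(2) by blast
    moreover have "(\<lambda>i. face_coset (face p) (h i)) ` {1..k p} = e ` {1..k p}"
      by (intro image_cong refl h(1))
    then have "(\<lambda>i. face_coset (face p) (h i)) ` {1..k p} = face_coset (face p) ` T p"
      unfolding bij_betw_imp_surj_on[OF e] .
    ultimately have "enum p h" unfolding enum_def by blast
    then show ?thesis by blast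
  qed
  then obtain q where "\<And>p. p \<in> P \<Longrightarrow> enum p (q p)" by metis
  then have q: "\<And>p. p \<in> P \<Longrightarrow> inj_on (\<lambda>i. face_coset (face p) (q p i)) {1..k p}"
    "\<And>p. p \<in> P \<Longrightarrow> q p ` {1..k p} \<subseteq> T p"
    "\<And>p. p \<in> P \<Longrightarrow> (\<lambda>i. face_coset (face p) (q p i)) ` {1..k p} = face_coset (face p) ` T p"
    by (simp_all add: enum_def)
  define I where "I = (SIGMA p : P. {1..k p})"
  define C where "C = (\<lambda>(p, i). face_coset (face p) (q p i))"
  have I_eq: "(SIGMA p : P. {i. 1 \<le> i \<and> enat i \<le> r p}) = I"
    using r by (auto simp: I_def k_def T_def)
  have finP: "finite P"
    by (rule inj_on_finite[OF inj _ finite_faces]) (use face in auto)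
  have finI: "finite I" unfolding I_def using finP by blast
  have qT: "q p i \<in> T p" if "(p, i) \<in> I" for p i
    using subsetD[OF q(2)[of p] imageI[of i]] that unfolding I_def by blast
  have 1: "q p i \<in> group_closure Q" if "(p, i) \<in> I" for p i
  proof -
    have p: "p \<in> P" using that by (simp add: I_def)
    interpret affine_quotient_face Q A B gens "face p" using face[OF p] by unfold_locales
    have "q p i \<in> localize (face p) A" using torsionD(1) qT[OF that] by (simp add: T_def)
    then obtain f where "f \<in> face p" "q p i + f \<in> A" by (auto simp: localize_def)
    then have "q p i + f \<in> group_closure Q" "f \<in> group_closure Q"
      using A_Q F_Q by (auto intro: group_closure.base)
    then have "q p i + f - f \<in> group_closure Q" by (rule group_closure.diff)
    then show ?thesis by simp
  qed
  have 2: "A - B = (\<Union>j\<in>I. C j \<inter> A)"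
  proof (intro Set.equalityI subsetI)
    fix a assume a: "a \<in> A - B"
    then obtain F where F: "is_face Q F" "a \<in> torsion_degrees Q A B F" using exists_torsion_face by blast
    then obtain p where p: "p \<in> P" "F = face p" using onto by blast
    then have "face_coset (face p) a \<in> (\<lambda>i. face_coset (face p) (q p i)) ` {1..k p}"
      using q(3)[OF p(1)] F(2) by (simp add: T_def)
    then obtain i where "(p, i) \<in> I" "C (p, i) = face_coset (face p) a"
      using p(1) by (auto simp: I_def C_def)
    moreover have "a \<in> face_coset (face p) a" by (simp add: face_coset_eq)
    ultimately show "a \<in> (\<Union>j\<in>I. C j \<inter> A)" using a by blast
  next
    fix a assume "a \<in> (\<Union>j\<in>I. C j \<inter> A)"
    then obtain p i where pi: "(p, i) \<in> I" "a \<in> face_coset (face p) (q p i)" "a \<in> A" by (auto simp: C_def)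
    have p: "p \<in> P" using pi by (simp add: I_def)
    interpret affine_quotient_face Q A B gens "face p" using face[OF p] by unfold_locales
    have "q p i + (a - q p i) \<in> torsion_degrees Q A B (face p)"
      using qT[OF pi(1)] pi(2) by (intro torsion_add_group) (auto simp: T_def face_coset_eq)
    then have "a \<notin> localize (face p) B" using torsionD(1) by simp
    then show "a \<in> A - B" using pi(3) subset_localize[of B] by blast
  qed
  have cover: "\<exists>j\<in>X. G j = face p \<and> face_coset (G j) (t j) = C (p, i)"
    if "(p, i) \<in> I" "finite X" "\<And>j. j \<in> X \<Longrightarrow> is_face Q (G j)" "A - B = (\<Union>j\<in>X. face_coset (G j) (t j) \<inter> A)"
    for p i and X :: "'x set" and G t
    using torsion_coset_in_cover[OF _ _ that(2,3,4), of "face p" "q p i"] qT[OF that(1)] face that(1)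
    by (simp add: T_def I_def C_def)
  have 3: "irredundant_union I (\<lambda>j. C j \<inter> A)"
    unfolding irredundant_union_def
  proof safe
    fix p i assume pi: "(p, i) \<in> I" and eq: "(\<Union>j\<in>I - {(p, i)}. C j \<inter> A) = (\<Union>j\<in>I. C j \<inter> A)"
    have C': "C j = face_coset (face (fst j)) (q (fst j) (snd j))" for j
      by (simp add: C_def split: prod.split)
    have "\<exists>j\<in>I - {(p, i)}. face (fst j) = face p \<and> face_coset (face (fst j)) (q (fst j) (snd j)) = C (p, i)"
    proof (rule cover[OF pi])
      show "finite (I - {(p, i)})" using finI by simp
      show "is_face Q (face (fst j))" if "j \<in> I - {(p, i)}" for j
        using face that by (auto simp: I_def)
      show "A - B = (\<Union>j\<in>I - {(p, i)}. face_coset (face (fst j)) (q (fst j) (snd j)) \<inter> A)"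
        using 2 eq by (simp add: C')
    qed
    then obtain j0 where j0: "j0 \<in> I - {(p, i)}" "face (fst j0) = face p"
      "face_coset (face (fst j0)) (q (fst j0) (snd j0)) = C (p, i)" by blast
    obtain p' i' where "j0 = (p', i')" by (cases j0)
    with j0 have j: "(p', i') \<in> I" "(p', i') \<noteq> (p, i)" "face p' = face p"
      "face_coset (face p') (q p' i') = face_coset (face p) (q p i)" by (simp_all add: C_def)
    have "p' = p" using inj j(1,3) pi by (auto simp: I_def dest: inj_onD)
    then have "i' = i" using inj_onD[OF q(1)[of p]] j pi by (auto simp: I_def)
    then show False using j(2) \<open>p' = p\<close> by simp
  qed
  have 4: "(\<lambda>j. face_coset (G j) (t j)) ` {1..l} = C ` I"
    if G: "\<forall>j\<in>{1..l}. is_face Q (G j) \<and> t j \<in> group_closure Q"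
      and eq: "A - B = (\<Union>j\<in>{1..l}. face_coset (G j) (t j) \<inter> A)"
      and irr: "irredundant_union {1..l} (\<lambda>j. face_coset (G j) (t j) \<inter> A)" for l :: nat and G t
  proof (intro Set.equalityI subsetI)
    fix X assume "X \<in> C ` I"
    then obtain p i where pi: "(p, i) \<in> I" "X = C (p, i)" by auto
    have "\<exists>j\<in>{1..l}. G j = face p \<and> face_coset (G j) (t j) = C (p, i)"
      by (rule cover[OF pi(1) _ _ eq]) (use G in auto)
    then show "X \<in> (\<lambda>j. face_coset (G j) (t j)) ` {1..l}" using pi(2) by auto
  next
    fix X assume "X \<in> (\<lambda>j. face_coset (G j) (t j)) ` {1..l}"
    then obtain j where j: "j \<in> {1..l}" "X = face_coset (G j) (t j)" by auto
    show "X \<in> C ` I"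
    proof (rule ccontr)
      assume not: "X \<notin> C ` I"
      \<comment> \<open>if the \<open>j\<close>-th coset is not one of the torsion cosets, these already occur among the others\<close>
      have "A - B \<subseteq> (\<Union>m\<in>{1..l} - {j}. face_coset (G m) (t m) \<inter> A)"
      proof
        fix a assume "a \<in> A - B"
        then obtain p i where pi: "(p, i) \<in> I" "a \<in> C (p, i)" "a \<in> A" unfolding 2 by auto
        have "\<exists>m\<in>{1..l}. G m = face p \<and> face_coset (G m) (t m) = C (p, i)"
          by (rule cover[OF pi(1) _ _ eq]) (use G in auto)
        then obtain m where m: "m \<in> {1..l}" "face_coset (G m) (t m) = C (p, i)" by blast
        then have "m \<noteq> j" using not j(2) pi(1) by auto
        then show "a \<in> (\<Union>m\<in>{1..l} - {j}. face_coset (G m) (t m) \<inter> A)" using m pi by blast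
      qed
      moreover have "(\<Union>m\<in>{1..l} - {j}. face_coset (G m) (t m) \<inter> A) \<subseteq> A - B" unfolding eq by blast
      ultimately have "(\<Union>m\<in>{1..l} - {j}. face_coset (G m) (t m) \<inter> A) = A - B" by blast
      then show False using irr j(1) eq unfolding irredundant_union_def by metis
    qed
  qed
  show ?thesis
    unfolding Let_def I_eq
  proof (rule exI[of _ q], fold C_def, intro conjI)
    show "\<forall>(p, i)\<in>I. q p i \<in> group_closure Q" using 1 by blast
  qed (use 2 3 4 in auto)
qed

end

text \<open>The exponents of the finitely many generators suffice, as they span a graded submodule containing the generators.\<close>

lemma generated_support:
  fixes A :: "'g::ab_group_add set" and N :: "('g \<Rightarrow>\<^sub>0 'k::field, 'g \<Rightarrow>\<^sub>0 'k, 'd) module_scheme"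
  assumes N: "truncated_module (monoid_algebra Q) (\<lambda>a. a) Q N NC (\<lambda>a. a) A {}"
    and fg: "finitely_generated_module (monoid_algebra Q) N"
  shows "\<exists>A0. finite A0 \<and> A \<subseteq> {a + q | a q. a \<in> A0 \<and> q \<in> Q}"
proof -
  interpret truncated_module "monoid_algebra Q" "\<lambda>a. a" Q N NC "\<lambda>a. a" A "{}" by (rule N)
  have carrier: "carrier N = span_on A" using N_carrier by simp
  obtain X where X: "finite X" "X \<subseteq> span_on A" "span_on A = (\<lambda>H. submodule H (monoid_algebra Q) N) hull X"
    using fg by (auto simp: finitely_generated_module_def carrier)
  define A0 where "A0 = \<Union> (keys ` X)"
  define V where "V = {a + q | a q. a \<in> A0 \<and> q \<in> Q}"
  have A0: "finite A0" "A0 \<subseteq> A" using X(1,2) by (auto simp: A0_def span_on_def)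
  have "truncated_ideal Q (A - {}) V"
    unfolding truncated_ideal_def
  proof (intro conjI ballI impI)
    show "V \<subseteq> A - {}" using A0(2) A_add by (fastforce simp: V_def add.commute)
    fix w q assume "w \<in> V" "q \<in> Q"
    then obtain a p where "a \<in> A0" "p + q \<in> Q" "w + q = a + (p + q)" using Q_add by (auto simp: V_def add.assoc)
    then show "w + q \<in> V" unfolding V_def by blast
  qed
  then have "submodule (span_on V) (monoid_algebra Q) N"
    using graded_submodule_theta_image by (simp add: graded_submodule_def)
  moreover have "X \<subseteq> span_on V"
  proof
    fix x assume "x \<in> X"
    then have "keys x \<subseteq> A0" by (auto simp: A0_def)
    moreover have "A0 \<subseteq> V"
    proof
      fix a assume "a \<in> A0"
      then have "a + 0 \<in> V" unfolding V_def using Q_0 by blast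
      then show "a \<in> V" by simp
    qed
    ultimately show "x \<in> span_on V" by (auto simp: span_on_def)
  qed
  ultimately have "span_on A \<subseteq> (span_on V :: ('g \<Rightarrow>\<^sub>0 'k) set)"
    unfolding X(3) by (intro hull_minimal)
  then have "A \<subseteq> V" using theta_image_subset_iff[of A V] \<open>truncated_ideal Q (A - {}) V\<close>
    by (simp add: truncated_ideal_def)
  then show ?thesis using A0(1) unfolding V_def by blast
qed

theorem theorem3p1:
  fixes Q :: "(int ^ 'n) set"
    and M U :: "((int ^ 'n) \<Rightarrow>\<^sub>0 'k::field) set"
  defines "R \<equiv> monoid_algebra Q :: ((int ^ 'n) \<Rightarrow>\<^sub>0 'k) ring"
    and "RC \<equiv> monoid_algebra_grading Q :: int ^ 'n \<Rightarrow> ((int ^ 'n) \<Rightarrow>\<^sub>0 'k) set"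
    and "P \<equiv> self_module (monoid_algebra (group_closure Q) :: ((int ^ 'n) \<Rightarrow>\<^sub>0 'k) ring)"
    and "PC \<equiv> monoid_algebra_grading (group_closure Q) :: int ^ 'n \<Rightarrow> ((int ^ 'n) \<Rightarrow>\<^sub>0 'k) set"
  defines "Mm \<equiv> P\<lparr>carrier := M\<rparr>" and "MC \<equiv> \<lambda>g. M \<inter> PC g"
  defines "N \<equiv> quotient_module Mm U" and "NC \<equiv> quotient_grading Mm MC U"
  defines "r \<equiv> multiplicity_on R RC N NC"
  assumes "affine_monoid Q"
    and "graded_submodule R P PC M" and "finitely_generated_module R Mm"
    and "graded_submodule R P PC U" and "finitely_generated_module R (P\<lparr>carrier := U\<rparr>)"
    and "U \<subseteq> M"
  shows "(\<forall>p \<in> associated_primes R N. r p \<noteq> \<infinity>) \<and>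
    (\<exists>q :: ((int ^ 'n) \<Rightarrow>\<^sub>0 'k) set \<Rightarrow> nat \<Rightarrow> int ^ 'n.
      let I = (SIGMA p : associated_primes R N. {i. 1 \<le> i \<and> enat i \<le> r p});
          C = (\<lambda>(p, i). face_coset (face_of_prime Q p) (q p i))
      in (\<forall>(p, i) \<in> I. q p i \<in> group_closure Q) \<and>
         Supp N NC = (\<Union>j\<in>I. C j \<inter> Supp Mm MC) \<and>
         irredundant_union I (\<lambda>j. C j \<inter> Supp Mm MC) \<and>
         (\<forall>(l::nat) (G :: nat \<Rightarrow> (int ^ 'n) set) (t :: nat \<Rightarrow> int ^ 'n).
            (\<forall>j\<in>{1..l}. is_face Q (G j) \<and> t j \<in> group_closure Q) \<and>
            Supp N NC = (\<Union>j\<in>{1..l}. face_coset (G j) (t j) \<inter> Supp Mm MC) \<and>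
            irredundant_union {1..l} (\<lambda>j. face_coset (G j) (t j) \<inter> Supp Mm MC)
            \<longrightarrow> (\<lambda>j. face_coset (G j) (t j)) ` {1..l} = C ` I))"
proof -
  obtain gens where gens: "finite gens" "Q = sum_mset ` {C. set_mset C \<subseteq> gens}"
    using \<open>affine_monoid Q\<close> unfolding affine_monoid_def submonoid_hull_sum_mset by blast
  have Q_0: "0 \<in> Q" unfolding gens(2) by (intro image_eqI[of _ _ "{#}"]) auto
  have Q_add: "p + q \<in> Q" if pq: "p \<in> Q" "q \<in> Q" for p q
  proof -
    obtain C D where "p = sum_mset C" "q = sum_mset D" "set_mset C \<subseteq> gens" "set_mset D \<subseteq> gens"
      using pq unfolding gens(2) by blast
    then show ?thesis unfolding gens(2) by (intro image_eqI[of _ _ "C + D"]) auto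
  qed
  interpret P: truncated_module R "\<lambda>a. a" Q P PC "\<lambda>a. a" "group_closure Q" "{}"
    unfolding R_def P_def PC_def
    by (rule self_module_truncated) (auto simp: Q_0 Q_add group_closure.base group_closure_add)
  obtain A where A: "truncated_ideal Q (group_closure Q - {}) A" "M = (\<lambda>a. a) ` span_on A"
    using \<open>graded_submodule R P PC M\<close> by (rule P.graded_submoduleE)
  obtain B where B: "truncated_ideal Q (group_closure Q - {}) B" "U = (\<lambda>a. a) ` span_on B"
    using \<open>graded_submodule R P PC U\<close> by (rule P.graded_submoduleE)
  have A_Q: "A \<subseteq> group_closure Q" and B_Q: "B \<subseteq> group_closure Q"
    using A(1) B(1) by (auto simp: truncated_ideal_def)
  have BA: "B \<subseteq> A"
    using P.theta_image_subset_iff[of B A] \<open>U \<subseteq> M\<close> A_Q B_Q A(2) B(2) by simp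
  have Mm: "truncated_module R (\<lambda>a. a) Q Mm MC (\<lambda>a. a) (A \<union> {}) {}"
    using P.restrict[OF A(1)] unfolding Mm_def MC_def A(2) .
  interpret M: truncated_module R "\<lambda>a. a" Q Mm MC "\<lambda>a. a" A "{}" using Mm by simp
  have M: "M = span_on A" and U: "U = span_on B" using A(2) B(2) by simp_all
  interpret affine_quotient Q A B gens
  proof
    fix q b assume q: "q \<in> Q" "b \<in> B"
    then have "b + q \<in> group_closure Q" using B_Q group_closure_add[of b Q q] group_closure.base[of q Q] by auto
    then show "q + b \<in> B" using B(1) q unfolding truncated_ideal_def by (metis Diff_empty add.commute)
  qed (use Q_0 Q_add M.A_add BA gens in auto)
  obtain pos :: "int ^ 'n \<Rightarrow> bool" where pos: "positive_cone pos" using lexicographic_cone by blast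
  have N_trunc: "truncated_module R (\<lambda>a. a) Q N NC coset_of A B"
    unfolding R_def N_def NC_def U
  proof (rule quotient_truncated)
    show "MC g = span_on (A \<inter> {g})" for g using M.NC_eq by simp
  qed (simp_all add: Mm_def P_def self_module_def monoid_algebra_def M)
  then interpret N: graded_truncated_module pos Q N NC coset_of A B
    using pos unfolding R_def by (rule graded_truncated_module.intro[rotated])
  obtain A0 where A0: "finite A0" "A \<subseteq> {a + q | a q. a \<in> A0 \<and> q \<in> Q}"
    using generated_support[OF M.truncated_module_axioms[unfolded R_def]] \<open>finitely_generated_module R Mm\<close>
    unfolding R_def by blast
  have Ass: "\<exists>F. is_face Q F \<and> p = face_prime Q F" if "p \<in> associated_primes R N" for p
    using N.associated_prime_face that unfolding R_def by blast
  have face: "is_face Q (face_of_prime Q p)" "p = face_prime Q (face_of_prime Q p)"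
    if "p \<in> associated_primes R N" for p
    using Ass[OF that] face_of_prime_face_prime[OF Q_0] by metis+
  have r: "r p = enat (card (face_coset (face_of_prime Q p) ` torsion_degrees Q A B (face_of_prime Q p)))"
    if p: "p \<in> associated_primes R N" for p
  proof -
    interpret F: affine_quotient_face Q A B gens "face_of_prime Q p" using face(1)[OF p] by unfold_locales
    interpret L: localizable_module Q N NC coset_of A B "face_of_prime Q p" using face(1)[OF p] by unfold_locales
    show ?thesis
      using L.multiplicity_on_face_prime[OF F.finite_torsion_cosets[OF A0]] face(2)[OF p]
      unfolding r_def R_def RC_def face_coset_plus by simp
  qed
  have Supp: "Supp N NC = A - B" "Supp Mm MC = A" using N.Supp_eq M.Supp_eq by simp_all
  have "\<forall>p\<in>associated_primes R N. r p \<noteq> \<infinity>" using r by simp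
  then show ?thesis
    unfolding Supp
  proof (intro conjI coset_decomposition[OF A_Q A0 _ _ _ r])
    show "inj_on (face_of_prime Q) (associated_primes R N)"
      using face(2) by (metis inj_onI)
    fix F assume F: "is_face Q F" "torsion_degrees Q A B F \<noteq> {}"
    interpret F: affine_quotient_face Q A B gens F using F(1) by unfold_locales
    obtain a where "a \<in> A - B" "\<And>q. q \<in> Q \<Longrightarrow> a + q \<in> A - B \<longleftrightarrow> q \<in> F"
      using F.torsion_witness F(2) by blast
    then have "face_prime Q F \<in> associated_primes R N"
      using N.face_prime_associated[OF F(1)] unfolding R_def by blast
    then show "F \<in> face_of_prime Q ` associated_primes R N"
      using face_of_prime_face_prime[OF Q_0 F(1)] by (metis image_eqI)
  qed (use face(1) in auto)
qed

end
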